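(* Let $(R,\mathfrak m)$ be a $2$-dimensional Cohen-Macaulay local ring with infinite residue field, $I$ an $\mathfrak m$-primary ideal, $K$ an ideal containing $I$, and $J$ a minimal reduction of $I$. If $KI\cap J=KJ$, then $$r_J^K(I)\le g_1-\lambda(KI/KJ)+1+\lambda(R/K).$$
   Context: $\lambda$ denotes length of $R$-modules. The $K$-reduction number of $I$ with respect to $J$ is $r_J^K(I)=\min\{n\ge0\mid KI^{n+1}=KJI^n\}$. The function $n\mapsto\lambda(R/KI^n)$ agrees for $n\gg0$ with a polynomial $P_K(I,n)$ of degree $2$; the integers $g_0,g_1,g_2$ are defined by $P_K(I,n)=g_0\binom{n+1}{2}-g_1 n+g_2$. *)

theory Defs
  imports
    "HOL-Algebra.Algebra"
    "HOL-Library.Extended_Nat"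
begin

section \<open>Cohen-Macaulay local rings\<close>

locale noetherian_local_ring = cring R + noetherian_ring R
  for R (structure) and \<mm> +
  assumes maximal: "maximalideal \<mm> R"
    and unique_maximal: "maximalideal M R \<Longrightarrow> M = \<mm>"

definition krull_dim :: "('a, 'b) ring_scheme \<Rightarrow> enat" where
  "krull_dim R = Sup {enat n | n.
     \<exists>P :: nat \<Rightarrow> 'a set. (\<forall>i\<le>n. primeideal (P i) R) \<and> (\<forall>i<n. P i \<subset> P (Suc i))}"

definition nonzerodivisor :: "('a, 'b) ring_scheme \<Rightarrow> 'a \<Rightarrow> bool" where
  "nonzerodivisor R x \<longleftrightarrow>
     x \<in> carrier R \<and> (\<forall>y\<in>carrier R. x \<otimes>\<^bsub>R\<^esub> y = \<zero>\<^bsub>R\<^esub> \<longrightarrow> y = \<zero>\<^bsub>R\<^esub>)"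

definition regular_sequence :: "('a, 'b) ring_scheme \<Rightarrow> 'a list \<Rightarrow> bool" where
  "regular_sequence R xs \<longleftrightarrow>
     set xs \<subseteq> carrier R \<and>
     (\<forall>i<length xs. let Q = Idl\<^bsub>R\<^esub> (set (take i xs))
                    in nonzerodivisor (R Quot Q) (Q +>\<^bsub>R\<^esub> (xs ! i))) \<and>
     Idl\<^bsub>R\<^esub> (set xs) \<noteq> carrier R"

definition depth :: "('a, 'b) ring_scheme \<Rightarrow> 'a set \<Rightarrow> enat" where
  "depth R \<mm> = Sup {enat (length xs) | xs. set xs \<subseteq> \<mm> \<and> regular_sequence R xs}"

locale cohen_macaulay_local_ring = noetherian_local_ring +
  assumes depth_eq_dim: "depth R \<mm> = krull_dim R"


section \<open>Length of modules\<close>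

text \<open>
  Only the additive group and the scalar multiplication of a \<^typ>\<open>('a, 'b) module\<close> matter for
  its module structure; the fields \<^const>\<open>monoid.mult\<close> and \<^const>\<open>monoid.one\<close> below are merely fillers
  required by the record type.
\<close>

definition ideal_module :: "('a, 'b) ring_scheme \<Rightarrow> 'a set \<Rightarrow> ('a, 'a) module" where
  "ideal_module R A =
     \<lparr>carrier = A, monoid.mult = monoid.mult R, monoid.one = \<one>\<^bsub>R\<^esub>, ring.zero = \<zero>\<^bsub>R\<^esub>,
      ring.add = ring.add R, smult = monoid.mult R\<rparr>"

definition factor_module :: "('a, 'b, 'm) module_scheme \<Rightarrow> 'b set \<Rightarrow> ('a, 'b set) module" where
  "factor_module M N =
     \<lparr>carrier = a_rcosets\<^bsub>M\<^esub> N, monoid.mult = rcoset_mult M N, monoid.one = N +>\<^bsub>M\<^esub> \<one>\<^bsub>M\<^esub>,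
      ring.zero = N, ring.add = set_add M, smult = (\<lambda>r C. \<Union>x\<in>C. N +>\<^bsub>M\<^esub> (r \<odot>\<^bsub>M\<^esub> x))\<rparr>"

definition module_length :: "('a, 'b) ring_scheme \<Rightarrow> ('a, 'c, 'm) module_scheme \<Rightarrow> enat" where
  "module_length R M = Sup {enat n | n.
     \<exists>N :: nat \<Rightarrow> 'c set. (\<forall>i\<le>n. submodule (N i) R M) \<and> (\<forall>i<n. N i \<subset> N (Suc i))}"

text \<open>
  \<open>quot_length R A B\<close> is the length of the \<open>R\<close>-module \<open>A/B\<close> for ideals \<open>B \<subseteq> A\<close>, as a natural
  number. It is meaningful only if that length is finite, as is the case when \<open>B\<close> contains a
  power of the maximal ideal of a Noetherian local ring.
\<close>

definition quot_length :: "('a, 'b) ring_scheme \<Rightarrow> 'a set \<Rightarrow> 'a set \<Rightarrow> nat" where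
  "quot_length R A B = the_enat (module_length R (factor_module (ideal_module R A) B))"

lemma (in ring) module_ideal_module:
  assumes "cring R" "ideal A R"
  shows "module R (ideal_module R A)"
proof -
  interpret cring R by fact
  interpret A: ideal A R by fact
  show ?thesis
  proof (rule moduleI)
    show "abelian_group (ideal_module R A)"
    proof (rule abelian_groupI)
      fix x assume "x \<in> carrier (ideal_module R A)"
      hence "x \<in> A" by (simp add: ideal_module_def)
      hence "\<ominus> x \<in> A" "\<ominus> x \<oplus> x = \<zero>"
        using A.a_inv_closed l_neg A.Icarr by blast+
      thus "\<exists>y\<in>carrier (ideal_module R A).
              y \<oplus>\<^bsub>ideal_module R A\<^esub> x = \<zero>\<^bsub>ideal_module R A\<^esub>"
        by (auto simp: ideal_module_def)
    qed (auto simp: ideal_module_def A.Icarr a_assoc a_comm a_lcomm)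
  qed (auto simp: ideal_module_def A.Icarr A.I_l_closed l_distr r_distr m_assoc is_cring)
qed

lemma (in module) module_factor_module:
  assumes "submodule N R M"
  shows "module R (factor_module M N)"
proof -
  interpret N: submodule N R M by fact
  interpret N: abelian_subgroup N M
    using N.subgroup_axioms M.abelian_group_axioms
    by (intro abelian_subgroupI3) (auto intro: additive_subgroup.intro)
  have sm: "(\<Union>x\<in>N +>\<^bsub>M\<^esub> a. N +>\<^bsub>M\<^esub> (r \<odot>\<^bsub>M\<^esub> x)) = N +>\<^bsub>M\<^esub> (r \<odot>\<^bsub>M\<^esub> a)"
    if r: "r \<in> carrier R" and a: "a \<in> carrier M" for r a
  proof -
    have "N +>\<^bsub>M\<^esub> (r \<odot>\<^bsub>M\<^esub> x) = N +>\<^bsub>M\<^esub> (r \<odot>\<^bsub>M\<^esub> a)" if x: "x \<in> N +>\<^bsub>M\<^esub> a" for x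
    proof -
      obtain h where h: "h \<in> N" "x = h \<oplus>\<^bsub>M\<^esub> a"
        using x by (auto simp: a_r_coset_def')
      have "r \<odot>\<^bsub>M\<^esub> x = (r \<odot>\<^bsub>M\<^esub> h) \<oplus>\<^bsub>M\<^esub> (r \<odot>\<^bsub>M\<^esub> a)"
        using h r a by (simp add: smult_r_distr)
      hence "r \<odot>\<^bsub>M\<^esub> x \<in> N +>\<^bsub>M\<^esub> (r \<odot>\<^bsub>M\<^esub> a)"
        using N.smult_closed[OF r h(1)] by (auto simp: a_r_coset_def')
      thus ?thesis
        using N.a_repr_independence'[of "r \<odot>\<^bsub>M\<^esub> x" "r \<odot>\<^bsub>M\<^esub> a"] r a by simp
    qed
    moreover have "a \<in> N +>\<^bsub>M\<^esub> a"
      using a N.a_rcos_self by blast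
    ultimately show ?thesis by blast
  qed
  have car: "\<exists>a\<in>carrier M. C = N +>\<^bsub>M\<^esub> a" if "C \<in> a_rcosets\<^bsub>M\<^esub> N" for C
    using that by (auto simp: A_RCOSETS_def')
  have carI: "N +>\<^bsub>M\<^esub> a \<in> a_rcosets\<^bsub>M\<^esub> N" if "a \<in> carrier M" for a
    using that by (auto simp: A_RCOSETS_def')
  have add: "(N +>\<^bsub>M\<^esub> a) <+>\<^bsub>M\<^esub> (N +>\<^bsub>M\<^esub> b) = N +>\<^bsub>M\<^esub> (a \<oplus>\<^bsub>M\<^esub> b)"
    if "a \<in> carrier M" "b \<in> carrier M" for a b
    using N.a_rcos_sum that by simp
  have N0: "N = N +>\<^bsub>M\<^esub> \<zero>\<^bsub>M\<^esub>"
    by (simp add: M.a_coset_add_zero N.a_subset)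
  show ?thesis
  proof (rule moduleI)
    show "abelian_group (factor_module M N)"
    proof (rule abelian_groupI)
      fix C assume C: "C \<in> carrier (factor_module M N)"
      then obtain a where a: "a \<in> carrier M" "C = N +>\<^bsub>M\<^esub> a"
        using car by (auto simp: factor_module_def)
      have "(N +>\<^bsub>M\<^esub> (\<ominus>\<^bsub>M\<^esub> a)) <+>\<^bsub>M\<^esub> C = N"
        using a add[of "\<ominus>\<^bsub>M\<^esub> a" a] N0 by (simp add: M.l_neg)
      thus "\<exists>Y\<in>carrier (factor_module M N).
              Y \<oplus>\<^bsub>factor_module M N\<^esub> C = \<zero>\<^bsub>factor_module M N\<^esub>"
        using carI[of "\<ominus>\<^bsub>M\<^esub> a"] a by (auto simp: factor_module_def)
      show "\<zero>\<^bsub>factor_module M N\<^esub> \<oplus>\<^bsub>factor_module M N\<^esub> C = C"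
        using a add[of "\<zero>\<^bsub>M\<^esub>" a] N0 by (simp add: factor_module_def)
    next
      show "\<zero>\<^bsub>factor_module M N\<^esub> \<in> carrier (factor_module M N)"
        using carI[of "\<zero>\<^bsub>M\<^esub>"] N0 by (simp add: factor_module_def)
    qed (auto simp: factor_module_def dest!: car simp: add carI M.a_assoc M.a_comm M.a_lcomm)
  qed (clarsimp simp: factor_module_def sm add carI smult_l_distr smult_r_distr smult_assoc1
         R.is_cring simp del: UN_simps dest!: car)+
qed


section \<open>Reductions and Hilbert coefficients\<close>

definition ideal_radical :: "('a, 'b) ring_scheme \<Rightarrow> 'a set \<Rightarrow> 'a set" where
  "ideal_radical R Q = {x \<in> carrier R. \<exists>n::nat. x [^]\<^bsub>R\<^esub> n \<in> Q}"

locale primaryideal = ideal + cring +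
  assumes I_notcarr: "carrier R \<noteq> I"
    and I_primary: "\<lbrakk>a \<in> carrier R; b \<in> carrier R; a \<otimes> b \<in> I\<rbrakk> \<Longrightarrow> a \<in> I \<or> b \<in> ideal_radical R I"

definition primary_to :: "('a, 'b) ring_scheme \<Rightarrow> 'a set \<Rightarrow> 'a set \<Rightarrow> bool" where
  "primary_to R P Q \<longleftrightarrow> primaryideal Q R \<and> ideal_radical R Q = P"

abbreviation ideal_power :: "('a, 'b) ring_scheme \<Rightarrow> 'a set \<Rightarrow> nat \<Rightarrow> 'a set" where
  "ideal_power R I n \<equiv> I [^]\<^bsub>ideals_set R\<^esub> n"

definition reduction :: "('a, 'b) ring_scheme \<Rightarrow> 'a set \<Rightarrow> 'a set \<Rightarrow> bool" where
  "reduction R J I \<longleftrightarrow> ideal J R \<and> J \<subseteq> I \<and>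
     (\<exists>n. J \<cdot>\<^bsub>R\<^esub> ideal_power R I n = ideal_power R I (n + 1))"

definition minimal_reduction :: "('a, 'b) ring_scheme \<Rightarrow> 'a set \<Rightarrow> 'a set \<Rightarrow> bool" where
  "minimal_reduction R J I \<longleftrightarrow>
     reduction R J I \<and> (\<forall>J'. reduction R J' I \<and> J' \<subseteq> J \<longrightarrow> J' = J)"

definition reduction_number :: "('a, 'b) ring_scheme \<Rightarrow> 'a set \<Rightarrow> 'a set \<Rightarrow> 'a set \<Rightarrow> nat" where
  "reduction_number R K J I =
     (LEAST n. K \<cdot>\<^bsub>R\<^esub> ideal_power R I (n + 1) = K \<cdot>\<^bsub>R\<^esub> J \<cdot>\<^bsub>R\<^esub> ideal_power R I n)"

definition fiber_hilbert_coeffs ::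
  "('a, 'b) ring_scheme \<Rightarrow> 'a set \<Rightarrow> 'a set \<Rightarrow> int \<Rightarrow> int \<Rightarrow> int \<Rightarrow> bool" where
  "fiber_hilbert_coeffs R K I g\<^sub>0 g\<^sub>1 g\<^sub>2 \<longleftrightarrow>
     (\<forall>\<^sub>F n in sequentially.
        int (quot_length R (carrier R) (K \<cdot>\<^bsub>R\<^esub> ideal_power R I n))
          = g\<^sub>0 * int ((n + 1) choose 2) - g\<^sub>1 * int n + g\<^sub>2)"

end

(*
Write J = (x, y); depth 2 makes all syzygies of x, y trivial. A generating set of J of size r >= 3
can be shortened: R/J^n grows at most quadratically, so some form in three of the generators lies
in m J^N, and over an infinite residue field a linear change of variables makes it monic.

Let M_n be the union over k of (K I^(n+k) : J^k), a Ratliff-Rush closure of the filtration K I^n.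
Since (M_(n+1) : J) = M_n,
  length(M_(n+1)/J M_n) = length(R/J) + 2 length(R/M_n) - length(R/M_(n-1)) - length(R/M_(n+1)),
and these numbers add up to g_1 + length(R/M_0); here M_n = K I^n for large n holds because
comparison of Hilbert polynomials forces g_0 = length(R/J). The condition K I cap J = K J saves
length(KI/KJ) generators in degree 1, so the Rees algebra of J generates the M_n from K and
K I together with s <= g_1 + length(R/K) - length(KI/KJ) further elements. The determinant
trick applied to these s elements gives K I^(s+2) = K J I^(s+1).
*)
theory Submission
  imports Defs
begin

section \<open>Lengths of quotients of ideals\<close>

text \<open>If F_n = K I^n takes the place of M_n, the formula for length(M_(n+1)/J M_n) acquires
  the additional summand length((F_n : J)/F_(n-1)), on which g_1 gives no hold; M_n is built to make
  it vanish. This exchange has two consequences. M_0 may be larger than K, so up to length(M_0/K)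
  generators appear in degree 0; together with length(R/M_0) they produce the length(R/K) of the
  bound. And the claim concerns K I^n, not M_n: therefore the determinant belongs to the vector (1,
  y_1, ..., y_s), where the contributions of K and K I are coefficients of the entry 1. Every term
  of the determinant has one factor from the column of 1, which supplies K, and the row of 1 is
  multiplied by an element of K I^2, which lies in M_2. This row accounts for the exponent s + 2 and
  so for the summand 1 of the bound. Nonzero terms off the diagonal are controlled by degrees: their
  total degree in I and J is s + 2, but at most s + 1 factors stem from I, so a factor from J is
  present.\<close>

lemma enat_Sup_add_le:
  fixes C' Y :: "enat set"
  assumes "C' \<noteq> {}" "Y \<noteq> {}" and le: "\<And>x y. x \<in> C' \<Longrightarrow> y \<in> Y \<Longrightarrow> x + y \<le> z"
  shows "Sup C' + Sup Y \<le> z"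
proof (cases z)
  case (enat k)
  obtain x0 y0 where "x0 \<in> C'" "y0 \<in> Y" using assms by blast
  have "finite C'"
  proof (rule finite_enat_bounded[of _ k])
    fix x assume "x \<in> C'"
    from le[OF this \<open>y0 \<in> Y\<close>] show "x \<le> enat k" using enat by (metis le_iff_add order_trans)
  qed
  moreover have "finite Y"
  proof (rule finite_enat_bounded[of _ k])
    fix y assume "y \<in> Y"
    from le[OF \<open>x0 \<in> C'\<close> this] show "y \<le> enat k" using enat by (metis add.commute le_iff_add order_trans)
  qed
  ultimately show ?thesis using le assms by (simp add: Sup_enat_def)
qed simp

context cring begin

lemma ideal_carr: "ideal Q R \<Longrightarrow> a \<in> Q \<Longrightarrow> a \<in> carrier R"
  by (rule ideal.Icarr)

lemma ideal_sub: "ideal Q R \<Longrightarrow> Q \<subseteq> carrier R"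
  by (auto intro: ideal.Icarr)

lemma ideal_zero: "ideal Q R \<Longrightarrow> \<zero> \<in> Q"
  by (simp add: additive_subgroup.zero_closed ideal.axioms(1))

lemma ideal_add: "ideal Q R \<Longrightarrow> a \<in> Q \<Longrightarrow> b \<in> Q \<Longrightarrow> a \<oplus> b \<in> Q"
  by (simp add: additive_subgroup.a_closed ideal.axioms(1))

lemma ideal_neg: "ideal Q R \<Longrightarrow> a \<in> Q \<Longrightarrow> \<ominus> a \<in> Q"
  by (simp add: additive_subgroup.a_inv_closed ideal.axioms(1))

lemma ideal_minus: "ideal Q R \<Longrightarrow> a \<in> Q \<Longrightarrow> b \<in> Q \<Longrightarrow> a \<ominus> b \<in> Q"
  by (simp add: a_minus_def ideal_add ideal_neg)

lemma ideal_l: "ideal Q R \<Longrightarrow> a \<in> Q \<Longrightarrow> r \<in> carrier R \<Longrightarrow> r \<otimes> a \<in> Q"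
  by (rule ideal.I_l_closed)

lemma ideal_r: "ideal Q R \<Longrightarrow> a \<in> Q \<Longrightarrow> r \<in> carrier R \<Longrightarrow> a \<otimes> r \<in> Q"
  by (rule ideal.I_r_closed)

lemma idealI_cring:
  assumes "Q \<subseteq> carrier R" "\<zero> \<in> Q" "\<And>a b. a \<in> Q \<Longrightarrow> b \<in> Q \<Longrightarrow> a \<oplus> b \<in> Q"
    "\<And>r a. r \<in> carrier R \<Longrightarrow> a \<in> Q \<Longrightarrow> r \<otimes> a \<in> Q"
  shows "ideal Q R"
proof (rule idealI)
  show "ring R" by (rule ring_axioms)
  show "subgroup Q (add_monoid R)"
  proof (rule add.subgroupI)
    fix a assume a: "a \<in> Q"
    then have "a \<in> carrier R" using assms(1) by blast
    then have "\<ominus> a = (\<ominus> \<one>) \<otimes> a" by (simp add: l_minus)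
    then show "\<ominus> a \<in> Q" using assms(4)[of "\<ominus> \<one>" a] a by simp
  qed (use assms in auto)
  show "a \<in> Q \<Longrightarrow> x \<in> carrier R \<Longrightarrow> x \<otimes> a \<in> Q" for a x by (rule assms(4))
  show "a \<in> Q \<Longrightarrow> x \<in> carrier R \<Longrightarrow> a \<otimes> x \<in> Q" for a x
    using assms(4)[of x a] m_comm[of a x] assms(1) by auto
qed

lemma add_minus_cancel:
  assumes "a \<in> carrier R" "b \<in> carrier R"
  shows "(a \<oplus> b) \<ominus> b = a" "(a \<oplus> b) \<ominus> a = b" "a \<oplus> (b \<ominus> a) = b"
proof -
  show "(a \<oplus> b) \<ominus> b = a" using assms by (simp add: a_minus_def a_assoc r_neg)
  then show "(a \<oplus> b) \<ominus> a = b" using assms by (metis a_comm a_minus_def add.inv_closed add.m_assoc r_neg r_zero)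
  show "a \<oplus> (b \<ominus> a) = b" using assms by (metis a_comm a_minus_def add.inv_closed add.m_assoc r_neg r_zero)
qed

text \<open>The ideal u A + B. It covers sums of ideals (\<open>u = \<one>\<close>), adjoining one
  element (\<open>A = carrier R\<close>) and principal ideals (\<open>B = {\<zero>}\<close>), so
  that the single formula \<open>ilen_ladd\<close> serves all layers that occur.\<close>

definition ladd :: "'a \<Rightarrow> 'a set \<Rightarrow> 'a set \<Rightarrow> 'a set" where
  "ladd u A B = {u \<otimes> a \<oplus> b | a b. a \<in> A \<and> b \<in> B}"

lemma laddI: "a \<in> A \<Longrightarrow> b \<in> B \<Longrightarrow> u \<otimes> a \<oplus> b \<in> ladd u A B"
  by (auto simp: ladd_def)

lemma laddE: "v \<in> ladd u A B \<Longrightarrow> (\<And>a b. a \<in> A \<Longrightarrow> b \<in> B \<Longrightarrow> v = u \<otimes> a \<oplus> b \<Longrightarrow> P) \<Longrightarrow> P"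
  by (auto simp: ladd_def)

lemma ladd_ideal:
  assumes u: "u \<in> carrier R" and A: "ideal A R" and B: "ideal B R"
  shows "ideal (ladd u A B) R"
proof (rule idealI_cring)
  note c = ideal_carr[OF A] ideal_carr[OF B] u
  show "ladd u A B \<subseteq> carrier R" by (auto elim!: laddE simp: c)
  show "\<zero> \<in> ladd u A B" using laddI[OF ideal_zero[OF A] ideal_zero[OF B], of u] u by simp
  fix v w assume "v \<in> ladd u A B" "w \<in> ladd u A B"
  then obtain a b a' b' where v: "a \<in> A" "b \<in> B" "v = u \<otimes> a \<oplus> b" "a' \<in> A" "b' \<in> B" "w = u \<otimes> a' \<oplus> b'"
    by (auto elim!: laddE)
  have "v \<oplus> w = u \<otimes> (a \<oplus> a') \<oplus> (b \<oplus> b')"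
    using v c by (simp add: r_distr a_ac)
  then show "v \<oplus> w \<in> ladd u A B"
    using v laddI[OF ideal_add[OF A] ideal_add[OF B]] by metis
next
  note c = ideal_carr[OF A] ideal_carr[OF B] u
  fix r v assume r: "r \<in> carrier R" and "v \<in> ladd u A B"
  then obtain a b where v: "a \<in> A" "b \<in> B" "v = u \<otimes> a \<oplus> b"
    by (auto elim!: laddE)
  have "r \<otimes> v = u \<otimes> (r \<otimes> a) \<oplus> r \<otimes> b"
    using v c r by (simp add: r_distr m_ac)
  then show "r \<otimes> v \<in> ladd u A B"
    using v r laddI[OF ideal_l[OF A] ideal_l[OF B]] by metis
qed

lemma ladd_memr: 
  assumes "u \<in> carrier R" "ideal A R" "ideal B R" "b \<in> B"
  shows "b \<in> ladd u A B"
  using laddI[OF ideal_zero[OF assms(2)] assms(4), of u] assms ideal_carr[OF assms(3)] by simp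

lemma ladd_meml: 
  assumes "u \<in> carrier R" "ideal A R" "ideal B R" "a \<in> A"
  shows "u \<otimes> a \<in> ladd u A B"
  using laddI[OF assms(4) ideal_zero[OF assms(3)], of u] assms ideal_carr[OF assms(2)] by simp

lemma ladd_least:
  assumes "ideal C R" "B \<subseteq> C" "\<And>a. a \<in> A \<Longrightarrow> u \<otimes> a \<in> C"
  shows "ladd u A B \<subseteq> C" using assms ideal_add by (auto elim!: laddE)

lemma ladd_mono: "A \<subseteq> A' \<Longrightarrow> B \<subseteq> B' \<Longrightarrow> ladd u A B \<subseteq> ladd u A' B'"
  by (auto simp: ladd_def)

section \<open>Length of A/B through chains of ideals\<close>

definition ichain :: "'a set \<Rightarrow> 'a set \<Rightarrow> nat \<Rightarrow> (nat \<Rightarrow> 'a set) \<Rightarrow> bool" where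
  "ichain A B n N \<longleftrightarrow> (\<forall>i\<le>n. ideal (N i) R \<and> B \<subseteq> N i \<and> N i \<subseteq> A) \<and> (\<forall>i<n. N i \<subset> N (Suc i))"

text \<open>Chains in the lattice of ideals between \<open>B\<close> and \<open>A\<close> keep
  quotient modules out of the computations; \<open>module_length_factor\<close> identifies the value
  with the length of the module A/B.\<close>

definition ilen :: "'a set \<Rightarrow> 'a set \<Rightarrow> enat" where
  "ilen A B = Sup {enat n | n. \<exists>N. ichain A B n N}"

lemma ilen_ge: "ichain A B n N \<Longrightarrow> enat n \<le> ilen A B"
  unfolding ilen_def by (rule Sup_upper) auto

lemma ilen_le: "(\<And>n N. ichain A B n N \<Longrightarrow> enat n \<le> c) \<Longrightarrow> ilen A B \<le> c"
  unfolding ilen_def by (rule Sup_least) auto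

lemma ilen_mono: "A \<subseteq> A' \<Longrightarrow> B' \<subseteq> B \<Longrightarrow> ilen A B \<le> ilen A' B'"
proof (rule ilen_le)
  fix n N assume "A \<subseteq> A'" "B' \<subseteq> B" "ichain A B n N"
  then have "ichain A' B' n N" unfolding ichain_def by (meson subset_trans)
  then show "enat n \<le> ilen A' B'" by (rule ilen_ge)
qed

lemma ilen_super:
  assumes "ideal B R" "C \<subseteq> B" "B \<subseteq> A"
  shows "ilen A B + ilen B C \<le> ilen A C" unfolding ilen_def[of A B] ilen_def[of B C]
proof (rule enat_Sup_add_le)
  have "ichain A B 0 (\<lambda>_. B)" using assms by (auto simp: ichain_def)
  then show "{enat n |n. \<exists>N. ichain A B n N} \<noteq> {}" by blast
  have "ichain B C 0 (\<lambda>_. B)" using assms by (auto simp: ichain_def)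
  then show "{enat n |n. \<exists>N. ichain B C n N} \<noteq> {}" by blast
next
  fix x y assume "x \<in> {enat n |n. \<exists>N. ichain A B n N}" "y \<in> {enat n |n. \<exists>N. ichain B C n N}"
  then obtain n N2 m N1 where xy: "x = enat n" "y = enat m" and 2: "ichain A B n N2" and 1: "ichain B C m N1"
    by blast
  \<comment> \<open>\<open>N2 0\<close> is skipped at the junction, since it may equal
    \<open>N1 m\<close>; strictness there comes from
    \<open>N1 m \<subseteq> B \<subseteq> N2 0 \<subset> N2 1\<close>.\<close>
  define N where "N = (\<lambda>i. if i \<le> m then N1 i else N2 (i - m))"
  have "ichain A C (n + m) N" unfolding ichain_def
  proof (intro conjI allI impI)
    fix i assume i: "i \<le> n + m"
    show "ideal (N i) R" using 1 2 i by (auto simp: ichain_def N_def)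
    have "C \<subseteq> N i \<and> N i \<subseteq> A"
    proof (cases "i \<le> m")
      case True
      then have "C \<subseteq> N1 i" "N1 i \<subseteq> B" using 1 by (simp_all add: ichain_def)
      then show ?thesis using True assms by (simp add: N_def)
    next
      case False
      then have "B \<subseteq> N2 (i - m)" "N2 (i - m) \<subseteq> A" using 2 i by (simp_all add: ichain_def)
      then show ?thesis using False assms by (simp add: N_def)
    qed
    then show "C \<subseteq> N i" "N i \<subseteq> A" by blast+
  next
    fix i assume i: "i < n + m"
    consider "i < m" | "i = m" | "i > m" by linarith
    then show "N i \<subset> N (Suc i)"
    proof cases
      case 2
      have "N1 m \<subseteq> B" "B \<subseteq> N2 0" "N2 0 \<subset> N2 1"
        using \<open>ichain A B n N2\<close> 1 i 2 by (auto simp: ichain_def)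
      then show ?thesis using 2 by (auto simp: N_def)
    qed (use 1 2 i in \<open>auto simp: ichain_def N_def Suc_diff_le\<close>)
  qed
  then show "x + y \<le> ilen A C" using ilen_ge xy by fastforce
qed

lemma ilen_strict:
  assumes "ideal A R" "ideal B R" "B \<subset> A"
  shows "1 \<le> ilen A B"
proof -
  have "ichain A B 1 (\<lambda>i. if i = 0 then B else A)" using assms by (auto simp: ichain_def)
  from ilen_ge[OF this] show ?thesis by (simp add: one_enat_def)
qed

text \<open>Modular law in the form needed for chains: a strict step stays visible in the
  intersection with \<open>B\<close> or in the sum with \<open>B\<close>.\<close>

lemma ideal_modular:
  assumes C': "ideal C' R" and Y: "ideal Y R" and B: "ideal B R"
    and "C' \<subseteq> Y" "C' \<inter> B = Y \<inter> B" "ladd \<one> C' B = ladd \<one> Y B"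
  shows "C' = Y"
proof
  show "Y \<subseteq> C'"
  proof
    fix y assume y: "y \<in> Y"
    have "\<one> \<otimes> y \<oplus> \<zero> \<in> ladd \<one> C' B"
      using laddI[OF y ideal_zero[OF B]] assms by simp
    then obtain a b where ab: "a \<in> C'" "b \<in> B" "y = a \<oplus> b"
      using ideal_carr[OF C'] ideal_carr[OF Y y] by (auto elim!: laddE)
    have "b = y \<ominus> a" using ab ideal_carr[OF C'] ideal_carr[OF B] add_minus_cancel(2) by simp
    moreover have "a \<in> Y" using ab assms by blast
    ultimately have "b \<in> Y" using ideal_minus[OF Y y] by metis
    then show "y \<in> C'" using ab assms ideal_add[OF C'] by blast
  qed
qed fact

text \<open>Each step of a chain from \<open>C\<close> to \<open>A\<close> is strict after
  intersecting with \<open>B\<close> or after adding \<open>B\<close>, so it is counted in B/C or in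
  A/B; the induction counts the first \<open>i\<close> steps.\<close>

lemma ilen_sub:
  assumes "ideal A R" "ideal B R" "ideal C R" "C \<subseteq> B" "B \<subseteq> A"
  shows "ilen A C \<le> ilen A B + ilen B C"
proof (rule ilen_le)
  fix n N assume ch: "ichain A C n N"
  note BB = assms(2)
  have id: "ideal (N i) R" if "i \<le> n" for i using that ch by (auto simp: ichain_def)
  have id1: "ideal (ladd \<one> (N i) B) R" "ideal (N i \<inter> B) R" if "i \<le> n" for i
    using id[OF that] BB by (auto intro: ladd_ideal i_intersect)
  have Bl: "B \<subseteq> ladd \<one> (N i) B" if "i \<le> n" for i
    using id[OF that] BB ladd_memr by blast
  have "enat i \<le> ilen (ladd \<one> (N i) B) B + ilen (N i \<inter> B) C" if "i \<le> n" for i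
    using that
  proof (induction i)
    case (Suc i)
    have lt: "N i \<subset> N (Suc i)" using Suc ch by (auto simp: ichain_def)
    have ci: "C \<subseteq> N i \<inter> B" using Suc ch assms by (auto simp: ichain_def)
    let ?L = "\<lambda>i. ilen (ladd \<one> (N i) B) B" and ?M = "\<lambda>i. ilen (N i \<inter> B) C"
    have sub: "ladd \<one> (N i) B \<subseteq> ladd \<one> (N (Suc i)) B" "N i \<inter> B \<subseteq> N (Suc i) \<inter> B"
      using ladd_mono[of "N i" "N (Suc i)" B B \<one>] lt by auto
    have m: "?L i \<le> ?L (Suc i)" "?M i \<le> ?M (Suc i)" using sub by (auto intro: ilen_mono)
    have "N i \<inter> B \<noteq> N (Suc i) \<inter> B \<or> ladd \<one> (N i) B \<noteq> ladd \<one> (N (Suc i)) B"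
      using ideal_modular[of "N i" "N (Suc i)" B] id Suc.prems BB lt by fastforce
    then have "1 + ?L i + ?M i \<le> ?L (Suc i) + ?M (Suc i)"
    proof
      assume "N i \<inter> B \<noteq> N (Suc i) \<inter> B"
      then have "1 \<le> ilen (N (Suc i) \<inter> B) (N i \<inter> B)"
        using sub id1 Suc.prems by (intro ilen_strict) auto
      then have "1 + ?M i \<le> ilen (N (Suc i) \<inter> B) (N i \<inter> B) + ?M i"
        by (rule add_right_mono)
      also have "\<dots> \<le> ?M (Suc i)" using ci sub id1 Suc.prems by (intro ilen_super) auto
      finally have st: "1 + ?M i \<le> ?M (Suc i)" .
      show ?thesis using add_mono[OF m(1) st] by (simp only: ac_simps)
    next
      assume "ladd \<one> (N i) B \<noteq> ladd \<one> (N (Suc i)) B"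
      then have "1 \<le> ilen (ladd \<one> (N (Suc i)) B) (ladd \<one> (N i) B)"
        using sub id1 Suc.prems by (intro ilen_strict) auto
      then have "1 + ?L i \<le> ilen (ladd \<one> (N (Suc i)) B) (ladd \<one> (N i) B) + ?L i"
        by (rule add_right_mono)
      also have "\<dots> \<le> ?L (Suc i)" using Bl sub id1 Suc.prems by (intro ilen_super) auto
      finally show ?thesis using m(2) by (rule add_mono)
    qed
    moreover have "1 + enat i \<le> 1 + ?L i + ?M i"
      using Suc by (simp add: add.assoc add_left_mono)
    ultimately have "1 + enat i \<le> ?L (Suc i) + ?M (Suc i)" by (rule order_trans[rotated])
    then show ?case by (simp add: one_enat_def)
  qed (simp add: zero_enat_def[symmetric])
  from this[of n] have "enat n \<le> ilen (ladd \<one> (N n) B) B + ilen (N n \<inter> B) C" by simp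
  also have "\<dots> \<le> ilen A B + ilen B C"
  proof (intro add_mono ilen_mono)
    show "ladd \<one> (N n) B \<subseteq> A" using ch assms ideal_carr[OF assms(1)]
      by (intro ladd_least) (force simp: ichain_def)+
  qed auto
  finally show "enat n \<le> ilen A B + ilen B C" .
qed

lemma ilen_add:
  assumes "ideal A R" "ideal B R" "ideal C R" "C \<subseteq> B" "B \<subseteq> A"
  shows "ilen A C = ilen A B + ilen B C"
  using ilen_sub[OF assms] ilen_super[of B C A] assms by (simp add: antisym)

text \<open>A monotone map with a left inverse on the ideals concerned keeps strict chains strict.
  Used in both directions it replaces an isomorphism of modules.\<close>

lemma ilen_embed:
  assumes id: "\<And>C'. ideal C' R \<Longrightarrow> B \<subseteq> C' \<Longrightarrow> C' \<subseteq> A \<Longrightarrow> ideal (f C') R \<and> B' \<subseteq> f C' \<and> f C' \<subseteq> A'"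
    and mono: "\<And>C' Y. ideal C' R \<Longrightarrow> ideal Y R \<Longrightarrow> B \<subseteq> C' \<Longrightarrow> C' \<subseteq> Y \<Longrightarrow> Y \<subseteq> A \<Longrightarrow> f C' \<subseteq> f Y"
    and inj: "\<And>C'. ideal C' R \<Longrightarrow> B \<subseteq> C' \<Longrightarrow> C' \<subseteq> A \<Longrightarrow> g (f C') = C'"
  shows "ilen A B \<le> ilen A' B'"
proof (rule ilen_le)
  fix n N assume ch: "ichain A B n N"
  have "ichain A' B' n (f \<circ> N)" unfolding ichain_def comp_def
  proof (intro conjI allI impI)
    fix i assume "i \<le> n"
    then have *: "ideal (N i) R" "B \<subseteq> N i" "N i \<subseteq> A" using ch by (auto simp: ichain_def)
    show "ideal (f (N i)) R" "B' \<subseteq> f (N i)" "f (N i) \<subseteq> A'"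
      using id[OF *] by auto
  next
    fix i assume "i < n"
    then have *: "ideal (N i) R" "B \<subseteq> N i" "N i \<subseteq> A" "ideal (N (Suc i)) R" "B \<subseteq> N (Suc i)" "N (Suc i) \<subseteq> A" "N i \<subset> N (Suc i)"
      using ch by (auto simp: ichain_def)
    have "f (N i) \<noteq> f (N (Suc i))" using inj[OF *(1-3)] inj[OF *(4-6)] *(7) by (metis psubsetE subset_refl)
    moreover have "f (N i) \<subseteq> f (N (Suc i))" using mono[OF *(1,4,2)] * by blast
    ultimately show "f (N i) \<subset> f (N (Suc i))" by blast
  qed
  then show "enat n \<le> ilen A' B'" by (rule ilen_ge)
qed

section \<open>Colon ideals and layers of the form (u A + B)/B\<close>

definition colon :: "'a set \<Rightarrow> 'a set \<Rightarrow> 'a set" where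
  "colon A B = {u \<in> carrier R. \<forall>b\<in>B. u \<otimes> b \<in> A}"

lemma colon_ideal:
  assumes "ideal A R" "B \<subseteq> carrier R"
  shows "ideal (colon A B) R"
proof (rule idealI_cring)
  note c = subsetD[OF assms(2)]
  show "\<zero> \<in> colon A B" using ideal_zero[OF assms(1)] c by (auto simp: colon_def)
  show "a \<oplus> b \<in> colon A B" if "a \<in> colon A B" "b \<in> colon A B" for a b
    using that c ideal_add[OF assms(1)] by (auto simp: colon_def l_distr)
  show "r \<otimes> a \<in> colon A B" if "r \<in> carrier R" "a \<in> colon A B" for r a
    using that c ideal_l[OF assms(1)] by (auto simp: colon_def m_assoc)
qed (auto simp: colon_def)

text \<open>Multiplication by \<open>u\<close> maps \<open>A\<close> onto (u A + B)/B with kernel A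
  \<inter> (B : u); \<open>?f\<close> and \<open>?g\<close> are the resulting correspondence of
  ideals.\<close>

lemma ilen_ladd:
  assumes u: "u \<in> carrier R" and A: "ideal A R" and B: "ideal B R"
  shows "ilen (ladd u A B) B = ilen A (A \<inter> colon B {u})"
proof (rule antisym)
  note c = ideal_carr[OF A] ideal_carr[OF B] u
  let ?f = "\<lambda>C'. {a \<in> A. u \<otimes> a \<in> C'}" and ?g = "\<lambda>C. ladd u C B"
  have fid: "ideal (?f C') R" if "ideal C' R" for C'
    using ideal_zero[OF A] ideal_zero[OF that] ideal_add[OF A] ideal_add[OF that] ideal_l[OF A]
      ideal_l[OF that] c by (intro idealI_cring) (auto simp: r_distr m_lcomm[of u])
  have f: "ideal (?f C') R \<and> A \<inter> colon B {u} \<subseteq> ?f C' \<and> ?f C' \<subseteq> A" if "ideal C' R" "B \<subseteq> C'" for C'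
    using fid[OF that(1)] that c by (auto simp: colon_def m_comm)
  have gf: "?g (?f C') = C'" if C': "ideal C' R" "B \<subseteq> C'" "C' \<subseteq> ladd u A B" for C'
  proof
    show "?g (?f C') \<subseteq> C'" using C' by (intro ladd_least) auto
    show "C' \<subseteq> ?g (?f C')"
    proof
      fix v assume v: "v \<in> C'"
      then obtain a b where ab: "a \<in> A" "b \<in> B" "v = u \<otimes> a \<oplus> b" using C'(3) by (meson laddE subsetD)
      have "u \<otimes> a = v \<ominus> b" using ab c add_minus_cancel(1) by simp
      then have "u \<otimes> a \<in> C'" using ideal_minus[OF C'(1) v, of b] ab C'(2) by auto
      then show "v \<in> ?g (?f C')" using ab by (auto intro!: laddI)
    qed
  qed
  show "ilen (ladd u A B) B \<le> ilen A (A \<inter> colon B {u})"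
    by (rule ilen_embed[where f = ?f and g = ?g]) (use f gf in auto)
  have cB: "ideal (colon B {u}) R" using B u by (intro colon_ideal) auto
  show "ilen A (A \<inter> colon B {u}) \<le> ilen (ladd u A B) B"
  proof (rule ilen_embed[where f = ?g and g = ?f])
    fix C' assume C': "ideal C' R" "A \<inter> colon B {u} \<subseteq> C'" "C' \<subseteq> A"
    show "ideal (?g C') R \<and> B \<subseteq> ?g C' \<and> ?g C' \<subseteq> ladd u A B"
      using C' u B by (auto intro: ladd_ideal ladd_memr dest: subsetD[OF ladd_mono[OF C'(3) order_refl]])
    show "?f (?g C') = C'"
    proof
      show "C' \<subseteq> ?f (?g C')" using C' u B by (auto intro: ladd_meml)
      show "?f (?g C') \<subseteq> C'"
      proof safe
        fix a assume a: "a \<in> A" "u \<otimes> a \<in> ?g C'"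
        then obtain x b where xb: "x \<in> C'" "b \<in> B" "u \<otimes> a = u \<otimes> x \<oplus> b" by (auto elim: laddE)
        have xc: "x \<in> carrier R" "a \<in> carrier R" "b \<in> carrier R" using xb C' a c by auto
        have "b = u \<otimes> a \<ominus> u \<otimes> x" using xb xc u
          by (simp add: add_minus_cancel(2))
        then have "u \<otimes> (a \<ominus> x) \<in> B" using xb xc u
          by (simp add: a_minus_def r_distr r_minus)
        then have "a \<ominus> x \<in> colon B {u}" using xc u by (simp add: colon_def m_comm)
        moreover have "a \<ominus> x \<in> A" using a xb C' ideal_minus[OF A] by blast
        ultimately have "a \<ominus> x \<in> C'" using C' by blast
        then have "x \<oplus> (a \<ominus> x) \<in> C'" using C' xb ideal_add by blast
        moreover have "x \<oplus> (a \<ominus> x) = a" using xc by (simp add: add_minus_cancel)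
        ultimately show "a \<in> C'" by simp
      qed
    qed
  next
    fix C' Y :: "'a set" assume "C' \<subseteq> Y"
    then show "?g C' \<subseteq> ?g Y" by (rule ladd_mono) simp
  qed
qed

section \<open>Submodules of A/B and ideals between B and A\<close>

context
  fixes A B :: "'a set"
  assumes A: "ideal A R" and B: "ideal B R" and BA: "B \<subseteq> A"
begin

abbreviation "FM \<equiv> factor_module (ideal_module R A) B"

lemma FM_carrier: "carrier FM = {B +> a | a. a \<in> A}"
  by (auto simp: factor_module_def ideal_module_def A_RCOSETS_def' a_r_coset_def')

lemma FM_zero: "\<zero>\<^bsub>FM\<^esub> = B"
  by (simp add: factor_module_def)

lemma FM_add: "a \<in> A \<Longrightarrow> b \<in> A \<Longrightarrow> (B +> a) \<oplus>\<^bsub>FM\<^esub> (B +> b) = B +> (a \<oplus> b)"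
  using ideal.a_rcos_sum[OF B] ideal_carr[OF A]
  by (simp add: factor_module_def ideal_module_def set_add_def' cong: SUP_cong)

lemma coset_eq: "a \<in> carrier R \<Longrightarrow> b \<in> carrier R \<Longrightarrow> B +> a = B +> b \<longleftrightarrow> a \<ominus> b \<in> B"
  using quotient_eq_iff_same_a_r_cos[OF B] by blast

lemma coset_mem: "a \<in> carrier R \<Longrightarrow> b \<in> B +> a \<longleftrightarrow> b \<in> carrier R \<and> b \<ominus> a \<in> B"
proof
  assume a: "a \<in> carrier R" and b: "b \<in> B +> a"
  then obtain h where "h \<in> B" "b = h \<oplus> a" by (auto simp: a_r_coset_def')
  then show "b \<in> carrier R \<and> b \<ominus> a \<in> B" using a ideal_carr[OF B] by (simp add: add_minus_cancel)
next
  assume a: "a \<in> carrier R" and b: "b \<in> carrier R \<and> b \<ominus> a \<in> B"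
  then have "b = (b \<ominus> a) \<oplus> a" by (metis add_minus_cancel(3) a_comm minus_closed)
  then show "b \<in> B +> a" using b by (auto simp: a_r_coset_def')
qed

lemma FM_smult:
  assumes r: "r \<in> carrier R" and a: "a \<in> A"
  shows "r \<odot>\<^bsub>FM\<^esub> (B +> a) = B +> (r \<otimes> a)"
proof -
  have ac: "a \<in> carrier R" using ideal_carr[OF A a] .
  have "B +> (r \<otimes> x) = B +> (r \<otimes> a)" if x: "x \<in> B +> a" for x
  proof -
    have "x \<in> carrier R" "x \<ominus> a \<in> B" using x coset_mem ac by auto
    then have "r \<otimes> (x \<ominus> a) \<in> B" using r ideal_l[OF B] by blast
    moreover have "r \<otimes> (x \<ominus> a) = r \<otimes> x \<ominus> r \<otimes> a"
      using \<open>x \<in> carrier R\<close> r ac by (simp add: a_minus_def r_distr r_minus)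
    ultimately show ?thesis using coset_eq r ac \<open>x \<in> carrier R\<close> by simp
  qed
  moreover have "a \<in> B +> a" using coset_mem[OF ac] ac ideal_zero[OF B] by (simp add: a_minus_def r_neg)
  ultimately have "(\<Union>x\<in>B +> a. B +> (r \<otimes> x)) = B +> (r \<otimes> a)" by blast
  then show ?thesis by (simp add: factor_module_def ideal_module_def a_r_coset_def')
qed

lemma FM_module: "module R FM"
proof -
  note M = module_ideal_module[OF is_cring A]
  have "submodule B R (ideal_module R A)"
  proof (rule module.submoduleI[OF M])
    show "\<ominus>\<^bsub>ideal_module R A\<^esub> a \<in> B" if a: "a \<in> B" for a
    proof -
      interpret M: module R "ideal_module R A" by (rule M)
      have "a \<in> carrier (ideal_module R A)" using a BA by (auto simp: ideal_module_def)
      then have "\<ominus>\<^bsub>ideal_module R A\<^esub> a = (\<ominus> \<one>) \<odot>\<^bsub>ideal_module R A\<^esub> a"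
        using M.smult_l_minus[of \<one> a] by simp
      then show ?thesis using ideal_l[OF B a, of "\<ominus> \<one>"] by (simp add: ideal_module_def)
    qed
  qed (use BA ideal_add[OF B] ideal_l[OF B] ideal_zero[OF B] in \<open>auto simp: ideal_module_def\<close>)
  then show ?thesis by (rule module.module_factor_module[OF module_ideal_module[OF is_cring A]])
qed

text \<open>Correspondence theorem: a submodule of A/B is recovered from its preimage
  \<open>{a \<in> A. B +> a \<in> N}\<close>.\<close>

lemma submodule_FM_iff:
  "submodule N R FM \<longleftrightarrow> (\<exists>C. ideal C R \<and> B \<subseteq> C \<and> C \<subseteq> A \<and> N = {B +> c | c. c \<in> C})"
proof
  assume N: "submodule N R FM"
  note Nsub = submodule.axioms(1)[OF N]
  have Nc: "N \<subseteq> carrier FM" using subgroup.subset[OF Nsub] by simp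
  have N0: "B \<in> N" using subgroup.one_closed[OF Nsub] by (simp add: FM_zero)
  have Na: "u \<oplus>\<^bsub>FM\<^esub> v \<in> N" if "u \<in> N" "v \<in> N" for u v
    using subgroup.m_closed[OF Nsub that] by simp
  have Ns: "r \<odot>\<^bsub>FM\<^esub> v \<in> N" if "r \<in> carrier R" "v \<in> N" for r v
    using submodule.smult_closed[OF N that] .
  let ?C = "{a \<in> A. B +> a \<in> N}"
  have "B +> b = B" if "b \<in> B" for b by (metis a_rcos_zero B that)
  then have "B \<subseteq> ?C" using BA N0 by auto
  moreover have "ideal ?C R"
  proof (rule idealI_cring)
    show "\<zero> \<in> ?C" using \<open>B \<subseteq> ?C\<close> ideal_zero[OF B] by blast
    show "a \<oplus> b \<in> ?C" if "a \<in> ?C" "b \<in> ?C" for a b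
      using Na[of "B +> a" "B +> b"] that FM_add[of a b] ideal_add[OF A] by simp
    show "r \<otimes> a \<in> ?C" if "r \<in> carrier R" "a \<in> ?C" for r a
      using Ns[of r "B +> a"] that FM_smult[of r a] ideal_l[OF A] by simp
  qed (use ideal_carr[OF A] in auto)
  moreover have "N = {B +> c | c. c \<in> ?C}"
  proof
    show "N \<subseteq> {B +> c | c. c \<in> ?C}"
    proof
      fix v assume v: "v \<in> N"
      then have "v \<in> {B +> a | a. a \<in> A}" using Nc FM_carrier by (metis subsetD)
      then show "v \<in> {B +> c | c. c \<in> ?C}" using v by blast
    qed
  qed blast
  ultimately show "\<exists>C. ideal C R \<and> B \<subseteq> C \<and> C \<subseteq> A \<and> N = {B +> c | c. c \<in> C}" by blast
next
  assume "\<exists>C. ideal C R \<and> B \<subseteq> C \<and> C \<subseteq> A \<and> N = {B +> c | c. c \<in> C}"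
  then obtain C where C: "ideal C R" "B \<subseteq> C" "C \<subseteq> A" "N = {B +> c | c. c \<in> C}" by blast
  have FMc: "v \<in> N \<Longrightarrow> v \<in> carrier FM" for v using C FM_carrier by blast
  show "submodule N R FM"
  proof (rule module.submoduleI[OF FM_module])
    show sub: "N \<subseteq> carrier FM" using FMc by blast
    show "\<zero>\<^bsub>FM\<^esub> \<in> N"
      using C ideal_zero[OF C(1)] a_rcos_zero[OF B ideal_zero[OF B]] by (auto simp: FM_zero)
    show smc: "r \<odot>\<^bsub>FM\<^esub> v \<in> N" if "r \<in> carrier R" "v \<in> N" for r v
    proof -
      obtain c where c: "c \<in> C" "v = B +> c" using \<open>v \<in> N\<close> unfolding C(4) by blast
      then have "r \<odot>\<^bsub>FM\<^esub> v = B +> (r \<otimes> c)" using FM_smult[of r c] \<open>r \<in> carrier R\<close> C(3) by blast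
      then show ?thesis using ideal_l[OF C(1) c(1) \<open>r \<in> carrier R\<close>] C(4) by blast
    qed
    show "u \<oplus>\<^bsub>FM\<^esub> v \<in> N" if "u \<in> N" "v \<in> N" for u v
    proof -
      obtain c where c: "c \<in> C" "u = B +> c" using \<open>u \<in> N\<close> unfolding C(4) by blast
      obtain d where d: "d \<in> C" "v = B +> d" using \<open>v \<in> N\<close> unfolding C(4) by blast
      have "u \<oplus>\<^bsub>FM\<^esub> v = B +> (c \<oplus> d)" using FM_add[of c d] c d C(3) by blast
      then show ?thesis using ideal_add[OF C(1) c(1) d(1)] C(4) by blast
    qed
    show "\<ominus>\<^bsub>FM\<^esub> v \<in> N" if v: "v \<in> N" for v
    proof -
      interpret F: module R FM by (rule FM_module)
      have "\<ominus>\<^bsub>FM\<^esub> v = (\<ominus> \<one>) \<odot>\<^bsub>FM\<^esub> v"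
        using FMc[OF v] F.smult_l_minus[of \<one> v] by simp
      then show ?thesis using smc[of "\<ominus> \<one>" v] v by simp
    qed
  qed
qed

lemma coset_image_mono_iff:
  assumes C: "ideal C R" "B \<subseteq> C" "C \<subseteq> A" and D: "ideal D R" "B \<subseteq> D" "D \<subseteq> A"
  shows "{B +> c | c. c \<in> C} \<subseteq> {B +> c | c. c \<in> D} \<longleftrightarrow> C \<subseteq> D"
proof
  assume le: "{B +> c | c. c \<in> C} \<subseteq> {B +> c | c. c \<in> D}"
  show "C \<subseteq> D"
  proof
    fix c assume c: "c \<in> C"
    then obtain d where d: "d \<in> D" "B +> c = B +> d" using le by blast
    have cc: "c \<in> carrier R" "d \<in> carrier R" using c d C D ideal_carr by blast+
    then have "c \<ominus> d \<in> D" using d coset_eq D by blast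
    then have "d \<oplus> (c \<ominus> d) \<in> D" using ideal_add D d by blast
    then show "c \<in> D" using cc by (simp add: add_minus_cancel)
  qed
next
  assume "C \<subseteq> D"
  then show "{B +> c | c. c \<in> C} \<subseteq> {B +> c | c. c \<in> D}" by blast
qed

lemma module_length_factor: "module_length R FM = ilen A B"
proof (rule antisym)
  show "module_length R FM \<le> ilen A B" unfolding module_length_def
  proof (rule Sup_least, safe)
    fix n N assume N: "\<forall>i\<le>n. submodule (N i) R FM" "\<forall>i<n. N i \<subset> N (Suc i)"
    have "\<forall>i\<in>{..n}. \<exists>C. ideal C R \<and> B \<subseteq> C \<and> C \<subseteq> A \<and> N i = {B +> c | c. c \<in> C}"
      using N(1) submodule_FM_iff by simp
    from bchoice[OF this] obtain C
      where "\<forall>i\<in>{..n}. ideal (C i) R \<and> B \<subseteq> C i \<and> C i \<subseteq> A \<and> N i = {B +> c | c. c \<in> C i}"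
      by blast
    then have C: "ideal (C i) R \<and> B \<subseteq> C i \<and> C i \<subseteq> A \<and> N i = {B +> c | c. c \<in> C i}"
      if "i \<le> n" for i using that by simp
    have "ichain A B n C" unfolding ichain_def
    proof (intro conjI allI impI)
      fix i assume "i < n"
      then have i: "i \<le> n" "Suc i \<le> n" "N i \<subset> N (Suc i)" using N by auto
      show "C i \<subset> C (Suc i)"
        using i(3) coset_image_mono_iff[of "C i" "C (Suc i)"] coset_image_mono_iff[of "C (Suc i)" "C i"]
          C[OF i(1)] C[OF i(2)] by (simp add: less_le_not_le)
    qed (use C in auto)
    then show "enat n \<le> ilen A B" by (rule ilen_ge)
  qed
  show "ilen A B \<le> module_length R FM"
  proof (rule ilen_le)
    fix n C assume ch: "ichain A B n C"
    then have C: "ideal (C i) R" "B \<subseteq> C i" "C i \<subseteq> A" if "i \<le> n" for i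
      using that by (auto simp: ichain_def)
    define N where "N = (\<lambda>i. {B +> c | c. c \<in> C i})"
    have "submodule (N i) R FM" if "i \<le> n" for i
      unfolding N_def by (rule iffD2[OF submodule_FM_iff]) (intro exI[of _ "C i"] conjI refl C[OF that])
    then have "\<forall>i\<le>n. submodule (N i) R FM" by simp
    moreover have "\<forall>i<n. N i \<subset> N (Suc i)"
    proof (intro allI impI)
      fix i assume "i < n"
      then have i: "i \<le> n" "Suc i \<le> n" "C i \<subset> C (Suc i)" using ch by (auto simp: ichain_def)
      show "N i \<subset> N (Suc i)" using i(3) coset_image_mono_iff[OF C[OF i(1)] C[OF i(2)]]
          coset_image_mono_iff[OF C[OF i(2)] C[OF i(1)]] by (simp add: less_le_not_le N_def)
    qed
    ultimately show "enat n \<le> module_length R FM"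
      unfolding module_length_def by (intro Sup_upper) blast
  qed
qed

end

lemma quot_length_eq: "ideal A R \<Longrightarrow> ideal B R \<Longrightarrow> B \<subseteq> A \<Longrightarrow> quot_length R A B = the_enat (ilen A B)"
  by (simp add: quot_length_def module_length_factor)

text \<open>Adjoining an element of \<open>A\<close> that is not yet reached uses up at least one
  unit of length, so the length bounds the number of elements required. Generation is expressed by a
  universal property over all ideals \<open>C\<close>, the form in which it is applied
  later.\<close>

lemma ilen_gens:
  assumes A: "ideal A R" and B: "ideal B R" and "B \<subseteq> A" "ilen A B \<noteq> \<infinity>"
  shows "\<exists>S. finite S \<and> S \<subseteq> A \<and> enat (card S) \<le> ilen A B \<and> (\<forall>C. ideal C R \<longrightarrow> B \<subseteq> C \<longrightarrow> S \<subseteq> C \<longrightarrow> A \<subseteq> C)"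
proof -
  obtain n where "ilen A B = enat n" using assms by blast
  then show ?thesis using B \<open>B \<subseteq> A\<close>
  proof (induction n arbitrary: B rule: less_induct)
    case (less n)
    note B = less.prems(2)
    show ?case
    proof (cases "B = A")
      case True
      then show ?thesis by (intro exI[of _ "{}"]) (auto simp: zero_enat_def[symmetric])
    next
      case False
      then obtain a where a: "a \<in> A" "a \<notin> B" using less.prems by blast
      have ac: "a \<in> carrier R" using a ideal_carr[OF A] by blast
      let ?B = "ladd a (carrier R) B"
      have iB: "ideal ?B R" using ac B oneideal by (rule_tac ladd_ideal) auto
      have BB: "B \<subseteq> ?B" using ladd_memr[OF ac oneideal B] by blast
      have aB: "a \<in> ?B" using ladd_meml[OF ac oneideal B, of \<one>] ac by simp
      have BA: "?B \<subseteq> A" using less.prems ideal_r[OF A] a A by (intro ladd_least) auto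
      have "1 \<le> ilen ?B B" using iB B BB aB a by (intro ilen_strict) auto
      moreover have "ilen A ?B + ilen ?B B = enat n"
        using ilen_add[OF A iB B BB BA] less.prems by simp
      ultimately obtain m k where m: "ilen A ?B = enat m" "m < n" "ilen ?B B = enat k" "k \<ge> 1" "m + k = n"
        by (cases "ilen A ?B"; cases "ilen ?B B") (auto simp: one_enat_def)
      obtain S where S: "finite S" "S \<subseteq> A" "enat (card S) \<le> ilen A ?B"
        "\<forall>C. ideal C R \<longrightarrow> ?B \<subseteq> C \<longrightarrow> S \<subseteq> C \<longrightarrow> A \<subseteq> C"
        using less.IH[OF m(2,1) iB BA] by blast
      show ?thesis
      proof (intro exI[of _ "insert a S"] conjI allI impI)
        show "finite (insert a S)" "insert a S \<subseteq> A" using S a by auto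
        show "enat (card (insert a S)) \<le> ilen A B"
          using S(3) m less.prems card_insert_le_m1 by (simp add: card_insert_if S(1))
      next
        fix C assume C: "ideal C R" "B \<subseteq> C" "insert a S \<subseteq> C"
        then have "?B \<subseteq> C" using ideal_r by (intro ladd_least) auto
        then show "A \<subseteq> C" using S C by blast
      qed
    qed
  qed
qed

section \<open>Determinants\<close>

lemma finsum_mem_ideal:
  assumes Q: "ideal Q R" and "finite P" "\<And>p. p \<in> P \<Longrightarrow> f p \<in> Q"
  shows "finsum R f P \<in> Q" using assms(2,3)
proof (induction P rule: finite_induct)
  case (insert p P)
  then have "f \<in> P \<rightarrow> carrier R" "f p \<in> carrier R" using ideal_carr[OF Q] by auto
  then show ?case using insert ideal_add[OF Q] by simp
qed (simp add: ideal_zero[OF Q])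

lemma finsum_swap:
  assumes "finite P" "finite K" "\<And>p k. p \<in> P \<Longrightarrow> k \<in> K \<Longrightarrow> f p k \<in> carrier R"
  shows "(\<Oplus>p\<in>P. \<Oplus>k\<in>K. f p k) = (\<Oplus>k\<in>K. \<Oplus>p\<in>P. f p k)"
  using assms(1,3)
proof (induction P rule: finite_induct)
  case (insert p P)
  have "(\<Oplus>k\<in>K. \<Oplus>p\<in>insert p P. f p k) = (\<Oplus>k\<in>K. f p k \<oplus> (\<Oplus>p\<in>P. f p k))"
  proof (rule finsum_cong')
    show "(\<lambda>k. f p k \<oplus> (\<Oplus>p\<in>P. f p k)) \<in> K \<rightarrow> carrier R"
      using insert.prems by (auto intro!: finsum_closed)
    show "(\<Oplus>p\<in>insert p P. f p k) = f p k \<oplus> (\<Oplus>p\<in>P. f p k)" if "k \<in> K" for k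
      using that insert by (intro finsum_insert) auto
  qed simp
  also have "\<dots> = (\<Oplus>k\<in>K. f p k) \<oplus> (\<Oplus>k\<in>K. \<Oplus>p\<in>P. f p k)"
    using insert.prems by (intro finsum_addf) (auto intro!: finsum_closed)
  also have "\<dots> = (\<Oplus>k\<in>K. f p k) \<oplus> (\<Oplus>p\<in>P. \<Oplus>k\<in>K. f p k)"
    using insert by simp
  also have "\<dots> = (\<Oplus>p\<in>insert p P. \<Oplus>k\<in>K. f p k)"
    using insert by (intro finsum_insert[symmetric]) (auto intro!: finsum_closed)
  finally show ?case by simp
qed simp

text \<open>A Leibniz term without its sign. \<open>p\<close> is an arbitrary map, because
  \<open>det_kernel\<close> composes permutations with a map that redirects one column to
  another.\<close>

definition perm_term :: "'i set \<Rightarrow> ('i \<Rightarrow> 'i \<Rightarrow> 'a) \<Rightarrow> ('i \<Rightarrow> 'i) \<Rightarrow> 'a" where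
  "perm_term S E p = (\<Otimes>i\<in>S. E i (p i))"

lemma perm_term_closed:
  assumes "\<And>i k. i \<in> S \<Longrightarrow> k \<in> S \<Longrightarrow> E i k \<in> carrier R" "p ` S \<subseteq> S"
  shows "perm_term S E p \<in> carrier R"
  unfolding perm_term_def using assms by (intro finprod_closed) auto

text \<open>The two sums below are the positive and the negative part of the Leibniz formula for the
  determinant of \<open>E\<close>.\<close>

lemma det_kernel:
  fixes S :: "'i set"
  assumes S: "finite S" "z \<in> S"
    and E: "\<And>i k. i \<in> S \<Longrightarrow> k \<in> S \<Longrightarrow> E i k \<in> carrier R"
    and y: "\<And>k. k \<in> S \<Longrightarrow> y k \<in> carrier R" "y z = \<one>"
    and ker: "\<And>i. i \<in> S \<Longrightarrow> (\<Oplus>k\<in>S. E i k \<otimes> y k) = \<zero>"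
  shows "(\<Oplus>p\<in>{p. p permutes S \<and> evenperm p}. perm_term S E p)
       = (\<Oplus>p\<in>{p. p permutes S \<and> \<not> evenperm p}. perm_term S E p)"
proof -
  let ?P = "\<lambda>b. {p. p permutes S \<and> evenperm p = b}"
  \<comment> \<open>\<open>?W k p\<close> is the Leibniz term of the matrix in which column
    \<open>z\<close> is replaced by column \<open>k\<close>; for \<open>k = z\<close> it is the term
    of \<open>E\<close> itself.\<close>
  define r where "r k j = (if j = z then k else j)" for k j
  let ?W = "\<lambda>k p. perm_term S E (r k \<circ> p)"
  have fin: "finite (?P b)" for b by (rule finite_subset[OF _ finite_permutations[OF S(1)]]) auto
  have Wc: "?W k p \<in> carrier R" if "p permutes S" "k \<in> S" for k p
    using that E by (intro perm_term_closed) (auto simp: r_def permutes_in_image)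
  \<comment> \<open>Two columns agree: composing with the transposition of \<open>z\<close> and
    \<open>k\<close> reverses the parity of \<open>p\<close> and leaves the term unchanged, so the
    even and the odd sum coincide.\<close>
  have swap: "(\<Oplus>p\<in>?P True. ?W k p) = (\<Oplus>p\<in>?P False. ?W k p)" if k: "k \<in> S - {z}" for k
  proof -
    let ?t = "\<lambda>p. transpose z k \<circ> p"
    have tt: "?t (?t p) = p" for p :: "'i \<Rightarrow> 'i" by (auto simp: fun_eq_iff)
    have ev: "?t p \<in> ?P (\<not> b)" if "p \<in> ?P b" for p b
    proof -
      have "permutation p" using that S(1) permutation_permutes by blast
      then have "evenperm (?t p) \<longleftrightarrow> evenperm (transpose z k) = evenperm p"
        by (intro evenperm_comp permutation_swap_id)
      then show ?thesis using that k S(2)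
        by (auto simp: evenperm_swap intro: permutes_compose permutes_swap_id)
    qed
    have img: "?P False = ?t ` ?P True"
    proof
      show "?P False \<subseteq> ?t ` ?P True"
      proof
        fix p assume "p \<in> ?P False"
        then have "?t p \<in> ?P True" using ev[of p False] by simp
        then show "p \<in> ?t ` ?P True" using tt[of p] by (metis imageI)
      qed
    qed (use ev[of _ True] in auto)
    have inj: "inj_on ?t (?P True)" by (rule inj_on_inverseI[of _ ?t]) (rule tt)
    have W: "?W k (?t p) = ?W k p" for p
    proof -
      have "r k (transpose z k j) = r k j" for j by (auto simp: r_def transpose_def)
      then show ?thesis by (simp add: perm_term_def)
    qed
    have "(\<Oplus>p\<in>?t ` ?P True. ?W k p) = (\<Oplus>p\<in>?P True. ?W k (?t p))"
      using inj ev[of _ True] k by (intro finsum_reindex) (auto intro!: Wc)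
    then show ?thesis by (simp only: img W)
  qed
  \<comment> \<open>Only the entry of the row that \<open>p\<close> sends to \<open>z\<close> varies
    with \<open>k\<close>; factoring out the other entries leaves the relation \<open>ker\<close>
    for this row.\<close>
  have lin: "(\<Oplus>k\<in>S. ?W k p \<otimes> y k) = \<zero>" if p: "p permutes S" for p
  proof -
    let ?i = "inv_into UNIV p z"
    have i: "?i \<in> S" "p ?i = z" using p S(2) by (auto simp: permutes_inverses permutes_in_image permutes_inv)
    have ne: "p i \<noteq> z" if "i \<noteq> ?i" for i using that p permutes_inverses(2) by metis
    let ?U = "\<Otimes>i\<in>S - {?i}. E i (p i)"
    have Uc: "?U \<in> carrier R" using p E by (auto intro!: finprod_closed simp: permutes_in_image)
    have WU: "?W k p = ?U \<otimes> E ?i k" if k: "k \<in> S" for k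
    proof -
      have S': "S = insert ?i (S - {?i})" using i by blast
      have c: "(\<lambda>i. E i ((r k \<circ> p) i)) \<in> S \<rightarrow> carrier R"
        using k p E by (auto simp: r_def permutes_in_image)
      have "?W k p = (\<Otimes>i\<in>insert ?i (S - {?i}). E i ((r k \<circ> p) i))"
        unfolding perm_term_def using S' by simp
      also have "\<dots> = E ?i ((r k \<circ> p) ?i) \<otimes> (\<Otimes>i\<in>S - {?i}. E i ((r k \<circ> p) i))"
        using c i S(1) by (intro finprod_insert) (auto dest: funcset_mem[OF _ i(1)])
      also have "(\<Otimes>i\<in>S - {?i}. E i ((r k \<circ> p) i)) = ?U"
        using ne p E by (intro finprod_cong') (auto simp: r_def permutes_in_image)
      also have "(r k \<circ> p) ?i = k" using i by (simp add: r_def)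
      finally show ?thesis using m_comm[OF E[OF i(1) k] Uc] by (rule trans)
    qed
    have "(\<Oplus>k\<in>S. ?W k p \<otimes> y k) = (\<Oplus>k\<in>S. ?U \<otimes> (E ?i k \<otimes> y k))"
      using WU i E y Uc by (intro finsum_cong') (auto simp: m_assoc)
    also have "\<dots> = ?U \<otimes> (\<Oplus>k\<in>S. E ?i k \<otimes> y k)"
      using i E y Uc S by (intro finsum_rdistr[symmetric]) auto
    finally show ?thesis using ker[OF i(1)] Uc by simp
  qed
  have W0: "?W z p = perm_term S E p" for p
    by (simp add: perm_term_def r_def if_distrib cong: if_cong)
  \<comment> \<open>Since \<open>y z = \<one>\<close>, summing \<open>lin\<close> over the
    permutations of one parity expresses that half of the determinant through the sums with a
    replaced column, which by \<open>swap\<close> are the same for both parities.\<close>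
  have main: "(\<Oplus>p\<in>?P b. perm_term S E p) = \<ominus> (\<Oplus>k\<in>S - {z}. (\<Oplus>p\<in>?P b. ?W k p) \<otimes> y k)" for b
  proof -
    have c: "(\<Oplus>p\<in>?P b. ?W k p) \<in> carrier R" if "k \<in> S" for k
      using that Wc by (intro finsum_closed) auto
    have "\<zero> = (\<Oplus>p\<in>?P b. \<Oplus>k\<in>S. ?W k p \<otimes> y k)"
      using lin by (simp cong: finsum_cong add: finsum_zero)
    also have "\<dots> = (\<Oplus>k\<in>S. \<Oplus>p\<in>?P b. ?W k p \<otimes> y k)"
      using Wc y S fin by (intro finsum_swap) auto
    also have "\<dots> = (\<Oplus>k\<in>S. (\<Oplus>p\<in>?P b. ?W k p) \<otimes> y k)"
      using Wc y S fin c by (intro finsum_cong' finsum_ldistr[symmetric]) auto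
    also have "\<dots> = (\<Oplus>k\<in>insert z (S - {z}). (\<Oplus>p\<in>?P b. ?W k p) \<otimes> y k)"
      using S(2) by (simp add: insert_absorb)
    also have "\<dots> = (\<Oplus>p\<in>?P b. ?W z p) \<otimes> y z \<oplus> (\<Oplus>k\<in>S - {z}. (\<Oplus>p\<in>?P b. ?W k p) \<otimes> y k)"
      using c y S by (intro finsum_insert) auto
    finally have "(\<Oplus>p\<in>?P b. ?W z p) \<oplus> (\<Oplus>k\<in>S - {z}. (\<Oplus>p\<in>?P b. ?W k p) \<otimes> y k) = \<zero>"
      using c[OF S(2)] y(2) by simp
    moreover have "(\<Oplus>k\<in>S - {z}. (\<Oplus>p\<in>?P b. ?W k p) \<otimes> y k) \<in> carrier R"
      using c y by (intro finsum_closed) auto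
    ultimately have "\<ominus> (\<Oplus>k\<in>S - {z}. (\<Oplus>p\<in>?P b. ?W k p) \<otimes> y k) = (\<Oplus>p\<in>?P b. ?W z p)"
      using c[OF S(2)] by (intro minus_equality)
    then show ?thesis by (simp only: W0)
  qed
  have "(\<Oplus>k\<in>S - {z}. (\<Oplus>p\<in>?P True. ?W k p) \<otimes> y k) = (\<Oplus>k\<in>S - {z}. (\<Oplus>p\<in>?P False. ?W k p) \<otimes> y k)"
    using swap Wc y by (intro finsum_cong') (auto intro!: finsum_closed)
  then show ?thesis using main[of True] main[of False] by simp
qed

text \<open>A kernel vector with an entry \<open>\<one>\<close> forces the determinant to vanish;
  modulo \<open>Q\<close> only the term of the identity permutation is left of it.\<close>

lemma det_kernel_ideal:
  fixes S :: "'i set"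
  assumes S: "finite S" "z \<in> S"
    and E: "\<And>i k. i \<in> S \<Longrightarrow> k \<in> S \<Longrightarrow> E i k \<in> carrier R"
    and y: "\<And>k. k \<in> S \<Longrightarrow> y k \<in> carrier R" "y z = \<one>"
    and ker: "\<And>i. i \<in> S \<Longrightarrow> (\<Oplus>k\<in>S. E i k \<otimes> y k) = \<zero>"
    and Q: "ideal Q R" "\<And>p. p permutes S \<Longrightarrow> p \<noteq> id \<Longrightarrow> perm_term S E p \<in> Q"
  shows "(\<Otimes>i\<in>S. E i i) \<in> Q"
proof -
  let ?P0 = "{p. p permutes S \<and> evenperm p}" and ?P1 = "{p. p permutes S \<and> \<not> evenperm p}"
  have fin: "finite ?P0" "finite ?P1"
    by (rule finite_subset[OF _ finite_permutations[OF S(1)]]; auto)+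
  have c: "perm_term S E p \<in> carrier R" if "p permutes S" for p
    using that E by (intro perm_term_closed) (auto simp: permutes_in_image)
  have id0: "id \<in> ?P0" by (simp add: permutes_id)
  let ?s = "finsum R (perm_term S E) (?P0 - {id})" and ?t = "finsum R (perm_term S E) ?P1"
  have s: "?s \<in> Q" using fin Q by (intro finsum_mem_ideal) auto
  have "?t \<in> Q"
  proof (rule finsum_mem_ideal[OF Q(1) fin(2)])
    fix p assume p: "p \<in> ?P1"
    then have "p \<noteq> id" using evenperm_id by blast
    then show "perm_term S E p \<in> Q" using p Q(2) by blast
  qed
  moreover have "finsum R (perm_term S E) ?P0 = perm_term S E id \<oplus> ?s"
  proof -
    have "finsum R (perm_term S E) (insert id (?P0 - {id})) = perm_term S E id \<oplus> ?s"
      using fin(1) c permutes_id by (intro finsum_insert) auto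
    moreover have "insert id (?P0 - {id}) = ?P0" using id0 by blast
    ultimately show ?thesis by simp
  qed
  moreover have "finsum R (perm_term S E) ?P0 = ?t" by (rule det_kernel[OF S E y ker])
  ultimately have "perm_term S E id \<oplus> ?s \<in> Q" by simp
  then have "(perm_term S E id \<oplus> ?s) \<ominus> ?s \<in> Q" using s ideal_minus[OF Q(1)] by blast
  then have "perm_term S E id \<in> Q"
    using c[OF permutes_id] ideal_carr[OF Q(1) s] by (simp add: add_minus_cancel(1))
  then show ?thesis by (simp add: perm_term_def)
qed

section \<open>Products and colons of ideals\<close>

lemma ideal_prod_mem: "a \<in> A \<Longrightarrow> b \<in> B \<Longrightarrow> a \<otimes> b \<in> A \<cdot> B"
  by (rule ideal_prod.prod)

lemma ideal_prod_le:
  assumes "ideal Q R" "\<And>a b. a \<in> A \<Longrightarrow> b \<in> B \<Longrightarrow> a \<otimes> b \<in> Q"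
  shows "A \<cdot> B \<subseteq> Q"
proof
  fix s assume "s \<in> A \<cdot> B"
  then show "s \<in> Q" by (induction s rule: ideal_prod.induct) (use assms ideal_add in auto)
qed

lemma ideal_prod_mono:
  assumes "A \<subseteq> A'" "B \<subseteq> B'"
  shows "A \<cdot> B \<subseteq> A' \<cdot> B'"
proof
  fix s assume "s \<in> A \<cdot> B"
  then show "s \<in> A' \<cdot> B'"
    by (induction s rule: ideal_prod.induct) (use assms in \<open>auto intro: ideal_prod.intros\<close>)
qed

lemma ideal_prod_lcomm:
  assumes "ideal A R" "ideal B R" "ideal C R"
  shows "A \<cdot> (B \<cdot> C) = B \<cdot> (A \<cdot> C)"
  by (metis assms ideal_prod_assoc ideal_prod_commute)

lemmas ideal_prod_ac = ideal_prod_assoc ideal_prod_commute ideal_prod_lcomm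

lemma ideal_prod_sub:
  assumes "ideal A R" "ideal B R"
  shows "A \<cdot> B \<subseteq> A" "A \<cdot> B \<subseteq> B"
  using ideal_prod_inter[OF assms] by auto

abbreviation ipow :: "'a set \<Rightarrow> nat \<Rightarrow> 'a set" where
  "ipow \<equiv> ideal_power R"

lemma ipow_0: "ipow A 0 = carrier R"
  by (simp add: ideals_set_def nat_pow_def)

lemma ipow_ideal: "ideal A R \<Longrightarrow> ideal (ipow A n) R"
proof -
  interpret S: comm_monoid "ideals_set R" by (rule ideals_set_is_comm_monoid)
  assume "ideal A R"
  then show ?thesis using S.nat_pow_closed[of A n] by (simp add: ideals_set_def)
qed

lemma ipow_add:
  "ideal A R \<Longrightarrow> ipow A (m + n) = ipow A m \<cdot> ipow A n"
proof -
  interpret S: comm_monoid "ideals_set R" by (rule ideals_set_is_comm_monoid)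
  assume "ideal A R"
  then show ?thesis using S.nat_pow_mult[of A m n] by (simp add: ideals_set_def)
qed

lemma ipow_1: "ideal A R \<Longrightarrow> ipow A (Suc 0) = A"
proof -
  interpret S: comm_monoid "ideals_set R" by (rule ideals_set_is_comm_monoid)
  assume "ideal A R"
  then show ?thesis using S.nat_pow_eone[of A] by (simp add: ideals_set_def)
qed

lemma ipow_Suc: "ideal A R \<Longrightarrow> ipow A (Suc n) = A \<cdot> ipow A n"
  using ipow_add[of A 1 n] ipow_1[of A] by simp

lemma ipow_mono: "ideal A R \<Longrightarrow> ideal B R \<Longrightarrow> A \<subseteq> B \<Longrightarrow> ipow A n \<subseteq> ipow B n"
proof (induction n)
  case (Suc n)
  then show ?case by (simp only: ipow_Suc ideal_prod_mono)
qed (simp add: ipow_0)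

lemma ipow_antimono:
  assumes "ideal A R" "m \<le> n"
  shows "ipow A n \<subseteq> ipow A m" using ipow_add[OF assms(1), of m "n - m"] assms(2)
    ideal_prod_sub(1)[OF ipow_ideal ipow_ideal, OF assms(1) assms(1)] by simp

section \<open>Lengths as natural numbers\<close>

definition len :: "'a set \<Rightarrow> 'a set \<Rightarrow> nat" where
  "len A B = the_enat (ilen A B)"

lemma ilen_finite_mono:
  assumes "ilen (carrier R) C \<noteq> \<infinity>" "A \<subseteq> carrier R" "C \<subseteq> B"
  shows "ilen A B \<noteq> \<infinity>"
  using ilen_mono[OF assms(2,3)] assms(1) enat_ord_simps(5) by metis

lemma len_add:
  assumes A: "ideal A R" and B: "ideal B R" and C: "ideal C R" and sub: "C \<subseteq> B" "B \<subseteq> A"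
    and fin: "ilen (carrier R) C \<noteq> \<infinity>"
  shows "len A C = len A B + len B C"
proof -
  have "ilen A B \<noteq> \<infinity>" by (rule ilen_finite_mono[OF fin ideal_sub[OF A] sub(1)])
  moreover have "ilen B C \<noteq> \<infinity>" by (rule ilen_finite_mono[OF fin ideal_sub[OF B] subset_refl])
  ultimately show ?thesis using ilen_add[OF A B C sub] by (auto simp: len_def)
qed

lemma len_mono:
  assumes "A \<subseteq> A'" "B' \<subseteq> B" "A' \<subseteq> carrier R" "ilen (carrier R) B' \<noteq> \<infinity>"
  shows "len A B \<le> len A' B'"
proof -
  have "ilen A' B' \<noteq> \<infinity>" by (rule ilen_finite_mono[OF assms(4,3) subset_refl])
  then show ?thesis using ilen_mono[OF assms(1,2)] by (cases "ilen A B"; cases "ilen A' B'") (auto simp: len_def)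
qed

lemma ilen_self: "ilen A A = 0"
proof -
  have "ilen A A \<le> 0"
  proof (rule ilen_le)
    fix n N assume ch: "ichain A A n N"
    have "\<not> 0 < n"
    proof
      assume "0 < n"
      then have "N 0 = A" "N 1 = A" "N 0 \<subset> N 1" using ch unfolding ichain_def
        by (metis One_nat_def Suc_leI le0 subset_antisym)+
      then show False by simp
    qed
    then show "enat n \<le> 0" by (simp add: zero_enat_def)
  qed
  then show ?thesis by simp
qed

lemma len_self: "len A A = 0"
  by (simp add: len_def ilen_self zero_enat_def)

lemma len_strict:
  assumes A: "ideal A R" and B: "ideal B R" and "B \<subseteq> A" "len A B = 0"
    and fin: "ilen (carrier R) B \<noteq> \<infinity>"
  shows "A = B"
proof (rule ccontr)
  assume "A \<noteq> B"
  then have "1 \<le> ilen A B" using assms by (intro ilen_strict) auto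
  moreover have "ilen A B \<noteq> \<infinity>" by (rule ilen_finite_mono[OF fin ideal_sub[OF A] subset_refl])
  ultimately show False using assms(4) by (cases "ilen A B") (simp_all add: len_def one_enat_def)
qed

lemma len_ladd:
  "u \<in> carrier R \<Longrightarrow> ideal A R \<Longrightarrow> ideal B R \<Longrightarrow> len (ladd u A B) B = len A (A \<inter> colon B {u})"
  by (simp add: len_def ilen_ladd)

text \<open>The ideal (x, y) M, see \<open>dbl_prod\<close>, and for \<open>M = carrier R\<close>
  the ideal (x, y). The explicit pair of coefficients is what arguments with syzygies operate
  on.\<close>

definition dbl :: "'a \<Rightarrow> 'a \<Rightarrow> 'a set \<Rightarrow> 'a set" where
  "dbl x y M = {x \<otimes> a \<oplus> y \<otimes> b | a b. a \<in> M \<and> b \<in> M}"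

lemma dbl_ladd:
  assumes "x \<in> carrier R" "y \<in> carrier R" "ideal M R"
  shows "dbl x y M = ladd x M (ladd y M {\<zero>})"
proof -
  have "y \<otimes> b \<oplus> \<zero> = y \<otimes> b" if "b \<in> M" for b using that assms ideal_carr[OF assms(3)] by simp
  then have "ladd y M {\<zero>} = {y \<otimes> b | b. b \<in> M}" by (force simp: ladd_def)
  then show ?thesis by (auto simp: dbl_def ladd_def)
qed

lemma dbl_ideal:
  assumes "x \<in> carrier R" "y \<in> carrier R" "ideal M R"
  shows "ideal (dbl x y M) R"
  unfolding dbl_ladd[OF assms] using assms zeroideal by (intro ladd_ideal) auto

lemma dbl_carrier:
  assumes "x \<in> carrier R" "y \<in> carrier R"
  shows "x \<in> dbl x y (carrier R)" "y \<in> dbl x y (carrier R)"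
proof -
  have "x = x \<otimes> \<one> \<oplus> y \<otimes> \<zero>" "y = x \<otimes> \<zero> \<oplus> y \<otimes> \<one>" using assms by simp_all
  then show "x \<in> dbl x y (carrier R)" "y \<in> dbl x y (carrier R)" unfolding dbl_def by blast+
qed

lemma dbl_prod:
  assumes xy: "x \<in> carrier R" "y \<in> carrier R" and M: "ideal M R"
  shows "dbl x y (carrier R) \<cdot> M = dbl x y M"
proof
  note c = ideal_carr[OF M] xy
  show "dbl x y (carrier R) \<cdot> M \<subseteq> dbl x y M"
  proof (rule ideal_prod_le[OF dbl_ideal[OF assms]])
    fix v m assume "v \<in> dbl x y (carrier R)" and m: "m \<in> M"
    then obtain a b where v: "a \<in> carrier R" "b \<in> carrier R" "v = x \<otimes> a \<oplus> y \<otimes> b" by (auto simp: dbl_def)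
    then have "v \<otimes> m = x \<otimes> (a \<otimes> m) \<oplus> y \<otimes> (b \<otimes> m)" using m c by (simp add: l_distr m_assoc)
    then show "v \<otimes> m \<in> dbl x y M" unfolding dbl_def using ideal_l[OF M m] v by blast
  qed
  show "dbl x y M \<subseteq> dbl x y (carrier R) \<cdot> M"
    unfolding dbl_def[of x y M] using dbl_carrier[OF xy] by (auto intro!: ideal_prod.intros)
qed

lemma dbl_least:
  assumes "ideal C R" "x \<in> C" "y \<in> C"
  shows "dbl x y (carrier R) \<subseteq> C"
  using assms by (auto simp: dbl_def intro!: ideal_add ideal_r)

text \<open>Vanishing of the first Koszul homology: every relation is a multiple of the trivial one.
  The condition is symmetric in \<open>x\<close> and \<open>y\<close>, unlike that of a regular
  sequence.\<close>

definition syz2 :: "'a \<Rightarrow> 'a \<Rightarrow> bool" where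
  "syz2 x y \<longleftrightarrow> x \<in> carrier R \<and> y \<in> carrier R \<and>
    (\<forall>u\<in>carrier R. \<forall>v\<in>carrier R. x \<otimes> u = y \<otimes> v \<longrightarrow> (\<exists>t\<in>carrier R. u = y \<otimes> t \<and> v = x \<otimes> t))"

text \<open>Both layers of \<open>J M \<subseteq> (x) + J M \<subseteq> J\<close> are cyclic, and triviality of the syzygies
  identifies their annihilators.\<close>

lemma len_dbl:
  assumes s: "syz2 x y" and M: "ideal M R" and fin: "ilen (carrier R) (dbl x y M) \<noteq> \<infinity>"
  shows "len (carrier R) (dbl x y M) + len (carrier R) (colon M (dbl x y (carrier R)))
       = len (carrier R) (dbl x y (carrier R)) + 2 * len (carrier R) M"
proof -
  have x: "x \<in> carrier R" and y: "y \<in> carrier R" using s by (auto simp: syz2_def)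
  note c = ideal_carr[OF M] x y
  let ?R = "carrier R" and ?D = "dbl x y M" and ?J = "dbl x y (carrier R)"
  let ?P = "ladd x ?R ?D" and ?xM = "ladd x ?R M" and ?Mx = "colon M {x}"
  let ?yM = "ladd y ?Mx M" and ?MJ = "colon M ?J"
  have iD: "ideal ?D R" and iJ: "ideal ?J R" using dbl_ideal x y M oneideal by auto
  have iP: "ideal ?P R" and ixM: "ideal ?xM R" using ladd_ideal x iD M oneideal by auto
  have iMx: "ideal ?Mx R" "ideal (colon M {y}) R" using colon_ideal M x y by auto
  have iyM: "ideal ?yM R" using ladd_ideal y iMx M by auto
  have iMJ: "ideal ?MJ R" using colon_ideal M ideal_sub[OF iJ] by auto
  have DM: "?D \<subseteq> M" using M x y by (auto simp: dbl_def intro!: ideal_add ideal_l)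
  have finM: "ilen ?R M \<noteq> \<infinity>" by (rule ilen_finite_mono[OF fin subset_refl DM])
  have JP: "?J = ladd y ?R ?P"
  proof
    show "?J \<subseteq> ladd y ?R ?P"
    proof
      fix v assume "v \<in> ?J"
      then obtain a b where v: "a \<in> ?R" "b \<in> ?R" "v = y \<otimes> b \<oplus> x \<otimes> a" using x y by (auto simp: dbl_def a_comm)
      then show "v \<in> ladd y ?R ?P" using ladd_meml[OF x oneideal iD v(1)] by (auto intro!: laddI)
    qed
    have DJ: "?D \<subseteq> ?J" using ideal_sub[OF M] unfolding dbl_def by blast
    have PJ: "?P \<subseteq> ?J" by (intro ladd_least[OF iJ DJ] ideal_r[OF iJ] dbl_carrier[OF x y])
    show "ladd y ?R ?P \<subseteq> ?J"
      by (intro ladd_least[OF iJ PJ] ideal_r[OF iJ] dbl_carrier[OF x y])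
  qed
  have PJ: "?P \<subseteq> ?J" unfolding JP using ladd_memr[OF y oneideal iP] by blast
  have DP: "?D \<subseteq> ?P" using ladd_memr[OF x oneideal iD] by blast
  \<comment> \<open>If u y lies in (x) + (x, y) M, subtracting a suitable \<open>b \<in> M\<close>
    turns u into a coefficient of a relation between \<open>x\<close> and \<open>y\<close>, hence
    into a multiple of \<open>x\<close>.\<close>
  have c1: "colon ?P {y} = ?xM"
  proof
    show "colon ?P {y} \<subseteq> ?xM"
    proof
      fix u assume "u \<in> colon ?P {y}"
      then have u: "u \<in> ?R" "u \<otimes> y \<in> ?P" by (auto simp: colon_def)
      then obtain r a b where r: "r \<in> ?R" "a \<in> M" "b \<in> M" "u \<otimes> y = x \<otimes> r \<oplus> (x \<otimes> a \<oplus> y \<otimes> b)"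
        by (auto simp: ladd_def dbl_def)
      have "y \<otimes> (u \<ominus> b) = x \<otimes> (r \<oplus> a)"
      proof -
        have "u \<otimes> y = x \<otimes> (r \<oplus> a) \<oplus> y \<otimes> b" using r c by (simp add: r_distr a_assoc)
        then have "u \<otimes> y \<ominus> y \<otimes> b = x \<otimes> (r \<oplus> a)" using r c by (simp add: add_minus_cancel)
        moreover have "u \<otimes> y \<ominus> y \<otimes> b = y \<otimes> (u \<ominus> b)" using u r c by (simp add: a_minus_def r_distr r_minus m_comm)
        ultimately show ?thesis by simp
      qed
      then obtain t where t: "t \<in> ?R" "u \<ominus> b = x \<otimes> t"
        using s r u c unfolding syz2_def by (metis add.m_closed minus_closed)
      then have "u = x \<otimes> t \<oplus> b" using u r c add_minus_cancel(3)[of b u] by (simp add: a_comm)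
      then show "u \<in> ?xM" using t r by (auto intro!: laddI)
    qed
    show "?xM \<subseteq> colon ?P {y}"
    proof
      fix u assume "u \<in> ?xM"
      then obtain t m where t: "t \<in> ?R" "m \<in> M" "u = x \<otimes> t \<oplus> m" by (auto elim: laddE)
      have "u \<otimes> y = x \<otimes> (t \<otimes> y) \<oplus> (x \<otimes> \<zero> \<oplus> y \<otimes> m)" using t c by (simp add: l_distr r_distr m_ac)
      moreover have "x \<otimes> \<zero> \<oplus> y \<otimes> m \<in> ?D" using t ideal_zero[OF M] unfolding dbl_def by blast
      ultimately have "u \<otimes> y \<in> ?P" using t y laddI[of "t \<otimes> y" ?R _ ?D x] by simp
      then show "u \<in> colon ?P {y}" using t c by (simp add: colon_def)
    qed
  qed
  \<comment> \<open>Here the relation is x (u - a) = y b with \<open>b \<in> M\<close>. Its factor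
    \<open>t\<close> satisfies b = x t, so \<open>t\<close> lies in M : x; this is why
    \<open>y\<close> is multiplied by M : x only.\<close>
  have c2: "colon ?D {x} = ?yM"
  proof
    show "colon ?D {x} \<subseteq> ?yM"
    proof
      fix u assume "u \<in> colon ?D {x}"
      then have u: "u \<in> ?R" "u \<otimes> x \<in> ?D" by (auto simp: colon_def)
      then obtain a b where r: "a \<in> M" "b \<in> M" "u \<otimes> x = x \<otimes> a \<oplus> y \<otimes> b"
        by (auto simp: dbl_def)
      have "x \<otimes> (u \<ominus> a) = y \<otimes> b"
      proof -
        have "u \<otimes> x \<ominus> x \<otimes> a = y \<otimes> b" using r c by (simp add: add_minus_cancel)
        moreover have "u \<otimes> x \<ominus> x \<otimes> a = x \<otimes> (u \<ominus> a)" using u r c by (simp add: a_minus_def r_distr r_minus m_comm)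
        ultimately show ?thesis by simp
      qed
      then obtain t where t: "t \<in> ?R" "u \<ominus> a = y \<otimes> t" "b = x \<otimes> t"
        using s r u c unfolding syz2_def by (metis minus_closed)
      have "u = y \<otimes> t \<oplus> a" using t u r c add_minus_cancel(3)[of a u] by (simp add: a_comm)
      moreover have "t \<in> ?Mx" using t r x by (simp add: colon_def m_comm)
      ultimately show "u \<in> ?yM" using r by (auto intro!: laddI)
    qed
    show "?yM \<subseteq> colon ?D {x}"
    proof
      fix u assume "u \<in> ?yM"
      then obtain t m where t: "t \<in> ?R" "t \<otimes> x \<in> M" "m \<in> M" "u = y \<otimes> t \<oplus> m" by (auto elim: laddE simp: colon_def)
      have "u \<otimes> x = x \<otimes> m \<oplus> y \<otimes> (t \<otimes> x)" using t c by (simp add: l_distr r_distr m_ac a_ac)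
      then have "u \<otimes> x \<in> ?D" using t unfolding dbl_def by blast
      then show "u \<in> colon ?D {x}" using t c by (simp add: colon_def)
    qed
  qed
  have c3: "?Mx \<inter> colon M {y} = ?MJ"
  proof
    show "?Mx \<inter> colon M {y} \<subseteq> ?MJ"
    proof
      fix u assume "u \<in> ?Mx \<inter> colon M {y}"
      then have u: "u \<in> ?R" "u \<otimes> x \<in> M" "u \<otimes> y \<in> M" by (auto simp: colon_def)
      have "u \<otimes> v \<in> M" if vJ: "v \<in> ?J" for v
      proof -
        obtain a b where v: "a \<in> ?R" "b \<in> ?R" "v = x \<otimes> a \<oplus> y \<otimes> b" using vJ by (auto simp: dbl_def)
        have "u \<otimes> v = (u \<otimes> x) \<otimes> a \<oplus> (u \<otimes> y) \<otimes> b" using v u x y by (simp add: r_distr m_assoc)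
        then show ?thesis using u v M by (simp add: ideal_add ideal_r)
      qed
      then show "u \<in> ?MJ" using u by (simp add: colon_def)
    qed
    show "?MJ \<subseteq> ?Mx \<inter> colon M {y}" using dbl_carrier[OF x y] by (auto simp: colon_def)
  qed
  have sub: "?Mx \<subseteq> ?R" "?xM \<subseteq> ?R" "?yM \<subseteq> ?R" "?MJ \<subseteq> ?R" "?J \<subseteq> ?R" "?P \<subseteq> ?R" "?MJ \<subseteq> ?Mx"
    using iMx ixM iyM iMJ iJ iP ideal_sub c3 by auto
  have "M \<subseteq> ?MJ" using M ideal_sub[OF iJ] by (auto simp: colon_def intro: ideal_r dest: ideal_carr)
  then have finMJ: "ilen ?R ?MJ \<noteq> \<infinity>" "ilen ?R ?Mx \<noteq> \<infinity>" using ilen_finite_mono[OF finM subset_refl] sub(7) by blast+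
  have finJ: "ilen ?R ?P \<noteq> \<infinity>" by (rule ilen_finite_mono[OF fin subset_refl DP])
  \<comment> \<open>R/M is split twice, along (x) + M and along y (M : x) + M. One part of each
    splitting is a layer of R/J M, and the two remaining parts add up to R/(M : J).\<close>
  have "len ?R ?D = len ?R ?P + len ?P ?D" using len_add[OF oneideal iP iD DP] sub fin by simp
  moreover have "len ?R ?P = len ?R ?J + len ?J ?P" using len_add[OF oneideal iJ iP PJ] sub finJ by simp
  moreover have "len ?J ?P = len ?R ?xM"
    unfolding JP using len_ladd[OF y oneideal iP] c1 sub(2) by (simp add: Int_absorb1)
  moreover have "len ?P ?D = len ?R ?yM"
    using len_ladd[OF x oneideal iD] c2 sub(3) by (simp add: Int_absorb1)
  moreover have "len ?R M = len ?R ?xM + len ?R ?Mx"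
    using len_add[OF oneideal ixM M _ sub(2) finM] ladd_memr[OF x oneideal M]
      len_ladd[OF x oneideal M] sub(1) by (auto simp: Int_absorb1)
  moreover have "len ?R M = len ?R ?yM + len ?Mx ?MJ"
    using len_add[OF oneideal iyM M _ sub(3) finM] ladd_memr[OF y iMx(1) M]
      len_ladd[OF y iMx(1) M] c3 by auto
  moreover have "len ?R ?MJ = len ?R ?Mx + len ?Mx ?MJ"
    using len_add[OF oneideal iMx(1) iMJ sub(7,1) finMJ(1)] .
  ultimately show ?thesis by linarith
qed

end

section \<open>Noetherian local rings: finite length and Nakayama's lemma\<close>

lemma (in noetherian_ring) proper_ideal_maximal:
  assumes A: "ideal A R" "A \<noteq> carrier R"
  shows "\<exists>M. maximalideal M R \<and> A \<subseteq> M"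
proof -
  let ?S = "{M. ideal M R \<and> A \<subseteq> M \<and> M \<noteq> carrier R}"
  have "\<exists>M\<in>?S. \<forall>M'\<in>?S. M \<subseteq> M' \<longrightarrow> M' = M"
  proof (rule subset_Zorn)
    fix C assume C: "subset.chain ?S C"
    show "\<exists>U\<in>?S. \<forall>M\<in>C. M \<subseteq> U"
    proof (cases "C = {}")
      case False
      have sub: "M \<in> ?S" if "M \<in> C" for M using C that unfolding subset.chain_def by blast
      have "subset.chain {I. ideal I R} C" using C by (auto simp: subset.chain_def)
      then have "\<Union>C \<in> C" by (rule ideal_chain_is_trivial[OF False])
      from sub[OF this] show ?thesis by (rule rev_bexI) blast
    next
      case True
      have "A \<in> ?S" using A by blast
      then show ?thesis using True by blast
    qed
  qed
  then obtain M where M: "ideal M R" "A \<subseteq> M" "M \<noteq> carrier R"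
    and max: "\<forall>M'. ideal M' R \<and> A \<subseteq> M' \<and> M' \<noteq> carrier R \<longrightarrow> M \<subseteq> M' \<longrightarrow> M' = M" by auto
  have "maximalideal M R"
  proof (rule maximalidealI)
    fix M' assume "ideal M' R" "M \<subseteq> M'" "M' \<subseteq> carrier R"
    then show "M' = M \<or> M' = carrier R" using M(2) max by (meson subset_trans)
  qed (use M in auto)
  then show ?thesis using M by blast
qed

context noetherian_local_ring begin

lemma max_ideal: "ideal \<mm> R"
  using maximal by (rule maximalideal.axioms(1))

lemma max_neq: "\<mm> \<noteq> carrier R"
  using maximalideal.I_notcarr[OF maximal] by blast

lemma one_not_max: "\<one> \<notin> \<mm>"
  using ideal.one_imp_carrier[OF max_ideal] max_neq by blast

lemma ilen_residue: "ilen (carrier R) \<mm> \<le> 1"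
proof (rule ilen_le)
  fix n N assume ch: "ichain (carrier R) \<mm> n N"
  have *: "N i = \<mm> \<or> N i = carrier R" if "i \<le> n" for i
    using ch that maximalideal.I_maximal[OF maximal, of "N i"] unfolding ichain_def by blast
  have "\<not> 2 \<le> n"
  proof
    assume n: "2 \<le> n"
    then have lt: "N 0 \<subset> N 1" "N 1 \<subset> N 2" using ch unfolding ichain_def
      by (simp_all add: numeral_2_eq_2)
    have "N 2 \<subseteq> carrier R" "\<mm> \<subseteq> N 0" using ch n unfolding ichain_def by blast+
    moreover have "N 1 = \<mm> \<or> N 1 = carrier R" using n by (intro *) auto
    ultimately show False using lt by blast
  qed
  then show "enat n \<le> 1" by (simp add: one_enat_def)
qed

lemma unit_of_not_max:
  assumes u: "u \<in> carrier R" "u \<notin> \<mm>"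
  shows "\<exists>v\<in>carrier R. u \<otimes> v = \<one>"
proof -
  let ?A = "ladd u (carrier R) {\<zero>}"
  have iA: "ideal ?A R" using u oneideal zeroideal by (intro ladd_ideal) auto
  have "u \<in> ?A" using ladd_meml[OF u(1) oneideal zeroideal one_closed] u by simp
  then have "?A = carrier R" using proper_ideal_maximal[OF iA] unique_maximal u by blast
  then have "\<one> \<in> ?A" by simp
  then show ?thesis using u by (auto elim!: laddE)
qed

lemma residue_prime:
  assumes "a \<in> carrier R" "b \<in> carrier R" "a \<otimes> b \<in> \<mm>"
  shows "a \<in> \<mm> \<or> b \<in> \<mm>"
  using primeideal.I_prime[OF maximalideal_prime[OF maximal] assms] .

lemma finite_gens:
  assumes "ideal A R"
  obtains S where "finite S" "S \<subseteq> A" "\<And>C. ideal C R \<Longrightarrow> S \<subseteq> C \<Longrightarrow> A \<subseteq> C"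
proof -
  obtain S where S: "S \<subseteq> carrier R" "finite S" "A = Idl S" using finetely_gen[OF assms] by blast
  have "S \<subseteq> A" using genideal_self[OF S(1)] S(3) by simp
  then show ?thesis using that[OF S(2)] genideal_minimal S(3) by metis
qed

text \<open>Each of finitely many generators \<open>a\<close> adds a quotient of R/\<mm>, since
  \<mm> a already lies in the product, and therefore adds length at most one.\<close>

lemma ilen_max_prod:
  assumes A: "ideal A R"
  shows "ilen A (\<mm> \<cdot> A) \<noteq> \<infinity>"
proof -
  obtain S where S: "finite S" "S \<subseteq> A" "\<And>C. ideal C R \<Longrightarrow> S \<subseteq> C \<Longrightarrow> A \<subseteq> C"
    using finite_gens[OF A] by blast
  let ?B = "\<mm> \<cdot> A"
  have iB: "ideal ?B R" using max_ideal A ideal_prod_is_ideal by blast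
  from S(1,2) have "\<exists>C. ideal C R \<and> ?B \<subseteq> C \<and> S \<subseteq> C \<and> ilen C ?B \<noteq> \<infinity>"
  proof (induction S rule: finite_induct)
    case empty
    then show ?case using iB ilen_self[of ?B] by (intro exI[of _ ?B]) simp
  next
    case (insert a S)
    then obtain C where C: "ideal C R" "?B \<subseteq> C" "S \<subseteq> C" "ilen C ?B \<noteq> \<infinity>" by auto
    have a: "a \<in> A" "a \<in> carrier R" using insert A ideal_carr by auto
    let ?C = "ladd a (carrier R) C"
    have iC: "ideal ?C R" using a C oneideal by (intro ladd_ideal) auto
    have CC: "C \<subseteq> ?C" using ladd_memr[OF a(2) oneideal C(1)] by blast
    have "\<mm> \<subseteq> carrier R \<inter> colon C {a}"
      using C(2) a ideal_carr[OF max_ideal] ideal_prod_mem[of _ \<mm> a A] by (auto simp: colon_def)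
    then have "ilen ?C C \<le> ilen (carrier R) \<mm>"
      unfolding ilen_ladd[OF a(2) oneideal C(1)] by (intro ilen_mono) auto
    also have "\<dots> \<le> 1" by (rule ilen_residue)
    finally have "ilen ?C C \<noteq> \<infinity>" by (cases "ilen ?C C") (simp_all add: one_enat_def)
    then have "ilen ?C ?B \<noteq> \<infinity>" using ilen_add[OF iC C(1) iB C(2) CC] C(4) by auto
    moreover have "a \<in> ?C" using ladd_meml[OF a(2) oneideal C(1) one_closed] a by simp
    ultimately show ?case using iC CC C by (intro exI[of _ ?C]) auto
  qed
  then obtain C where C: "ideal C R" "S \<subseteq> C" "ilen C ?B \<noteq> \<infinity>" by blast
  have "ilen A ?B \<le> ilen C ?B" using S(3)[OF C(1,2)] by (intro ilen_mono) auto
  then show ?thesis using C(3) by (cases "ilen C ?B"; cases "ilen A ?B") simp_all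
qed

lemma ilen_max_power: "ilen (carrier R) (ipow \<mm> n) \<noteq> \<infinity>"
proof (induction n)
  case 0
  then show ?case unfolding ipow_0 ilen_self by simp
next
  case (Suc n)
  have i: "ideal (ipow \<mm> n) R" "ideal (ipow \<mm> (Suc n)) R"
    using max_ideal ipow_ideal by blast+
  have "ilen (carrier R) (ipow \<mm> (Suc n)) = ilen (carrier R) (ipow \<mm> n)
      + ilen (ipow \<mm> n) (ipow \<mm> (Suc n))" using i oneideal max_ideal
    by (intro ilen_add ipow_antimono ideal_sub) auto
  also have "\<dots> \<noteq> \<infinity>"
    using Suc ilen_max_prod[OF i(1)] unfolding ipow_Suc[OF max_ideal] by auto
  finally show ?case .
qed

text \<open>Generators of \<open>A\<close> over \<open>B\<close> are discarded one at a time: if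
  \<open>a\<close> is discarded and \<open>C\<close> contains \<open>B\<close> and the others, then
  a (1 - \<mu>) lies in \<open>C\<close> for some \<open>\<mu> \<in> \<mm>\<close>, and 1 - \<mu> is
  a unit.\<close>

lemma nakayama:
  assumes A: "ideal A R" and B: "ideal B R" and le: "A \<subseteq> ladd \<one> (\<mm> \<cdot> A) B"
  shows "A \<subseteq> B"
proof -
  obtain S where S: "finite S" "S \<subseteq> A" "\<And>C. ideal C R \<Longrightarrow> S \<subseteq> C \<Longrightarrow> A \<subseteq> C"
    using finite_gens[OF A] by blast
  from S(1) have "(\<And>C. ideal C R \<Longrightarrow> B \<subseteq> C \<Longrightarrow> S \<subseteq> C \<Longrightarrow> A \<subseteq> C) \<Longrightarrow> S \<subseteq> A \<Longrightarrow> A \<subseteq> B"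
  proof (induction S rule: finite_induct)
    case empty
    then show ?case using B by blast
  next
    case (insert a S)
    have a: "a \<in> A" "a \<in> carrier R" using insert A ideal_carr by auto
    have "A \<subseteq> C" if C: "ideal C R" "B \<subseteq> C" "S \<subseteq> C" for C
    proof -
      let ?C = "ladd a \<mm> C" and ?D = "ladd a (carrier R) C"
      have iC: "ideal ?C R" "ideal ?D R" using a C oneideal max_ideal by (auto intro: ladd_ideal)
      have CC: "C \<subseteq> ?C" "C \<subseteq> ?D" using ladd_memr a C oneideal max_ideal by blast+
      have "a \<in> ?D" using ladd_meml[OF a(2) oneideal C(1) one_closed] a by simp
      then have AD: "A \<subseteq> ?D" using insert.prems(1)[OF iC(2)] CC C by blast
      have "\<mm> \<cdot> A \<subseteq> ?C"
      proof (rule ideal_prod_le[OF iC(1)])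
        fix r v assume r: "r \<in> \<mm>" and "v \<in> A"
        then obtain s c where v: "s \<in> carrier R" "c \<in> C" "v = a \<otimes> s \<oplus> c" using AD by (auto elim!: laddE dest!: subsetD)
        have rc: "r \<in> carrier R" "c \<in> carrier R" using r v max_ideal C ideal_carr by auto
        have "r \<otimes> v = a \<otimes> (r \<otimes> s) \<oplus> r \<otimes> c" using v rc a by (simp add: r_distr m_lcomm)
        then show "r \<otimes> v \<in> ?C" using v r rc C max_ideal by (simp add: laddI ideal_r ideal_l)
      qed
      then have "ladd \<one> (\<mm> \<cdot> A) B \<subseteq> ?C"
        using CC C ideal_carr[OF iC(1)] by (intro ladd_least[OF iC(1)]) auto
      then have "a \<in> ?C" using le a by blast
      then obtain \<mu> c where m: "\<mu> \<in> \<mm>" "c \<in> C" "a = a \<otimes> \<mu> \<oplus> c" by (auto elim: laddE)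
      have mc: "\<mu> \<in> carrier R" "c \<in> carrier R" using m max_ideal C ideal_carr by auto
      have "a \<otimes> (\<one> \<ominus> \<mu>) = a \<ominus> a \<otimes> \<mu>" using a mc by (simp add: a_minus_def r_distr r_minus)
      also have "\<dots> = c" using m a mc by (metis add_minus_cancel(2) m_closed)
      finally have ac: "a \<otimes> (\<one> \<ominus> \<mu>) = c" .
      have "\<one> \<ominus> \<mu> \<notin> \<mm>"
      proof
        assume "\<one> \<ominus> \<mu> \<in> \<mm>"
        then have "\<mu> \<oplus> (\<one> \<ominus> \<mu>) \<in> \<mm>" using m max_ideal ideal_add by blast
        then show False using one_not_max mc by (simp add: add_minus_cancel)
      qed
      then obtain v where v: "v \<in> carrier R" "(\<one> \<ominus> \<mu>) \<otimes> v = \<one>"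
        using unit_of_not_max[of "\<one> \<ominus> \<mu>"] mc by auto
      have "a = a \<otimes> (\<one> \<ominus> \<mu>) \<otimes> v" using v a mc by (simp add: m_assoc)
      then have "a \<in> C" using ac m v C(1) ideal_r by metis
      then show "A \<subseteq> C" using insert.prems(1) C by auto
    qed
    then show ?case using insert by auto
  qed
  then show ?thesis using S by blast
qed

end

context cring begin

section \<open>Reductions with two generators\<close>

primrec horner :: "'a list \<Rightarrow> 'a \<Rightarrow> 'a" where
  "horner [] a = \<zero>"
| "horner (f # fs) a = f \<oplus> a \<otimes> horner fs a"

text \<open>Quotient of the synthetic division by X - w: its coefficients are the values at
  \<open>w\<close> of the proper nonempty tails of the coefficient list.\<close>

primrec horner_quot :: "'a list \<Rightarrow> 'a \<Rightarrow> 'a list" where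
  "horner_quot [] w = []"
| "horner_quot (f # fs) w = (if fs = [] then [] else horner fs w # horner_quot fs w)"

lemma horner_closed: "set fs \<subseteq> carrier R \<Longrightarrow> a \<in> carrier R \<Longrightarrow> horner fs a \<in> carrier R"
  by (induction fs) auto

lemma horner_quot_closed: "set fs \<subseteq> carrier R \<Longrightarrow> a \<in> carrier R \<Longrightarrow> set (horner_quot fs a) \<subseteq> carrier R"
  by (induction fs) (auto simp: horner_closed)

lemma length_horner_quot: "length (horner_quot fs w) = length fs - 1"
  by (induction fs) auto

lemma horner_minus:
  assumes "set fs \<subseteq> carrier R" "a \<in> carrier R" "w \<in> carrier R"
  shows "horner fs a = horner fs w \<oplus> (a \<ominus> w) \<otimes> horner (horner_quot fs w) a"
  using assms(1)
proof (induction fs)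
  case (Cons f fs)
  show ?case
  proof (cases "fs = []")
    case False
    define g h q where "g = horner fs a" and "h = horner fs w" and "q = horner (horner_quot fs w) a"
    have c: "f \<in> carrier R" "h \<in> carrier R" "q \<in> carrier R"
      using Cons assms by (auto simp: h_def q_def horner_closed horner_quot_closed)
    have IH: "g = h \<oplus> (a \<ominus> w) \<otimes> q" using Cons by (simp add: g_def h_def q_def)
    have "f \<oplus> a \<otimes> (h \<oplus> (a \<ominus> w) \<otimes> q) = f \<oplus> w \<otimes> h \<oplus> (a \<ominus> w) \<otimes> (h \<oplus> a \<otimes> q)"
      using c assms by algebra
    then show ?thesis using False IH by (simp add: g_def h_def q_def)
  qed (use Cons assms in simp)
qed (use assms in simp)

lemma horner_nth:
  assumes "set fs \<subseteq> carrier R" "a \<in> carrier R"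
  shows "horner fs a = (\<Oplus>i\<in>{..<length fs}. fs ! i \<otimes> a [^] i)" using assms(1)
proof (induction fs)
  case (Cons f fs)
  have c: "fs ! i \<in> carrier R" if "i < length fs" for i using Cons that by auto
  have "(\<Oplus>i\<in>{..<Suc (length fs)}. (f # fs) ! i \<otimes> a [^] i)
      = (\<Oplus>i\<in>insert 0 (Suc ` {..<length fs}). (f # fs) ! i \<otimes> a [^] i)"
    by (simp add: lessThan_Suc_eq_insert_0)
  also have "\<dots> = f \<oplus> (\<Oplus>i\<in>Suc ` {..<length fs}. (f # fs) ! i \<otimes> a [^] i)"
    using Cons c assms by (subst finsum_insert) auto
  also have "(\<Oplus>i\<in>Suc ` {..<length fs}. (f # fs) ! i \<otimes> a [^] i)
      = (\<Oplus>i\<in>{..<length fs}. (f # fs) ! Suc i \<otimes> a [^] Suc i)"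
    using c assms by (intro finsum_reindex) auto
  also have "\<dots> = (\<Oplus>i\<in>{..<length fs}. a \<otimes> (fs ! i \<otimes> a [^] i))"
    using c assms by (intro finsum_cong') (auto simp: m_ac)
  also have "\<dots> = a \<otimes> horner fs a"
    using c assms Cons by (subst finsum_rdistr[symmetric]) auto
  finally show ?case by simp
qed simp

end

context noetherian_local_ring begin

lemma horner_quot_coeffs:
  assumes "set fs \<subseteq> carrier R" "w \<in> carrier R" "horner fs w \<in> \<mm>" "set (horner_quot fs w) \<subseteq> \<mm>"
  shows "set fs \<subseteq> \<mm>" using assms(1,3,4)
proof (induction fs)
  case (Cons f fs)
  show ?case
  proof (cases "fs = []")
    case True
    then show ?thesis using Cons assms by simp
  next
    case False
    then have h: "horner fs w \<in> \<mm>" "set fs \<subseteq> \<mm>" using Cons by auto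
    have c: "f \<in> carrier R" "horner fs w \<in> carrier R" using Cons assms horner_closed by auto
    have "(f \<oplus> w \<otimes> horner fs w) \<ominus> w \<otimes> horner fs w \<in> \<mm>"
      using ideal_minus[OF max_ideal] ideal_l[OF max_ideal h(1) assms(2)] Cons by auto
    then have "f \<in> \<mm>" using c assms by (simp add: add_minus_cancel)
    then show ?thesis using h by simp
  qed
qed simp

text \<open>A nonzero polynomial over a field has finitely many roots: dividing by X - w at a root
  leaves a shorter list that vanishes on all other residue classes of \<open>W\<close>. Roots are
  counted by residue class, hence the image in the infiniteness assumption.\<close>

lemma horner_roots:
  assumes "set fs \<subseteq> carrier R" "W \<subseteq> carrier R" "infinite ((\<lambda>a. \<mm> +> a) ` W)" "\<And>a. a \<in> W \<Longrightarrow> horner fs a \<in> \<mm>"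
  shows "set fs \<subseteq> \<mm>" using assms
proof (induction "length fs" arbitrary: fs W)
  case (Suc n)
  have "W \<noteq> {}" using Suc.prems by auto
  then obtain w where w: "w \<in> W" by blast
  then have wc: "w \<in> carrier R" using Suc.prems by blast
  let ?W = "{a \<in> W. a \<ominus> w \<notin> \<mm>}"
  have "\<mm> +> a = \<mm> +> w" if "a \<in> W" "a \<ominus> w \<in> \<mm>" for a
    using quotient_eq_iff_same_a_r_cos[OF max_ideal, of a w] that Suc.prems(2) wc by blast
  then have "(\<lambda>a. \<mm> +> a) ` W \<subseteq> insert (\<mm> +> w) ((\<lambda>a. \<mm> +> a) ` ?W)" by blast
  then have inf: "infinite ((\<lambda>a. \<mm> +> a) ` ?W)" using Suc.prems(3) finite_subset by auto
  have "set (horner_quot fs w) \<subseteq> \<mm>"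
  proof (rule Suc.hyps(1)[OF _ _ _ inf])
    show "n = length (horner_quot fs w)" using Suc.hyps by (simp add: length_horner_quot)
    show "set (horner_quot fs w) \<subseteq> carrier R" using horner_quot_closed Suc.prems wc by blast
    show "?W \<subseteq> carrier R" using Suc.prems by blast
    fix a assume a: "a \<in> ?W"
    then have ac: "a \<in> carrier R" using Suc.prems by blast
    have c: "horner fs w \<in> carrier R" "horner (horner_quot fs w) a \<in> carrier R"
      using horner_closed horner_quot_closed Suc.prems ac wc by auto
    have "horner fs a \<ominus> horner fs w \<in> \<mm>"
      using a w Suc.prems(4) ideal_minus[OF max_ideal] by simp
    then have "(a \<ominus> w) \<otimes> horner (horner_quot fs w) a \<in> \<mm>"
      using c ac wc horner_minus[OF Suc.prems(1) ac wc] by (simp add: add_minus_cancel)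
    then show "horner (horner_quot fs w) a \<in> \<mm>" using residue_prime[of "a \<ominus> w"] a ac wc c by auto
  qed
  then show ?case using horner_quot_coeffs Suc.prems w wc by blast
qed simp

text \<open>Distinct exponents prevent the coefficients from mixing, so the sum is a polynomial that
  is nonzero over the residue field. Missing exponents are filled with \<open>\<zero>\<close> to
  obtain a coefficient list.\<close>

lemma nonvanishing:
  assumes inf: "infinite (carrier (R Quot \<mm>))" and T: "finite T" and e: "inj_on e T"
    and c: "\<And>t. t \<in> T \<Longrightarrow> c t \<in> carrier R" and t0: "t0 \<in> T" "c t0 \<notin> \<mm>"
  shows "\<exists>a\<in>carrier R. (\<Oplus>t\<in>T. c t \<otimes> a [^] (e t :: nat)) \<notin> \<mm>"
proof (rule ccontr)
  assume no: "\<not> ?thesis"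
  obtain d where d: "e ` T \<subseteq> {..<d}" using T by (meson finite_imageI finite_nat_iff_bounded)
  define f where "f i = (if i \<in> e ` T then c (inv_into T e i) else \<zero>)" for i
  have fe: "f (e t) = c t" if "t \<in> T" for t using that e by (simp add: f_def)
  have fc: "f i \<in> carrier R" for i using c inv_into_into[of i e T] by (auto simp: f_def)
  let ?fs = "map f [0..<d]"
  have "horner ?fs a = (\<Oplus>t\<in>T. c t \<otimes> a [^] (e t))" if a: "a \<in> carrier R" for a
  proof -
    have "horner ?fs a = (\<Oplus>i\<in>{..<d}. ?fs ! i \<otimes> a [^] i)" using horner_nth[of ?fs a] a fc by auto
    also have "\<dots> = (\<Oplus>i\<in>{..<d}. f i \<otimes> a [^] i)" using a fc by (intro finsum_cong') auto
    also have "\<dots> = (\<Oplus>i\<in>e ` T. f i \<otimes> a [^] i)"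
      using d a fc by (intro add.finprod_mono_neutral_cong_right) (auto simp: f_def)
    also have "\<dots> = (\<Oplus>t\<in>T. f (e t) \<otimes> a [^] (e t))" using e a fc by (intro finsum_reindex) auto
    also have "\<dots> = (\<Oplus>t\<in>T. c t \<otimes> a [^] (e t))" using a fe c by (intro finsum_cong') auto
    finally show ?thesis .
  qed
  then have "horner ?fs a \<in> \<mm>" if "a \<in> carrier R" for a using no that by auto
  moreover have "carrier (R Quot \<mm>) = (\<lambda>a. \<mm> +> a) ` carrier R"
    by (auto simp: FactRing_def A_RCOSETS_def')
  ultimately have "set ?fs \<subseteq> \<mm>" using horner_roots[of ?fs "carrier R"] inf fc by auto
  moreover have "e t0 < d" using t0 d by blast
  ultimately have "f (e t0) \<in> \<mm>" by auto
  then show False using fe t0 by simp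
qed

text \<open>Linear independence over the residue field modulo \<open>B\<close>. Adjoining
  \<open>v t0\<close> to \<open>B\<close> is a strict step because
  \<open>\<one> \<notin> \<mm>\<close>, and the other elements stay independent modulo the larger
  ideal.\<close>

lemma indep_card_le_ilen:
  assumes A: "ideal A R" and T: "finite T" and v: "\<And>t. t \<in> T \<Longrightarrow> v t \<in> A"
    and "ideal B R" "B \<subseteq> A"
    and "\<And>c. c \<in> T \<rightarrow> carrier R \<Longrightarrow> (\<Oplus>t\<in>T. c t \<otimes> v t) \<in> B \<Longrightarrow> \<forall>t\<in>T. c t \<in> \<mm>"
  shows "enat (card T) \<le> ilen A B" using T v assms(4-)
proof (induction T arbitrary: B rule: finite_induct)
  case empty
  then show ?case by (simp add: zero_enat_def[symmetric])
next
  case (insert t0 T)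
  note B = insert.prems(2,3)
  let ?v = "v t0" let ?B = "ladd ?v (carrier R) B"
  have vA: "v t \<in> A" "v t \<in> carrier R" if "t \<in> insert t0 T" for t
    using insert.prems(1) that ideal_carr[OF A] by auto
  have v0: "?v \<in> carrier R" using vA by blast
  have iB: "ideal ?B R" using v0 B oneideal by (intro ladd_ideal)
  have BB: "B \<subseteq> ?B" using ladd_memr[OF v0 oneideal B(1)] by blast
  have BA: "?B \<subseteq> A" using B vA by (intro ladd_least[OF A] ideal_r[OF A]) auto
  have vB: "?v \<in> ?B" using ladd_meml[OF v0 oneideal B(1) one_closed] v0 by simp
  have sum: "(\<Oplus>t\<in>insert t0 T. c t \<otimes> v t) = c t0 \<otimes> ?v \<oplus> (\<Oplus>t\<in>T. c t \<otimes> v t)"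
    if "c \<in> insert t0 T \<rightarrow> carrier R" for c
    using insert.hyps that vA by (intro finsum_insert) auto
  have "?v \<notin> B"
  proof
    assume "?v \<in> B"
    let ?c = "\<lambda>t. if t = t0 then \<one> else \<zero>"
    have "(\<Oplus>t\<in>T. ?c t \<otimes> v t) = (\<Oplus>t\<in>T. \<zero>)"
      using insert.hyps vA by (intro finsum_cong') auto
    then have "(\<Oplus>t\<in>insert t0 T. ?c t \<otimes> v t) = ?v" using sum[of ?c] v0 by (simp add: finsum_zero)
    then have "\<one> \<in> \<mm>" using insert.prems(4)[of ?c] \<open>?v \<in> B\<close> by auto
    then show False using one_not_max by blast
  qed
  then have one: "1 \<le> ilen ?B B" using iB B BB vB by (intro ilen_strict) auto
  have "enat (card T) \<le> ilen A ?B"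
  proof (rule insert.IH[OF _ iB BA])
    fix c assume c: "c \<in> T \<rightarrow> carrier R" and "(\<Oplus>t\<in>T. c t \<otimes> v t) \<in> ?B"
    then obtain r b where r: "r \<in> carrier R" "b \<in> B" "(\<Oplus>t\<in>T. c t \<otimes> v t) = ?v \<otimes> r \<oplus> b" by (auto elim: laddE)
    have bc: "b \<in> carrier R" using r B ideal_carr by blast
    let ?c = "c(t0 := \<ominus> r)"
    have cc: "?c \<in> insert t0 T \<rightarrow> carrier R" using c r by auto
    have "(\<Oplus>t\<in>T. ?c t \<otimes> v t) = (\<Oplus>t\<in>T. c t \<otimes> v t)"
      using insert.hyps c vA by (intro finsum_cong') auto
    then have "(\<Oplus>t\<in>insert t0 T. ?c t \<otimes> v t) = (\<ominus> r) \<otimes> ?v \<oplus> (?v \<otimes> r \<oplus> b)"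
      using sum[OF cc] r by simp
    also have "\<dots> = b" using r v0 bc by algebra
    finally have "(\<Oplus>t\<in>insert t0 T. ?c t \<otimes> v t) \<in> B" using r by simp
    then have "\<forall>t\<in>insert t0 T. ?c t \<in> \<mm>" using insert.prems(4)[OF cc] by blast
    then show "\<forall>t\<in>T. c t \<in> \<mm>" using insert.hyps by (metis fun_upd_other insertCI)
  qed (use vA in auto)
  then have "enat (card T) + 1 \<le> ilen A ?B + ilen ?B B" using one by (intro add_mono)
  also have "\<dots> \<le> ilen A B" using iB BB BA by (rule ilen_super)
  finally show ?case using insert.hyps by (simp add: one_enat_def)
qed

end

section \<open>Congruences modulo J' in the powers of J\<close>

context cring begin

lemma inverse_mult_cancel:
  assumes "p \<in> carrier R" "u \<in> carrier R" "z \<in> carrier R" "p \<otimes> u = \<one>"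
  shows "u \<otimes> (p \<otimes> z) = z"
proof -
  have "u \<otimes> (p \<otimes> z) = (p \<otimes> u) \<otimes> z" using assms(1-3) by (simp add: m_ac)
  then show ?thesis using assms by simp
qed

lemma pow_mem_ipow:
  assumes J: "ideal J R" and x: "x \<in> J"
  shows "x [^] (k::nat) \<in> ipow J k"
proof (induction k)
  case 0
  then show ?case unfolding ipow_0 by simp
next
  case (Suc k)
  have "x \<otimes> x [^] k \<in> J \<cdot> ipow J k" using x Suc by (rule ideal_prod_mem)
  moreover have "x \<otimes> x [^] k = x [^] Suc k" using x J ideal_carr by (simp add: m_comm)
  ultimately show ?case using ipow_Suc[OF J] by metis
qed

lemma mult_mem_ipow:
  assumes J: "ideal J R" and "u \<in> ipow J k" "w \<in> ipow J l"
  shows "u \<otimes> w \<in> ipow J (k + l)" unfolding ipow_add[OF J] by (rule ideal_prod_mem) fact+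

text \<open>\<open>J' J\<^sup>k\<^sup>-\<^sup>1\<close>, which has to be \<open>0\<close> for \<open>k = 0\<close> in order to be compatible with
  products.\<close>

definition red_filt :: "'a set \<Rightarrow> 'a set \<Rightarrow> nat \<Rightarrow> 'a set" where
  "red_filt J' J k = (if k = 0 then {\<zero>} else J' \<cdot> ipow J (k - 1))"

context
  fixes J J' :: "'a set"
  assumes J: "ideal J R" and J': "ideal J' R" and JJ: "J' \<subseteq> J"
begin

lemma red_filt_ideal: "ideal (red_filt J' J k) R"
  using J J' zeroideal ideal_prod_is_ideal ipow_ideal by (simp add: red_filt_def)

lemma red_filt_mult:
  assumes f: "f \<in> red_filt J' J k" and u: "u \<in> ipow J l"
  shows "f \<otimes> u \<in> red_filt J' J (k + l)"
proof (cases k)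
  case 0
  then have "f \<otimes> u = \<zero>" using f u ideal_carr[OF ipow_ideal[OF J]] by (simp add: red_filt_def)
  then show ?thesis using ideal_zero[OF red_filt_ideal] by simp
next
  case (Suc k')
  have "f \<otimes> u \<in> (J' \<cdot> ipow J k') \<cdot> ipow J l"
    using f u Suc by (intro ideal_prod_mem) (auto simp: red_filt_def)
  also have "\<dots> = J' \<cdot> ipow J (k' + l)"
    unfolding ipow_add[OF J] by (intro ideal_prod_assoc J' ipow_ideal J)
  finally show ?thesis using Suc by (simp add: red_filt_def)
qed

text \<open>The ideals \<open>red_filt J' J k\<close> are the components of the ideal of the Rees
  algebra of \<open>J\<close> generated by \<open>J'\<close> in degree 1, so congruence modulo them
  respects products.\<close>

lemma red_filt_cong_mult:
  assumes u: "u \<in> ipow J k" "u' \<in> ipow J k" "u \<ominus> u' \<in> red_filt J' J k"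
    and w: "w \<in> ipow J l" "w' \<in> ipow J l" "w \<ominus> w' \<in> red_filt J' J l"
  shows "u \<otimes> w \<ominus> u' \<otimes> w' \<in> red_filt J' J (k + l)"
proof -
  have c: "u \<in> carrier R" "u' \<in> carrier R" "w \<in> carrier R" "w' \<in> carrier R"
    using u w ideal_carr[OF ipow_ideal[OF J]] by blast+
  have "u \<otimes> w \<ominus> u' \<otimes> w' = (u \<ominus> u') \<otimes> w \<oplus> (w \<ominus> w') \<otimes> u'"
    using c by algebra
  moreover have "(u \<ominus> u') \<otimes> w \<in> red_filt J' J (k + l)" using u w red_filt_mult by blast
  moreover have "(w \<ominus> w') \<otimes> u' \<in> red_filt J' J (k + l)"
    using u w red_filt_mult[of _ l u' k] by (simp add: add.commute)
  ultimately show ?thesis using ideal_add[OF red_filt_ideal] by metis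
qed

lemma red_filt_cong_pow:
  assumes x: "x \<in> J" "x' \<in> J" "x \<ominus> x' \<in> J'"
  shows "x [^] (k::nat) \<ominus> x' [^] k \<in> red_filt J' J k"
proof (induction k)
  case 0
  then show ?case by (simp add: red_filt_def a_minus_def r_neg)
next
  case (Suc k)
  have "x \<in> ipow J 1" "x' \<in> ipow J 1" using x ipow_1[OF J] by simp_all
  moreover have "x \<ominus> x' \<in> red_filt J' J 1"
    unfolding red_filt_def using x J' ipow_0[of J] ideal_prod_one[OF J'] by (simp del: monoid.nat_pow_0)
  ultimately have "x [^] k \<otimes> x \<ominus> x' [^] k \<otimes> x' \<in> red_filt J' J (k + 1)"
    using Suc pow_mem_ipow[OF J] x by (intro red_filt_cong_mult) auto
  then show ?case by simp
qed

text \<open>Modulo \<open>J'\<close> in degree 1 the Rees algebra of \<open>J\<close> is generated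
  by \<open>z\<close>, so in degree \<open>k\<close> only the power of \<open>z\<close>
  survives.\<close>

lemma power_le_red_filt:
  assumes z: "z \<in> carrier R" and le: "J \<subseteq> ladd z (carrier R) J'"
  shows "ipow J k \<subseteq> ladd (z [^] k) (carrier R) (red_filt J' J k)"
proof (induction k)
  case 0
  show ?case unfolding ipow_0
  proof
    fix r assume "r \<in> carrier R"
    then have "r = z [^] (0::nat) \<otimes> r \<oplus> \<zero>" by simp
    then show "r \<in> ladd (z [^] (0::nat)) (carrier R) (red_filt J' J 0)"
      using laddI[of r "carrier R" \<zero> "red_filt J' J 0" "z [^] (0::nat)"] \<open>r \<in> carrier R\<close>
      by (simp add: red_filt_def)
  qed
next
  case (Suc k)
  let ?Q = "ladd (z [^] Suc k) (carrier R) (red_filt J' J (Suc k))"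
  have iQ: "ideal ?Q R" using z red_filt_ideal oneideal by (intro ladd_ideal) auto
  show ?case unfolding ipow_Suc[OF J]
  proof (rule ideal_prod_le[OF iQ])
    fix a b assume a: "a \<in> J" and b: "b \<in> ipow J k"
    obtain r j where r: "r \<in> carrier R" "j \<in> J'" "a = z \<otimes> r \<oplus> j"
      using subsetD[OF le a] by (auto elim: laddE)
    obtain s q where s: "s \<in> carrier R" "q \<in> red_filt J' J k" "b = z [^] k \<otimes> s \<oplus> q"
      using subsetD[OF Suc b] by (auto elim: laddE)
    have c: "j \<in> carrier R" "q \<in> carrier R" "b \<in> carrier R"
      using r s b ideal_carr[OF J'] ideal_carr[OF red_filt_ideal] ideal_carr[OF ipow_ideal[OF J]] by blast+
    have zz: "z [^] k \<in> carrier R" using z by simp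
    have "a \<otimes> b = z [^] Suc k \<otimes> (r \<otimes> s) \<oplus> (q \<otimes> (z \<otimes> r) \<oplus> j \<otimes> b)"
    proof -
      have "a \<otimes> b = z \<otimes> r \<otimes> b \<oplus> j \<otimes> b" using r c z by (simp add: l_distr)
      also have "z \<otimes> r \<otimes> b = z [^] Suc k \<otimes> (r \<otimes> s) \<oplus> q \<otimes> (z \<otimes> r)"
        using r s c z zz by (simp add: r_distr m_ac)
      finally show ?thesis using r s c z by (simp add: a_assoc)
    qed
    moreover have "q \<otimes> (z \<otimes> r) \<in> red_filt J' J (Suc k)"
    proof -
      have "z \<otimes> r = a \<ominus> j" using r c z by (simp add: add_minus_cancel)
      moreover have "a \<ominus> j \<in> J" using ideal_minus[OF J a] JJ r(2) by blast
      ultimately have "z \<otimes> r \<in> J" by metis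
      then have "z \<otimes> r \<in> ipow J 1" using ipow_1[OF J] by simp
      then show ?thesis using red_filt_mult[OF s(2)] by fastforce
    qed
    moreover have "j \<otimes> b \<in> red_filt J' J (Suc k)"
      using r b by (auto simp: red_filt_def intro: ideal_prod_mem)
    ultimately show "a \<otimes> b \<in> ?Q"
      using r s ideal_add[OF red_filt_ideal] by (auto intro!: laddI)
  qed
qed

end

end

section \<open>Dropping one of three generators\<close>

context noetherian_local_ring begin

text \<open>More monomials in \<open>x\<close>, \<open>y\<close>, \<open>z\<close> are available in
  degree \<open>N\<close> than J^N has generators, so a form with a unit coefficient lies in \<mm>
  J^N. With x = x' + a z and y = y' + b z the coefficient of z^N becomes a unit. Thus z^N, and with
  it J^N, lies in J' J^(N-1) + \<mm> J^N, and Nakayama's lemma removes the second summand.\<close>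

lemma smaller_reduction:
  assumes inf: "infinite (carrier (R Quot \<mm>))"
    and G: "finite G" "G \<subseteq> carrier R" "card G \<ge> 3" and J: "J = Idl G"
    and N: "N \<ge> 1" "ilen (ipow J N) (\<mm> \<cdot> ipow J N) < enat ((N div 2 + 1)^2)"
  shows "\<exists>G'. finite G' \<and> G' \<subseteq> carrier R \<and> card G' < card G \<and> reduction R (Idl G') J"
proof -
  let ?R = "carrier R" and ?p = "ipow J"
  have iJ: "ideal J R" and GJ: "G \<subseteq> J" using J G genideal_ideal genideal_self by auto
  have Jc: "J \<subseteq> ?R" using iJ ideal_sub by blast
  obtain G3 where "G3 \<subseteq> G" "card G3 = 3" using G(3) obtain_subset_with_card_n by metis
  then obtain x y z where xyz: "{x, y, z} \<subseteq> G" "x \<noteq> y" "y \<noteq> z" "x \<noteq> z"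
    unfolding card_3_iff by blast
  have xJ: "x \<in> J" "y \<in> J" "z \<in> J" using xyz GJ by auto
  then have xc: "x \<in> ?R" "y \<in> ?R" "z \<in> ?R" using Jc by auto
  \<comment> \<open>With two exponents at most \<open>N div 2\<close> the exponent of
    \<open>z\<close> never needs truncation, and the box of exponents has square
    cardinality.\<close>
  define h where "h = N div 2"
  define T where "T = {..h} \<times> {..h}"
  define rr where "rr = (\<lambda>t::nat\<times>nat. N - fst t - snd t)"
  define v where "v = (\<lambda>t::nat\<times>nat. x [^] fst t \<otimes> y [^] snd t \<otimes> z [^] rr t)"
  \<comment> \<open>Kronecker substitution: \<open>b = a\<^sup>h\<^sup>+\<^sup>1\<close> reduces the search for \<open>(a, b)\<close> to one variable.\<close>
  define e where "e = (\<lambda>t::nat\<times>nat. fst t + Suc h * snd t)"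
  have T: "finite T" "card T = (h + 1)^2" by (simp_all add: T_def power2_eq_square)
  have deg: "fst t + snd t + rr t = N" if "t \<in> T" for t using that by (auto simp: T_def rr_def h_def)
  have e: "inj_on e T"
  proof (rule inj_onI)
    fix s t assume "s \<in> T" "t \<in> T" and eq: "e s = e t"
    then have lt: "fst s < Suc h" "fst t < Suc h" by (auto simp: T_def)
    from eq have "e s mod Suc h = e t mod Suc h" "e s div Suc h = e t div Suc h" by simp_all
    then have "fst s = fst t" "snd s = snd t" using lt by (simp_all add: e_def del: mult_Suc)
    then show "s = t" by (rule prod_eqI)
  qed
  have monoc: "a [^] fst t \<otimes> b [^] snd t \<otimes> z [^] rr t \<in> ?p N"
    if "a \<in> J" "b \<in> J" "t \<in> T" for a b t
    using mult_mem_ipow[OF iJ mult_mem_ipow[OF iJ pow_mem_ipow pow_mem_ipow] pow_mem_ipow, OF iJ that(1) iJ that(2) iJ xJ(3), of "fst t" "snd t" "rr t"] deg[OF that(3)]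
    by simp
  have ipN: "ideal (?p N) R" "ideal (\<mm> \<cdot> ?p N) R" "\<mm> \<cdot> ?p N \<subseteq> ?p N"
    using iJ max_ideal ipow_ideal ideal_prod_is_ideal ideal_prod_sub by blast+
  have "\<not> enat (card T) \<le> ilen (?p N) (\<mm> \<cdot> ?p N)" using N T by (simp add: h_def not_le)
  then obtain c where c: "c \<in> T \<rightarrow> ?R" "(\<Oplus>t\<in>T. c t \<otimes> v t) \<in> \<mm> \<cdot> ?p N" "\<not> (\<forall>t\<in>T. c t \<in> \<mm>)"
    using indep_card_le_ilen[OF ipN(1) T(1) _ ipN(2,3), of v] monoc[OF xJ(1,2)] unfolding v_def by blast
  then obtain t0 where t0: "t0 \<in> T" "c t0 \<notin> \<mm>" by blast
  obtain a where a: "a \<in> ?R" "(\<Oplus>t\<in>T. c t \<otimes> a [^] (e t)) \<notin> \<mm>"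
    using nonvanishing[OF inf T(1) e, of c t0] c t0 by blast
  define b where "b = a [^] Suc h"
  have bc: "b \<in> ?R" using a by (simp add: b_def)
  define x' y' where "x' = x \<ominus> a \<otimes> z" and "y' = y \<ominus> b \<otimes> z"
  have xc': "x' \<in> ?R" "y' \<in> ?R" "x' \<in> J" "y' \<in> J"
    using xc a bc xJ ideal_minus[OF iJ] ideal_l[OF iJ] by (auto simp: x'_def y'_def)
  \<comment> \<open>Three generators are exchanged for two: \<open>z\<close> is given up, and z^N is
    later recovered from \<mm> J^N.\<close>
  let ?G = "(G - {x, y, z}) \<union> {x', y'}" let ?J = "Idl ?G"
  have Gc: "?G \<subseteq> ?R" "finite ?G" using G xc' by auto
  have cG: "card ?G < card G"
  proof -
    have "card ?G \<le> card (G - {x, y, z}) + card {x', y'}" by (rule card_Un_le)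
    also have "card (G - {x, y, z}) = card G - 3" using xyz G(1) by (simp add: card_Diff_subset)
    also have "card {x', y'} \<le> 2" by (simp add: card_insert_if)
    finally show ?thesis using G(3) by linarith
  qed
  have iJ': "ideal ?J R" "?G \<subseteq> ?J" using genideal_ideal[OF Gc(1)] genideal_self[OF Gc(1)] by auto
  have JJ: "?J \<subseteq> J" using GJ xc' by (intro genideal_minimal iJ) auto
  let ?L = "ladd z ?R ?J"
  have iL: "ideal ?L R" using xc iJ' oneideal by (intro ladd_ideal)
  have zL: "z \<in> ?L" using ladd_meml[OF xc(3) oneideal iJ'(1) one_closed] xc by simp
  have JL': "?J \<subseteq> ?L" using ladd_memr[OF xc(3) oneideal iJ'(1)] by blast
  have "x \<in> ?L"
  proof -
    have "x = z \<otimes> a \<oplus> x'" unfolding x'_def using xc a by algebra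
    then show ?thesis using a iJ' by (auto intro: laddI)
  qed
  moreover have "y \<in> ?L"
  proof -
    have "y = z \<otimes> b \<oplus> y'" unfolding y'_def using xc bc by algebra
    then show ?thesis using bc iJ' by (auto intro: laddI)
  qed
  ultimately have "G \<subseteq> ?L" using zL iJ'(2) JL' by blast
  then have JL: "J \<subseteq> ?L" unfolding J by (intro genideal_minimal iL)
  let ?Q = "red_filt ?J J N"
  note iQ = red_filt_ideal[OF iJ iJ'(1) JJ, of N]
  let ?S = "ladd \<one> (\<mm> \<cdot> ?p N) ?Q"
  have iS: "ideal ?S R" using ipN iQ by (intro ladd_ideal) auto
  have QS: "?Q \<subseteq> ?S" using ladd_memr[OF one_closed ipN(2) iQ] by blast
  have mS: "\<mm> \<cdot> ?p N \<subseteq> ?S" using ladd_meml[OF one_closed ipN(2) iQ] ideal_carr[OF ipN(2)] by fastforce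
  \<comment> \<open>The monomial with \<open>x\<close>, \<open>y\<close> replaced by a z, b z. The
    replacement is legitimate modulo J' J^(N-1), and it makes every monomial a multiple of
    z^N.\<close>
  define w where "w = (\<lambda>t. (a \<otimes> z) [^] fst t \<otimes> (b \<otimes> z) [^] snd t \<otimes> z [^] rr t)"
  have azJ: "a \<otimes> z \<in> J" "b \<otimes> z \<in> J" using xJ a bc iJ ideal_l by auto
  have vc: "v t \<in> ?R" "w t \<in> ?R" if "t \<in> T" for t
    using monoc[OF xJ(1,2) that] monoc[OF azJ that] ideal_carr[OF ipN(1)] by (auto simp: v_def w_def)
  have vw: "v t \<ominus> w t \<in> ?Q" if t: "t \<in> T" for t
  proof -
    note M = pow_mem_ipow[OF iJ]
    have 1: "x [^] fst t \<ominus> (a \<otimes> z) [^] fst t \<in> red_filt ?J J (fst t)"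
      using xJ azJ iJ'(2) by (intro red_filt_cong_pow[OF iJ iJ'(1) JJ]) (auto simp: x'_def)
    have 2: "y [^] snd t \<ominus> (b \<otimes> z) [^] snd t \<in> red_filt ?J J (snd t)"
      using xJ azJ iJ'(2) by (intro red_filt_cong_pow[OF iJ iJ'(1) JJ]) (auto simp: y'_def)
    have 3: "z [^] rr t \<ominus> z [^] rr t \<in> red_filt ?J J (rr t)"
      using xc ideal_zero[OF red_filt_ideal[OF iJ iJ'(1) JJ]] by (simp add: a_minus_def r_neg)
    have "v t \<ominus> w t \<in> red_filt ?J J (fst t + snd t + rr t)" unfolding v_def w_def
      by (intro red_filt_cong_mult[OF iJ iJ'(1) JJ] mult_mem_ipow[OF iJ] M xJ azJ 1 2 3)
    then show ?thesis using deg[OF t] by simp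
  qed
  have wz: "w t = a [^] e t \<otimes> z [^] N" if t: "t \<in> T" for t
  proof -
    have "a [^] e t = a [^] fst t \<otimes> b [^] snd t"
      unfolding e_def b_def nat_pow_pow[OF a(1)] nat_pow_mult[OF a(1)] ..
    moreover have "z [^] N = z [^] fst t \<otimes> z [^] snd t \<otimes> z [^] rr t"
      using xc deg[OF t] by (simp add: nat_pow_mult)
    ultimately show ?thesis using a bc xc by (simp add: w_def nat_pow_distrib m_ac)
  qed
  let ?P = "\<Oplus>t\<in>T. c t \<otimes> a [^] (e t)"
  have Pc: "?P \<in> ?R" using c a by (intro finsum_closed) auto
  have "?P \<otimes> z [^] N = (\<Oplus>t\<in>T. c t \<otimes> w t)"
  proof -
    have "?P \<otimes> z [^] N = (\<Oplus>t\<in>T. c t \<otimes> a [^] (e t) \<otimes> z [^] N)"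
      using c a xc T by (intro finsum_ldistr) auto
    also have "\<dots> = (\<Oplus>t\<in>T. c t \<otimes> w t)"
      using c a xc wz by (intro finsum_cong') (auto simp: m_assoc Pi_iff)
    finally show ?thesis .
  qed
  also have "\<dots> \<in> ?S"
  proof -
    have "(\<Oplus>t\<in>T. c t \<otimes> v t) = (\<Oplus>t\<in>T. c t \<otimes> w t \<oplus> c t \<otimes> (v t \<ominus> w t))"
    proof (rule finsum_cong')
      fix t assume t: "t \<in> T"
      then have "c t \<in> ?R" using c by blast
      then show "c t \<otimes> v t = c t \<otimes> w t \<oplus> c t \<otimes> (v t \<ominus> w t)"
        using vc[OF t] by algebra
    qed (use c vc in \<open>auto simp: Pi_iff\<close>)
    also have "\<dots> = (\<Oplus>t\<in>T. c t \<otimes> w t) \<oplus> (\<Oplus>t\<in>T. c t \<otimes> (v t \<ominus> w t))"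
      using c vc by (intro finsum_addf) (auto simp: Pi_iff)
    finally have eq: "(\<Oplus>t\<in>T. c t \<otimes> v t) = (\<Oplus>t\<in>T. c t \<otimes> w t) \<oplus> (\<Oplus>t\<in>T. c t \<otimes> (v t \<ominus> w t))" .
    have dQ: "(\<Oplus>t\<in>T. c t \<otimes> (v t \<ominus> w t)) \<in> ?Q"
      using c vw T by (intro finsum_mem_ideal[OF iQ] ideal_l[OF iQ]) auto
    have wcar: "(\<Oplus>t\<in>T. c t \<otimes> w t) \<in> ?R" using c vc by (intro finsum_closed) (auto simp: Pi_iff)
    have "(\<Oplus>t\<in>T. c t \<otimes> v t) \<ominus> (\<Oplus>t\<in>T. c t \<otimes> (v t \<ominus> w t)) \<in> ?S"
      using c(2) dQ mS QS by (intro ideal_minus[OF iS]) auto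
    then show ?thesis unfolding eq using wcar ideal_carr[OF iQ dQ] by (simp add: add_minus_cancel)
  qed
  finally have PzS: "?P \<otimes> z [^] N \<in> ?S" .
  obtain u where u: "u \<in> ?R" "?P \<otimes> u = \<one>" using unit_of_not_max[OF Pc a(2)] by blast
  have uz: "u \<otimes> (?P \<otimes> z [^] N) = z [^] N"
    using u Pc xc by (intro inverse_mult_cancel) auto
  have zS: "z [^] N \<in> ?S" using ideal_l[OF iS PzS u(1)] unfolding uz .
  have "?p N \<subseteq> ladd (z [^] N) ?R ?Q" by (rule power_le_red_filt[OF iJ iJ'(1) JJ xc(3) JL])
  also have "\<dots> \<subseteq> ?S" by (rule ladd_least[OF iS QS]) (rule ideal_r[OF iS zS])
  finally have "?p N \<subseteq> ?Q" by (rule nakayama[OF ipN(1) iQ])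
  moreover have "?Q \<subseteq> ?p N"
  proof -
    have "?Q = ?J \<cdot> ?p (N - 1)" using N by (simp add: red_filt_def)
    also have "\<dots> \<subseteq> J \<cdot> ?p (N - 1)" using JJ by (intro ideal_prod_mono) auto
    also have "\<dots> = ?p N" using ipow_Suc[OF iJ, of "N - 1"] N by simp
    finally show ?thesis .
  qed
  ultimately have "?J \<cdot> ?p (N - 1) = ?p (N - 1 + 1)" using N by (simp add: red_filt_def)
  then have "reduction R ?J J" unfolding reduction_def using iJ' JJ by blast
  then show ?thesis using Gc cG by (intro exI[of _ ?G] conjI)
qed

end

context cring begin

section \<open>Regular sequences\<close>

lemma nonzerodivisor_cancel:
  assumes a: "a \<in> carrier R" and nz: "\<And>u. u \<in> carrier R \<Longrightarrow> a \<otimes> u = \<zero> \<Longrightarrow> u = \<zero>"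
    and c: "c \<in> carrier R" "d \<in> carrier R" "a \<otimes> c = a \<otimes> d"
  shows "c = d"
proof -
  have "a \<otimes> (c \<ominus> d) = a \<otimes> c \<ominus> a \<otimes> d" using a c by algebra
  then have "a \<otimes> (c \<ominus> d) = \<zero>" using a c by (simp add: a_minus_def r_neg)
  then show ?thesis using nz[of "c \<ominus> d"] c by (simp add: r_right_minus_eq)
qed

text \<open>Write \<alpha> = x p + y q and put w = p v + q u. A relation x u = y v gives \<alpha> u
  = y w and \<alpha> v = x w, so \<beta> w is a multiple of \<alpha> and w = \<alpha> t. Cancelling
  \<alpha> leaves u = y t and v = x t. Any regular pair inside (x, y) can be used for this.\<close>

lemma syz2_of_regular:
  assumes xy: "x \<in> carrier R" "y \<in> carrier R"
    and \<alpha>: "\<alpha> \<in> dbl x y (carrier R)" and \<beta>: "\<beta> \<in> dbl x y (carrier R)"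
    and nz: "\<And>u. u \<in> carrier R \<Longrightarrow> \<alpha> \<otimes> u = \<zero> \<Longrightarrow> u = \<zero>"
    and nzm: "\<And>u r. u \<in> carrier R \<Longrightarrow> r \<in> carrier R \<Longrightarrow> \<beta> \<otimes> u = \<alpha> \<otimes> r \<Longrightarrow> \<exists>t\<in>carrier R. u = \<alpha> \<otimes> t"
  shows "syz2 x y" unfolding syz2_def
proof (intro conjI ballI impI xy)
  fix u v assume uv: "u \<in> carrier R" "v \<in> carrier R" and eq: "x \<otimes> u = y \<otimes> v"
  obtain p q where p: "p \<in> carrier R" "q \<in> carrier R" "\<alpha> = x \<otimes> p \<oplus> y \<otimes> q" using \<alpha> by (auto simp: dbl_def)
  obtain r s where r: "r \<in> carrier R" "s \<in> carrier R" "\<beta> = x \<otimes> r \<oplus> y \<otimes> s" using \<beta> by (auto simp: dbl_def)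
  have ac: "\<alpha> \<in> carrier R" using p xy by simp
  define w where "w = p \<otimes> v \<oplus> q \<otimes> u"
  have wc: "w \<in> carrier R" using p uv by (simp add: w_def)
  have cancel: "a = b" if "a \<in> carrier R" "b \<in> carrier R" "\<alpha> \<otimes> a = \<alpha> \<otimes> b" for a b
    by (rule nonzerodivisor_cancel[OF ac _ that]) (rule nz)
  have au: "\<alpha> \<otimes> u = y \<otimes> w"
  proof -
    have "\<alpha> \<otimes> u = p \<otimes> (x \<otimes> u) \<oplus> q \<otimes> (y \<otimes> u)" using p uv xy by (simp add: l_distr r_distr m_ac)
    also have "\<dots> = y \<otimes> w" unfolding eq w_def using p uv xy by (simp add: r_distr m_ac)
    finally show ?thesis .
  qed
  have av: "\<alpha> \<otimes> v = x \<otimes> w"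
  proof -
    have "\<alpha> \<otimes> v = p \<otimes> (x \<otimes> v) \<oplus> q \<otimes> (y \<otimes> v)" using p uv xy by (simp add: l_distr r_distr m_ac)
    also have "\<dots> = x \<otimes> w" unfolding eq[symmetric] w_def using p uv xy by (simp add: r_distr m_ac)
    finally show ?thesis .
  qed
  have "\<beta> \<otimes> w = r \<otimes> (x \<otimes> w) \<oplus> s \<otimes> (y \<otimes> w)" using r wc xy by (simp add: l_distr r_distr m_ac)
  also have "\<dots> = \<alpha> \<otimes> (r \<otimes> v \<oplus> s \<otimes> u)"
    unfolding au[symmetric] av[symmetric] using r ac uv by (simp add: r_distr l_distr m_ac)
  finally obtain t where t: "t \<in> carrier R" "w = \<alpha> \<otimes> t"
    using nzm[OF wc, of "r \<otimes> v \<oplus> s \<otimes> u"] r uv by auto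
  have "u = y \<otimes> t" by (rule cancel) (use t uv xy au ac in \<open>simp_all add: m_ac\<close>)
  moreover have "v = x \<otimes> t" by (rule cancel) (use t uv xy av ac in \<open>simp_all add: m_ac\<close>)
  ultimately show "\<exists>t\<in>carrier R. u = y \<otimes> t \<and> v = x \<otimes> t" using t by blast
qed

text \<open>The ideal (x, y) is only known to contain powers of a regular pair taken from \<mm>. The
  exponent of \<open>a\<close> is raised first, stripping one factor \<open>a\<close> at a time, and
  then the exponent of \<open>b\<close>.\<close>

lemma regular_powers:
  assumes a: "a \<in> carrier R" and b: "b \<in> carrier R"
    and nz: "\<And>u. u \<in> carrier R \<Longrightarrow> a \<otimes> u = \<zero> \<Longrightarrow> u = \<zero>"
    and nzm: "\<And>u r. u \<in> carrier R \<Longrightarrow> r \<in> carrier R \<Longrightarrow> b \<otimes> u = a \<otimes> r \<Longrightarrow> \<exists>t\<in>carrier R. u = a \<otimes> t"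
  shows "u \<in> carrier R \<Longrightarrow> a [^] (n::nat) \<otimes> u = \<zero> \<Longrightarrow> u = \<zero>"
    and "u \<in> carrier R \<Longrightarrow> r \<in> carrier R \<Longrightarrow> b [^] (k::nat) \<otimes> u = a [^] (n::nat) \<otimes> r \<Longrightarrow> \<exists>t\<in>carrier R. u = a [^] n \<otimes> t"
proof -
  have cancel: "c = d" if "c \<in> carrier R" "d \<in> carrier R" "a \<otimes> c = a \<otimes> d" for c d
    by (rule nonzerodivisor_cancel[OF a _ that]) (rule nz)
  show "u \<in> carrier R \<Longrightarrow> a [^] n \<otimes> u = \<zero> \<Longrightarrow> u = \<zero>"
  proof (induction n)
    case (Suc n)
    have "a \<otimes> (a [^] n \<otimes> u) = \<zero>" using Suc.prems a by (simp add: m_ac)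
    then have "a [^] n \<otimes> u = \<zero>" using nz[of "a [^] n \<otimes> u"] Suc.prems a by blast
    then show ?case using Suc by blast
  qed (use a in simp)
  have *: "\<exists>t\<in>carrier R. u = a [^] n \<otimes> t"
    if "u \<in> carrier R" "r \<in> carrier R" "b \<otimes> u = a [^] n \<otimes> r" for u r and n :: nat
    using that
  proof (induction n arbitrary: u r)
    case 0
    then show ?case using a by auto
  next
    case (Suc n)
    have "b \<otimes> u = a \<otimes> (a [^] n \<otimes> r)" using Suc.prems a by (simp add: m_ac)
    then obtain t where t: "t \<in> carrier R" "u = a \<otimes> t" using nzm[of u "a [^] n \<otimes> r"] Suc.prems a by auto
    have eq: "a \<otimes> (b \<otimes> t) = a \<otimes> (a [^] n \<otimes> r)" using Suc.prems a b t by (simp add: m_ac)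
    have "b \<otimes> t = a [^] n \<otimes> r"
      by (rule cancel[OF _ _ eq]) (use Suc.prems(2) a b t(1) in auto)
    from Suc.IH[OF t(1) Suc.prems(2) this] obtain s where s: "s \<in> carrier R" "t = a [^] n \<otimes> s"
      by (elim bexE)
    then have "u = a [^] Suc n \<otimes> s" using t a by (simp add: m_ac)
    then show ?case using s by blast
  qed
  show "u \<in> carrier R \<Longrightarrow> r \<in> carrier R \<Longrightarrow> b [^] k \<otimes> u = a [^] n \<otimes> r \<Longrightarrow> \<exists>t\<in>carrier R. u = a [^] n \<otimes> t"
  proof (induction k arbitrary: u r)
    case 0
    then show ?case using a by auto
  next
    case (Suc k)
    have "b [^] k \<otimes> (b \<otimes> u) = a [^] n \<otimes> r" using Suc.prems b by (simp add: m_ac)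
    from Suc.IH[OF _ Suc.prems(2) this] obtain t where t: "t \<in> carrier R" "b \<otimes> u = a [^] n \<otimes> t"
      using Suc.prems(1) b by auto
    from *[OF Suc.prems(1) t] show ?case .
  qed
qed

lemma nonzerodivisor_Quot:
  assumes Q: "ideal Q R" and x: "x \<in> carrier R" and nz: "nonzerodivisor (R Quot Q) (Q +> x)"
    and y: "y \<in> carrier R" "x \<otimes> y \<in> Q"
  shows "y \<in> Q"
proof -
  have "Q +> y \<in> carrier (R Quot Q)" using y by (auto simp: FactRing_def A_RCOSETS_def')
  moreover have "(Q +> x) \<otimes>\<^bsub>R Quot Q\<^esub> (Q +> y) = \<zero>\<^bsub>R Quot Q\<^esub>"
    using ideal.rcoset_mult_add[OF Q x y(1)] a_rcos_zero[OF Q y(2)] by (simp add: FactRing_def)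
  ultimately have "Q +> y = Q" using nz by (simp add: nonzerodivisor_def FactRing_def)
  then show ?thesis using ideal.rcos_const_imp_mem[OF Q y(1)] by blast
qed

end

context cohen_macaulay_local_ring begin

text \<open>\<open>depth\<close> is a supremum, so depth two yields a regular sequence of length at
  least two. Its first two elements are kept, and their regularity is translated from quotient rings
  to equations in \<open>R\<close>.\<close>

lemma regular_pair:
  assumes dim: "krull_dim R = 2"
  obtains a b where "a \<in> \<mm>" "b \<in> \<mm>"
    "\<And>u. u \<in> carrier R \<Longrightarrow> a \<otimes> u = \<zero> \<Longrightarrow> u = \<zero>"
    "\<And>u r. u \<in> carrier R \<Longrightarrow> r \<in> carrier R \<Longrightarrow> b \<otimes> u = a \<otimes> r \<Longrightarrow> \<exists>t\<in>carrier R. u = a \<otimes> t"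
proof -
  have "\<exists>xs. set xs \<subseteq> \<mm> \<and> regular_sequence R xs \<and> length xs \<ge> 2"
  proof (rule ccontr)
    assume no: "\<not> ?thesis"
    have "depth R \<mm> \<le> 1" unfolding depth_def
    proof (rule Sup_least, safe)
      fix xs assume "set xs \<subseteq> \<mm>" "regular_sequence R xs"
      then have "length xs \<le> 1" using no by force
      then show "enat (length xs) \<le> 1" by (simp add: one_enat_def)
    qed
    moreover have "depth R \<mm> = 2" using depth_eq_dim dim by simp
    ultimately show False by (simp add: one_enat_def numeral_eq_enat)
  qed
  then obtain xs where xs: "set xs \<subseteq> \<mm>" "regular_sequence R xs" "length xs \<ge> 2" by blast
  define a b where "a = xs ! 0" and "b = xs ! 1"
  have ab: "a \<in> \<mm>" "b \<in> \<mm>" 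
    unfolding a_def b_def using xs(3) by (auto intro!: subsetD[OF xs(1)] nth_mem intro: less_le_trans)
  then have c: "a \<in> carrier R" "b \<in> carrier R" using max_ideal ideal_carr by blast+
  have reg: "nonzerodivisor (R Quot (Idl (set (take i xs)))) (Idl (set (take i xs)) +> (xs ! i))"
    if "i < 2" for i using xs that by (auto simp: regular_sequence_def Let_def)
  have t1: "set (take 1 xs) = {a}" using xs(3) by (cases xs) (auto simp: a_def)
  have I0: "Idl {} = {\<zero>}" using genideal_minimal[OF zeroideal, of "{}"] ideal_zero[OF genideal_ideal, of "{}"] by auto
  have n0: "nonzerodivisor (R Quot {\<zero>}) ({\<zero>} +> a)" using reg[of 0] by (simp add: I0 a_def)
  have n1: "nonzerodivisor (R Quot (PIdl a)) (PIdl a +> b)"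
    using reg[of 1] t1 cgenideal_eq_genideal[OF c(1)] by (simp add: b_def)
  show ?thesis
  proof (rule that[OF ab])
    show "u = \<zero>" if "u \<in> carrier R" "a \<otimes> u = \<zero>" for u
      using nonzerodivisor_Quot[OF zeroideal c(1) n0] that by simp
    show "\<exists>t\<in>carrier R. u = a \<otimes> t" if u: "u \<in> carrier R" "r \<in> carrier R" "b \<otimes> u = a \<otimes> r" for u r
    proof -
      have "b \<otimes> u \<in> PIdl a" using u c m_comm[of a r] by (auto simp: cgenideal_def)
      then have "u \<in> PIdl a" using nonzerodivisor_Quot[OF cgenideal_ideal[OF c(1)] c(2) n1] u by blast
      then obtain t where "t \<in> carrier R" "u = t \<otimes> a" by (auto simp: cgenideal_def)
      then show ?thesis using c m_comm[of a t] by (intro bexI[of _ t]) auto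
    qed
  qed
qed

lemma syz2_of_radical:
  assumes dim: "krull_dim R = 2" and xy: "x \<in> carrier R" "y \<in> carrier R"
    and rad: "\<And>a. a \<in> \<mm> \<Longrightarrow> \<exists>n::nat. a [^] n \<in> dbl x y (carrier R)"
  shows "syz2 x y"
proof -
  obtain a b where ab: "a \<in> \<mm>" "b \<in> \<mm>"
    and r: "\<And>u. u \<in> carrier R \<Longrightarrow> a \<otimes> u = \<zero> \<Longrightarrow> u = \<zero>"
    "\<And>u r. u \<in> carrier R \<Longrightarrow> r \<in> carrier R \<Longrightarrow> b \<otimes> u = a \<otimes> r \<Longrightarrow> \<exists>t\<in>carrier R. u = a \<otimes> t"
    using regular_pair[OF dim] by blast
  have c: "a \<in> carrier R" "b \<in> carrier R" using ab max_ideal ideal_carr by blast+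
  obtain n k where nk: "a [^] (n::nat) \<in> dbl x y (carrier R)" "b [^] (k::nat) \<in> dbl x y (carrier R)"
    using rad ab by blast
  show ?thesis by (rule syz2_of_regular[OF xy nk regular_powers[OF c r]])
qed

end

context cring begin

section \<open>The determinant trick\<close>

lemma ideals_set_one: "\<one>\<^bsub>ideals_set R\<^esub> = carrier R"
  by (simp add: ideals_set_def)

lemma prod_mem_ipow:
  assumes I: "ideal I R" and "finite A" "\<And>i. i \<in> A \<Longrightarrow> g i \<in> ipow I (f i)"
  shows "(\<Otimes>i\<in>A. g i) \<in> ipow I (\<Sum>i\<in>A. f i)" using assms(2,3)
proof (induction A rule: finite_induct)
  case empty
  then show ?case unfolding finprod_empty sum.empty ipow_0 by simp
next
  case (insert i A)
  have c: "g j \<in> carrier R" if "j \<in> insert i A" for j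
    using insert.prems[OF that] ideal_carr[OF ipow_ideal[OF I]] by blast
  have "(\<Otimes>j\<in>insert i A. g j) = g i \<otimes> (\<Otimes>j\<in>A. g j)"
    using insert.hyps c by (intro finprod_insert) auto
  also have "\<dots> \<in> ipow I (f i + (\<Sum>j\<in>A. f j))"
    using insert by (intro mult_mem_ipow I) auto
  finally show ?case using insert.hyps by simp
qed

lemma prod_mem_two_powers:
  assumes I: "ideal I R" and J: "ideal J R" and "finite A"
    and "\<And>i. i \<in> A \<Longrightarrow> g i \<in> ipow J (e i) \<cdot> ipow I (f i)"
  shows "(\<Otimes>i\<in>A. g i) \<in> ipow J (\<Sum>i\<in>A. e i) \<cdot> ipow I (\<Sum>i\<in>A. f i)"
  using assms(3,4)
proof (induction A rule: finite_induct)
  case empty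
  then show ?case unfolding finprod_empty sum.empty ipow_0 ideal_prod_one[OF oneideal] by simp
next
  case (insert i A)
  note id = ipow_ideal[OF I] ipow_ideal[OF J] ideal_prod_is_ideal
  have c: "g j \<in> carrier R" if "j \<in> insert i A" for j
    using insert.prems[OF that] ideal_carr[OF id(3)[OF id(2) id(1)]] by blast
  have "(\<Otimes>j\<in>insert i A. g j) = g i \<otimes> (\<Otimes>j\<in>A. g j)"
    using insert.hyps c by (intro finprod_insert) auto
  also have "\<dots> \<in> (ipow J (e i) \<cdot> ipow I (f i)) \<cdot>
      (ipow J (\<Sum>i\<in>A. e i) \<cdot> ipow I (\<Sum>i\<in>A. f i))"
    using insert by (intro ideal_prod_mem) auto
  also have "\<dots> = ipow J (e i + (\<Sum>i\<in>A. e i)) \<cdot> ipow I (f i + (\<Sum>i\<in>A. f i))"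
    unfolding ipow_add[OF I] ipow_add[OF J] by (simp only: ideal_prod_ac id)
  finally show ?case using insert.hyps by simp
qed

text \<open>The power is tested on products of single elements. A finite set \<open>S\<close>
  indexes the factors, so that they can be placed on the diagonal of a matrix indexed by
  \<open>S\<close>.\<close>

lemma ideal_prod_power_le:
  assumes Q: "ideal Q R" and I: "ideal I R" and "finite S" and "ideal A R"
    and "\<And>q z. q \<in> A \<Longrightarrow> z \<in> S \<rightarrow> I \<Longrightarrow> q \<otimes> (\<Otimes>j\<in>S. z j) \<in> Q"
  shows "A \<cdot> ipow I (card S) \<subseteq> Q" using assms(3-)
proof (induction S arbitrary: A rule: finite_induct)
  case empty
  have "A \<subseteq> Q" using empty.prems(2)[of _ "\<lambda>_. \<zero>"] ideal_carr[OF empty.prems(1)] by fastforce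
  then show ?case unfolding card.empty ipow_0 ideal_prod_one[OF empty.prems(1)] .
next
  case (insert j S)
  note A = insert.prems(1)
  have "A \<cdot> ipow I (card (insert j S)) = (A \<cdot> I) \<cdot> ipow I (card S)"
    using insert.hyps ipow_Suc[OF I] ideal_prod_assoc[OF A I ipow_ideal[OF I]] by simp
  also have "\<dots> \<subseteq> Q"
  proof (rule insert.IH[OF ideal_prod_is_ideal[OF A I]])
    fix q z assume q: "q \<in> A \<cdot> I" and z: "z \<in> S \<rightarrow> I"
    have zc: "(\<Otimes>j\<in>S. z j) \<in> carrier R" using z ideal_carr[OF I] by (intro finprod_closed) auto
    have "A \<cdot> I \<subseteq> colon Q {\<Otimes>j\<in>S. z j}"
    proof (rule ideal_prod_le)
      show "ideal (colon Q {\<Otimes>j\<in>S. z j}) R" using Q zc by (intro colon_ideal) auto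
      fix a i assume a: "a \<in> A" and i: "i \<in> I"
      have c: "a \<in> carrier R" "i \<in> carrier R" using a i A I ideal_carr by blast+
      let ?z = "z(j := i)"
      have zI: "?z \<in> insert j S \<rightarrow> I" using z i by auto
      have "(\<Otimes>k\<in>insert j S. ?z k) = ?z j \<otimes> (\<Otimes>k\<in>S. ?z k)"
        using insert.hyps zI ideal_carr[OF I] by (intro finprod_insert) (auto simp: Pi_iff)
      also have "(\<Otimes>k\<in>S. ?z k) = (\<Otimes>k\<in>S. z k)"
        using insert.hyps z ideal_carr[OF I] by (intro finprod_cong') auto
      finally have "a \<otimes> (i \<otimes> (\<Otimes>k\<in>S. z k)) \<in> Q"
        using insert.prems(2)[OF a zI] by simp
      then show "a \<otimes> i \<in> colon Q {\<Otimes>j\<in>S. z j}" using c zc by (simp add: colon_def m_assoc)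
    qed
    then show "q \<otimes> (\<Otimes>j\<in>S. z j) \<in> Q" using q by (auto simp: colon_def)
  qed
  finally show ?case .
qed

lemma finprod_zero_factor:
  assumes "finite A" "i \<in> A" "g i = \<zero>" "\<And>j. j \<in> A \<Longrightarrow> g j \<in> carrier R"
  shows "(\<Otimes>j\<in>A. g j) = \<zero>"
proof -
  have "(\<Otimes>j\<in>insert i (A - {i}). g j) = g i \<otimes> (\<Otimes>j\<in>A - {i}. g j)"
    using assms by (intro finprod_insert) auto
  also have "\<dots> = \<zero>" using assms by (simp add: finprod_closed)
  finally show ?thesis using assms(2) by (simp add: insert_absorb)
qed

text \<open>Every term in which the two products differ has a factor from \<open>J\<close>. In
  \<open>red_filt J I\<close> the ideal \<open>J\<close> plays the smaller role and \<open>I\<close>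
  the larger one.\<close>

lemma prod_minus_mem:
  assumes I: "ideal I R" and J: "ideal J R" "J \<subseteq> I" and "finite S"
    and z: "z \<in> S \<rightarrow> I" and b: "b \<in> S \<rightarrow> J"
  shows "(\<Otimes>j\<in>S. z j) \<ominus> (\<Otimes>j\<in>S. z j \<ominus> b j) \<in> red_filt J I (card S)"
  using assms(4-)
proof (induction S rule: finite_induct)
  case empty
  then show ?case by (simp add: red_filt_def a_minus_def r_neg)
next
  case (insert j S)
  have zI: "z k \<in> I" "z k \<ominus> b k \<in> I" if "k \<in> insert j S" for k
    using insert.prems that J ideal_minus[OF I] by (auto simp: Pi_iff)
  then have c: "z k \<in> carrier R" "z k \<ominus> b k \<in> carrier R" if "k \<in> insert j S" for k
    using that ideal_carr[OF I] by blast+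
  have p: "(\<Otimes>k\<in>S. h k) \<in> ipow I (card S)" if "\<And>k. k \<in> S \<Longrightarrow> h k \<in> I" for h
    using prod_mem_ipow[OF I insert.hyps(1), of h "\<lambda>_. 1"] that ipow_1[OF I] by simp
  have eq: "(\<Otimes>k\<in>insert j S. h k) = h j \<otimes> (\<Otimes>k\<in>S. h k)"
    if "\<And>k. k \<in> insert j S \<Longrightarrow> h k \<in> carrier R" for h
    using insert.hyps that by (intro finprod_insert) auto
  have bj: "z j \<ominus> (z j \<ominus> b j) \<in> red_filt J I 1"
  proof -
    have "b j \<in> J" using insert.prems by auto
    moreover have "z j \<ominus> (z j \<ominus> b j) = b j" using c ideal_carr[OF J(1) \<open>b j \<in> J\<close>]
      by (simp add: a_minus_def minus_add r_neg2)
    ultimately show ?thesis unfolding red_filt_def by (simp add: ideals_set_one ideal_prod_one[OF J(1)])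
  qed
  have "z j \<otimes> (\<Otimes>k\<in>S. z k) \<ominus> (z j \<ominus> b j) \<otimes> (\<Otimes>k\<in>S. z k \<ominus> b k) \<in> red_filt J I (1 + card S)"
    using insert zI ipow_1[OF I] by (intro red_filt_cong_mult[OF I J] bj p) auto
  then show ?case using eq[of z] eq[of "\<lambda>k. z k \<ominus> b k"] c insert.hyps by simp
qed

text \<open>Degree \<open>n\<close> part of the module over the Rees algebra of \<open>J\<close>
  generated by \<open>K\<close> in degree 0 and K I in degree 1; as J is contained in I, it absorbs
  K J^n.\<close>

definition kbase :: "'a set \<Rightarrow> 'a set \<Rightarrow> 'a set \<Rightarrow> nat \<Rightarrow> 'a set" where
  "kbase I J K n = (if n = 0 then K else (K \<cdot> I) \<cdot> ipow J (n - 1))"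

context
  fixes I J K :: "'a set" and S :: "'k set" and y :: "'k \<Rightarrow> 'a" and d :: "'k \<Rightarrow> nat"
  assumes I: "ideal I R" and J: "ideal J R" and K: "ideal K R" and JI: "J \<subseteq> I"
    and S: "finite S" and y: "\<And>k. k \<in> S \<Longrightarrow> y k \<in> carrier R"
begin

abbreviation "gen_base \<equiv> kbase I J K"

text \<open>Coefficients in degree \<open>n\<close> of a generator of degree \<open>d k\<close>. The
  value \<open>{\<zero>}\<close> stands for negative powers and makes matrix entries of negative
  degree vanish.\<close>

definition gen_coeff :: "nat \<Rightarrow> 'k \<Rightarrow> 'a set" where
  "gen_coeff n k = (if d k \<le> n then ipow J (n - d k) else {\<zero>})"

text \<open>Degree \<open>n\<close> part of the module over the Rees algebra generated by the base
  and by each \<open>y k\<close> in degree \<open>d k\<close>.\<close>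

definition gen_mod :: "nat \<Rightarrow> 'a set" where
  "gen_mod n = {c \<oplus> (\<Oplus>k\<in>S. b k \<otimes> y k) | c b. c \<in> gen_base n \<and> (\<forall>k\<in>S. b k \<in> gen_coeff n k)}"

lemma gen_base_ideal: "ideal (gen_base n) R"
  using I J K by (simp add: kbase_def ideal_prod_is_ideal ipow_ideal)

lemma gen_coeff_ideal: "ideal (gen_coeff n k) R"
  using J zeroideal by (simp add: gen_coeff_def ipow_ideal)

lemma gen_coeff_carr: "\<forall>k\<in>S. b k \<in> gen_coeff n k \<Longrightarrow> k \<in> S \<Longrightarrow> b k \<in> carrier R"
  using ideal_carr[OF gen_coeff_ideal] by blast

lemma gen_sum_closed:
  "\<forall>k\<in>S. b k \<in> gen_coeff n k \<Longrightarrow> (\<Oplus>k\<in>S. b k \<otimes> y k) \<in> carrier R"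
  using gen_coeff_carr y by (intro finsum_closed) auto

lemma gen_modI:
  "c \<in> gen_base n \<Longrightarrow> \<forall>k\<in>S. b k \<in> gen_coeff n k \<Longrightarrow> c \<oplus> (\<Oplus>k\<in>S. b k \<otimes> y k) \<in> gen_mod n"
  unfolding gen_mod_def by blast

lemma gen_modE:
  assumes "u \<in> gen_mod n"
  obtains c b where "c \<in> gen_base n" "\<forall>k\<in>S. b k \<in> gen_coeff n k" "u = c \<oplus> (\<Oplus>k\<in>S. b k \<otimes> y k)"
  using assms unfolding gen_mod_def by blast

text \<open>Serves two purposes: multiplication by ring elements inside one degree, and
  multiplication by \<open>J\<close> into the next degree.\<close>

lemma gen_mod_smult:
  assumes u: "u \<in> gen_mod n" and r: "r \<in> carrier R"
    and base: "\<And>c. c \<in> gen_base n \<Longrightarrow> r \<otimes> c \<in> gen_base m"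
    and coeff: "\<And>k b. k \<in> S \<Longrightarrow> b \<in> gen_coeff n k \<Longrightarrow> r \<otimes> b \<in> gen_coeff m k"
  shows "r \<otimes> u \<in> gen_mod m"
proof -
  obtain c b where u: "c \<in> gen_base n" "\<forall>k\<in>S. b k \<in> gen_coeff n k" "u = c \<oplus> (\<Oplus>k\<in>S. b k \<otimes> y k)"
    using u by (rule gen_modE)
  note bc = gen_coeff_carr[OF u(2)]
  have cc: "c \<in> carrier R" using u ideal_carr[OF gen_base_ideal] by blast
  have "r \<otimes> u = r \<otimes> c \<oplus> r \<otimes> (\<Oplus>k\<in>S. b k \<otimes> y k)"
    unfolding u(3) using r cc gen_sum_closed[OF u(2)] by (simp add: r_distr)
  also have "r \<otimes> (\<Oplus>k\<in>S. b k \<otimes> y k) = (\<Oplus>k\<in>S. r \<otimes> (b k \<otimes> y k))"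
    using r S bc y by (intro finsum_rdistr) auto
  also have "\<dots> = (\<Oplus>k\<in>S. (r \<otimes> b k) \<otimes> y k)"
    using r bc y by (intro finsum_cong') (auto simp: m_assoc)
  finally show ?thesis using u base coeff gen_modI[of "r \<otimes> c" m "\<lambda>k. r \<otimes> b k"] by simp
qed

lemma gen_mod_ideal: "ideal (gen_mod n) R"
proof (rule idealI_cring)
  show "gen_mod n \<subseteq> carrier R"
  proof
    fix u assume "u \<in> gen_mod n"
    then show "u \<in> carrier R"
      by (rule gen_modE) (use gen_sum_closed ideal_carr[OF gen_base_ideal] in auto)
  qed
  have "(\<Oplus>k\<in>S. \<zero> \<otimes> y k) = (\<Oplus>k\<in>S. \<zero>)" using y by (intro finsum_cong') auto
  then show "\<zero> \<in> gen_mod n"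
    using gen_modI[OF ideal_zero[OF gen_base_ideal], of "\<lambda>_. \<zero>" n] ideal_zero[OF gen_coeff_ideal]
    by (simp add: finsum_zero)
  fix u v assume "u \<in> gen_mod n" "v \<in> gen_mod n"
  then obtain c b c' b' where u: "c \<in> gen_base n" "\<forall>k\<in>S. b k \<in> gen_coeff n k" "u = c \<oplus> (\<Oplus>k\<in>S. b k \<otimes> y k)"
    and v: "c' \<in> gen_base n" "\<forall>k\<in>S. b' k \<in> gen_coeff n k" "v = c' \<oplus> (\<Oplus>k\<in>S. b' k \<otimes> y k)"
    by (elim gen_modE)
  note bc = gen_coeff_carr[OF u(2)] gen_coeff_carr[OF v(2)]
  have cc: "c \<in> carrier R" "c' \<in> carrier R" using u v ideal_carr[OF gen_base_ideal] by blast+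
  have "(\<Oplus>k\<in>S. (b k \<oplus> b' k) \<otimes> y k) = (\<Oplus>k\<in>S. b k \<otimes> y k \<oplus> b' k \<otimes> y k)"
    using bc y by (intro finsum_cong') (auto simp: l_distr)
  also have "\<dots> = (\<Oplus>k\<in>S. b k \<otimes> y k) \<oplus> (\<Oplus>k\<in>S. b' k \<otimes> y k)"
    using bc y by (intro finsum_addf) auto
  finally have "u \<oplus> v = (c \<oplus> c') \<oplus> (\<Oplus>k\<in>S. (b k \<oplus> b' k) \<otimes> y k)"
    unfolding u(3) v(3) using cc gen_sum_closed[OF u(2)] gen_sum_closed[OF v(2)] by (simp add: a_ac)
  also have "\<dots> \<in> gen_mod n"
    using u v by (intro gen_modI) (auto intro: ideal_add[OF gen_base_ideal] ideal_add[OF gen_coeff_ideal])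
  finally show "u \<oplus> v \<in> gen_mod n" .
next
  fix r u assume "r \<in> carrier R" "u \<in> gen_mod n"
  then show "r \<otimes> u \<in> gen_mod n"
    by (intro gen_mod_smult[of u n]) (auto intro: ideal_l[OF gen_base_ideal] ideal_l[OF gen_coeff_ideal])
qed

lemma gen_base_sub: "gen_base n \<subseteq> gen_mod n"
proof
  fix c assume c: "c \<in> gen_base n"
  have "(\<Oplus>k\<in>S. \<zero> \<otimes> y k) = (\<Oplus>k\<in>S. \<zero>)" using y by (intro finsum_cong') auto
  then show "c \<in> gen_mod n"
    using gen_modI[OF c, of "\<lambda>_. \<zero>"] ideal_zero[OF gen_coeff_ideal] ideal_carr[OF gen_base_ideal c]
    by (simp add: finsum_zero)
qed

lemma gen_mod_gen:
  assumes k: "k \<in> S" "d k = n"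
  shows "y k \<in> gen_mod n"
proof -
  let ?b = "\<lambda>j. if j = k then \<one> else \<zero>"
  have "(\<Oplus>j\<in>S. ?b j \<otimes> y j) = (\<Oplus>j\<in>S. if k = j then y j else \<zero>)"
    using y by (intro finsum_cong') auto
  also have "\<dots> = y k" using k S y by (intro finsum_singleton) auto
  finally have s: "(\<Oplus>j\<in>S. ?b j \<otimes> y j) = y k" .
  have "\<one> \<in> gen_coeff n k" using k by (simp add: gen_coeff_def ideals_set_one)
  then have "\<forall>j\<in>S. ?b j \<in> gen_coeff n j" using ideal_zero[OF gen_coeff_ideal] by simp
  then show ?thesis using gen_modI[OF ideal_zero[OF gen_base_ideal], of ?b n] s y k by simp
qed

lemma gen_mod_step: "J \<cdot> gen_mod n \<subseteq> gen_mod (Suc n)"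
proof (rule ideal_prod_le[OF gen_mod_ideal])
  fix r u assume r: "r \<in> J" and u: "u \<in> gen_mod n"
  show "r \<otimes> u \<in> gen_mod (Suc n)"
  proof (rule gen_mod_smult[OF u])
    show "r \<in> carrier R" using r J ideal_carr by blast
    show "r \<otimes> c \<in> gen_base (Suc n)" if c: "c \<in> gen_base n" for c
    proof (cases n)
      case 0
      have "c \<otimes> r \<in> K \<cdot> I" using c r JI 0 by (intro ideal_prod_mem) (auto simp: kbase_def)
      moreover have "c \<in> carrier R" "r \<in> carrier R" using ideal_carr[OF gen_base_ideal c] ideal_carr[OF J r] .
      ultimately show ?thesis using 0 I K
        by (simp add: kbase_def ideals_set_one ideal_prod_one ideal_prod_is_ideal m_comm)
    next
      case (Suc m)
      have "r \<otimes> c \<in> J \<cdot> ((K \<cdot> I) \<cdot> ipow J m)"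
        using c r Suc by (intro ideal_prod_mem) (auto simp: kbase_def)
      also have "\<dots> = (K \<cdot> I) \<cdot> ipow J n" unfolding Suc ipow_Suc[OF J]
        by (intro ideal_prod_lcomm J ideal_prod_is_ideal K I ipow_ideal)
      finally show ?thesis by (simp add: kbase_def)
    qed
    show "r \<otimes> b \<in> gen_coeff (Suc n) k" if k: "k \<in> S" and b: "b \<in> gen_coeff n k" for k b
    proof (cases "d k \<le> n")
      case True
      then have "r \<otimes> b \<in> J \<cdot> ipow J (n - d k)"
        using r b by (intro ideal_prod_mem) (auto simp: gen_coeff_def)
      also have "\<dots> = ipow J (Suc n - d k)"
        using ipow_Suc[OF J] True by (simp only: Suc_diff_le)
      finally show ?thesis using True by (simp add: gen_coeff_def)
    next
      case False
      then have "r \<otimes> b = \<zero>" using r b ideal_carr[OF J] by (simp add: gen_coeff_def)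
      then show ?thesis using ideal_zero[OF gen_coeff_ideal] by simp
    qed
  qed
qed

context
  fixes M :: "nat \<Rightarrow> 'a set"
  assumes IM: "\<And>n. I \<cdot> M n \<subseteq> M (Suc n)" and KIM: "K \<cdot> I \<subseteq> M 1"
    and yM: "\<And>k. k \<in> S \<Longrightarrow> y k \<in> M (d k)"
    and gen: "\<And>n C. ideal C R \<Longrightarrow> (n = 0 \<Longrightarrow> K \<subseteq> C) \<Longrightarrow> (n = 1 \<Longrightarrow> K \<cdot> I \<subseteq> C) \<Longrightarrow>
      (n > 0 \<Longrightarrow> J \<cdot> M (n - 1) \<subseteq> C) \<Longrightarrow> (\<And>k. k \<in> S \<Longrightarrow> d k = n \<Longrightarrow> y k \<in> C) \<Longrightarrow> M n \<subseteq> C"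
begin

text \<open>Induction on the degree. The universal property \<open>gen\<close> is applied with
  \<open>gen_mod n\<close> for \<open>C\<close>, which contains the new generators and, by
  \<open>gen_mod_step\<close>, J times the previous degree.\<close>

lemma M_sub_gen_mod: "M n \<subseteq> gen_mod n"
proof (induction n)
  case 0
  show ?case
  proof (rule gen[OF gen_mod_ideal])
    show "K \<subseteq> gen_mod 0" using gen_base_sub[of 0] by (simp add: kbase_def)
    show "y k \<in> gen_mod 0" if "k \<in> S" "d k = 0" for k using gen_mod_gen[OF that] .
  qed auto
next
  case (Suc n)
  show ?case
  proof (rule gen[OF gen_mod_ideal])
    have "K \<cdot> I \<cdot> carrier R = K \<cdot> I" using ideal_prod_one ideal_prod_is_ideal I K by blast
    then show "K \<cdot> I \<subseteq> gen_mod (Suc n)" if "Suc n = 1"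
      using gen_base_sub[of 1] that by (simp add: kbase_def ideals_set_one)
    show "J \<cdot> M (Suc n - 1) \<subseteq> gen_mod (Suc n)"
      using ideal_prod_mono[OF subset_refl Suc, of J] gen_mod_step[of n] by auto
    show "y k \<in> gen_mod (Suc n)" if "k \<in> S" "d k = Suc n" for k using gen_mod_gen[OF that] .
  qed auto
qed

text \<open>The index \<^term>\<open>None\<close> is an extra generator \<open>1\<close>, whose coefficients carry the factor \<open>K I\<close>; its
  degree is set to \<open>1\<close> to make the matrix below homogeneous.\<close>

abbreviation "SO \<equiv> insert None (Some ` S)"

definition yo :: "'k option \<Rightarrow> 'a" where "yo i = (case i of None \<Rightarrow> \<one> | Some k \<Rightarrow> y k)"
definition dg :: "'k option \<Rightarrow> nat" where "dg i = (case i of None \<Rightarrow> 1 | Some k \<Rightarrow> d k)"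
definition WO :: "nat \<Rightarrow> 'k option \<Rightarrow> 'a set" where
  "WO n i = (case i of None \<Rightarrow> gen_base n | Some k \<Rightarrow> gen_coeff n k)"

lemma WO_ideal: "ideal (WO n i) R"
  using gen_base_ideal gen_coeff_ideal by (cases i) (auto simp: WO_def)

lemma yo_closed: "i \<in> SO \<Longrightarrow> yo i \<in> carrier R"
  using y by (auto simp: yo_def)

lemma gen_mod_rep:
  assumes "u \<in> gen_mod n"
  shows "\<exists>f. (\<forall>k\<in>SO. f k \<in> WO n k) \<and> u = (\<Oplus>k\<in>SO. f k \<otimes> yo k)"
proof -
  obtain c b where cb: "c \<in> gen_base n" "\<forall>k\<in>S. b k \<in> gen_coeff n k" "u = c \<oplus> (\<Oplus>k\<in>S. b k \<otimes> y k)"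
    using gen_modE[OF assms] by blast
  define f where "f = case_option c b"
  have fW: "\<forall>k\<in>SO. f k \<in> WO n k" using cb by (auto simp: f_def WO_def)
  then have fc: "f k \<in> carrier R" if "k \<in> SO" for k using ideal_carr[OF WO_ideal] that by blast
  have "(\<Oplus>k\<in>SO. f k \<otimes> yo k) = f None \<otimes> yo None \<oplus> (\<Oplus>k\<in>Some ` S. f k \<otimes> yo k)"
    using S fc yo_closed by (intro finsum_insert) auto
  also have "(\<Oplus>k\<in>Some ` S. f k \<otimes> yo k) = (\<Oplus>k\<in>S. f (Some k) \<otimes> yo (Some k))"
    using fc yo_closed by (intro finsum_reindex) auto
  finally have "(\<Oplus>k\<in>SO. f k \<otimes> yo k) = u"
    using cb ideal_carr[OF gen_base_ideal cb(1)] by (simp add: f_def yo_def)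
  then show ?thesis using fW by metis
qed

text \<open>Multiplying 1 by \<open>q\<close> and each y_j by z_j raises degrees by one, so the
  results are again combinations of 1 and the y_k. The matrix \<open>E\<close> of these relations
  kills a vector with entry 1, and its diagonal product is q times the product of the z_j up to
  terms of \<open>?Q\<close>.\<close>

lemma determinant_trick_product:
  assumes q: "q \<in> (K \<cdot> I) \<cdot> I" and z: "z \<in> S \<rightarrow> I"
  shows "q \<otimes> (\<Otimes>j\<in>S. z j) \<in> K \<cdot> (J \<cdot> ipow I (card S + 1))"
proof -
  let ?s = "card S" and ?p = "ipow"
  let ?Q = "K \<cdot> (J \<cdot> ?p I (?s + 1))"
  note id = ipow_ideal[OF I] ipow_ideal[OF J] ideal_prod_is_ideal I J K
  have iQ: "ideal ?Q R" by (intro id)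
  have one_l: "carrier R \<cdot> A = A" if "ideal A R" for A
    using ideal_prod_commute[OF oneideal that] ideal_prod_one[OF that] by simp
  \<comment> \<open>\<open>q\<close> belongs to the index \<open>None\<close> of degree 1: it lies
    in I (K I), hence in I M_1, and so has degree 2.\<close>
  define D where "D = case_option q z"
  have KII: "ideal ((K \<cdot> I) \<cdot> I) R" by (intro id)
  have DI: "D (Some j) \<in> I" if "j \<in> S" for j using z that by (auto simp: D_def)
  have Dc: "D i \<in> carrier R" if "i \<in> SO" for i
    using that DI ideal_carr[OF I] ideal_carr[OF KII q] by (auto simp: D_def)
  have rep: "\<exists>f. (\<forall>k\<in>SO. f k \<in> WO (Suc (dg i)) k) \<and> D i \<otimes> yo i = (\<Oplus>k\<in>SO. f k \<otimes> yo k)"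
    if i: "i \<in> SO" for i
  proof (rule gen_mod_rep)
    show "D i \<otimes> yo i \<in> gen_mod (Suc (dg i))"
    proof (cases i)
      case None
      have "(K \<cdot> I) \<cdot> I = I \<cdot> (K \<cdot> I)" by (intro ideal_prod_commute id)
      then have "q \<in> I \<cdot> M 1" using q ideal_prod_mono[OF subset_refl KIM, of I] by auto
      then have "q \<in> gen_mod 2" using IM[of 1] M_sub_gen_mod[of 2] by (auto simp: numeral_2_eq_2)
      then show ?thesis using None ideal_carr[OF KII q] by (simp add: D_def yo_def dg_def numeral_2_eq_2)
    next
      case (Some j)
      then have "D i \<otimes> y j \<in> I \<cdot> M (d j)" using i DI yM by (intro ideal_prod_mem) auto
      then show ?thesis using Some IM[of "d j"] M_sub_gen_mod[of "Suc (d j)"] by (auto simp: yo_def dg_def)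
    qed
  qed
  have "\<exists>B. \<forall>i\<in>SO. (\<forall>k\<in>SO. B i k \<in> WO (Suc (dg i)) k) \<and> D i \<otimes> yo i = (\<Oplus>k\<in>SO. B i k \<otimes> yo k)"
    by (rule bchoice) (use rep in blast)
  then obtain B where B: "\<And>i k. i \<in> SO \<Longrightarrow> k \<in> SO \<Longrightarrow> B i k \<in> WO (Suc (dg i)) k"
    and Beq: "\<And>i. i \<in> SO \<Longrightarrow> D i \<otimes> yo i = (\<Oplus>k\<in>SO. B i k \<otimes> yo k)" by blast
  have Bc: "B i k \<in> carrier R" if "i \<in> SO" "k \<in> SO" for i k
    using ideal_carr[OF WO_ideal B[OF that]] .
  define E where "E i k = (if i = k then D i else \<zero>) \<ominus> B i k" for i k
  have Ec: "E i k \<in> carrier R" if "i \<in> SO" "k \<in> SO" for i k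
    using that Dc Bc by (simp add: E_def)
  have fS: "finite SO" "None \<in> SO" and cS: "card SO = ?s + 1" using S by (auto simp: card_image)
  have ker: "(\<Oplus>k\<in>SO. E i k \<otimes> yo k) = \<zero>" if i: "i \<in> SO" for i
  proof -
    let ?u = "\<Oplus>k\<in>SO. E i k \<otimes> yo k" and ?v = "\<Oplus>k\<in>SO. B i k \<otimes> yo k"
    have c: "?u \<in> carrier R" "?v \<in> carrier R"
      using i Ec Bc yo_closed by (intro finsum_closed; auto)+
    have "?u \<oplus> ?v = (\<Oplus>k\<in>SO. E i k \<otimes> yo k \<oplus> B i k \<otimes> yo k)"
      using i Ec Bc yo_closed by (intro finsum_addf[symmetric]) auto
    also have "\<dots> = (\<Oplus>k\<in>SO. if i = k then D k \<otimes> yo k else \<zero>)"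
    proof (rule finsum_cong')
      fix k assume k: "k \<in> SO"
      have "E i k \<otimes> yo k \<oplus> B i k \<otimes> yo k = (E i k \<oplus> B i k) \<otimes> yo k"
        using i k Ec Bc yo_closed by (simp add: l_distr)
      also have "E i k \<oplus> B i k = (if i = k then D i else \<zero>)"
        using i k Dc Bc add_minus_cancel(3)[of "B i k" "if i = k then D i else \<zero>"]
        by (simp add: E_def a_comm)
      finally show "E i k \<otimes> yo k \<oplus> B i k \<otimes> yo k = (if i = k then D k \<otimes> yo k else \<zero>)"
        using k yo_closed by simp
    qed (use i Dc yo_closed in auto)
    also have "\<dots> = D i \<otimes> yo i" using i fS Dc yo_closed by (intro finsum_singleton) auto
    finally have "?u \<oplus> ?v = ?v" using Beq[OF i] by simp
    then show ?thesis using add_minus_cancel(1)[OF c] r_neg[OF c(2)] by (simp add: a_minus_def)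
  qed
  \<comment> \<open>Either some entry has negative degree and is zero, or every entry is located in
    a product of powers of J and I whose exponents are summed over \<open>SO\<close>.\<close>
  have offdiag: "perm_term SO E p \<in> ?Q" if p: "p permutes SO" "p \<noteq> id" for p
  proof (cases "\<exists>i\<in>SO. p i \<noteq> i \<and> dg (p i) > Suc (dg i) \<and> p i \<noteq> None")
    case True
    then obtain i where i0: "i \<in> SO" "p i \<noteq> i" "dg (p i) > Suc (dg i)" "p i \<noteq> None" by blast
    then obtain k where "p i = Some k" by auto
    then have i: "i \<in> SO" "p i = Some k" "i \<noteq> Some k" "d k > Suc (dg i)"
      using i0 by (simp_all add: dg_def[of "Some k"])
    have "p i \<in> SO" using p i(1) permutes_in_image by metis
    then have "B i (Some k) \<in> WO (Suc (dg i)) (Some k)" using i B by metis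
    then have "B i (Some k) = \<zero>" using i(4) by (simp add: WO_def gen_coeff_def)
    then have "E i (p i) = \<zero>" using i by (simp add: E_def a_minus_def)
    then have "perm_term SO E p = \<zero>" unfolding perm_term_def
    proof (rule finprod_zero_factor[OF fS(1) i(1)])
      show "E j (p j) \<in> carrier R" if "j \<in> SO" for j
        using Ec[OF that iffD2[OF permutes_in_image[OF p(1)] that]] .
    qed
    then show ?thesis using ideal_zero[OF iQ] by simp
  next
    case False
    then have le: "dg (p i) \<le> Suc (dg i)" if "i \<in> SO" "p i \<noteq> i" for i
      using that by (cases "p i = None") (auto simp: dg_def)
    have pS: "p i \<in> SO" if "i \<in> SO" for i using p(1) that permutes_in_image by metis
    \<comment> \<open>Exponents of J and I that hold entry \<open>(i, p i)\<close>, with an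
      additional factor K in column \<open>None\<close>. A fixed index supplies one factor I, column
      \<open>None\<close> supplies one from K I, and an entry off the diagonal supplies its degree
      difference as a power of J.\<close>
    define e where "e i = (if p i = i then 0 else Suc (dg i) - dg (p i))" for i
    define f where "f i = (if p i = i then 1 else 0) + (if p i = None then 1 else 0 :: nat)" for i
    let ?P = "\<lambda>e f. ?p J e \<cdot> ?p I f"
    have iP: "ideal (?P e f) R" for e f by (intro id)
    have P0: "?P 0 f = ?p I f" for f unfolding ipow_0 by (rule one_l) (intro id)
    have P1: "?P e 0 = ?p J e" for e unfolding ipow_0 by (rule ideal_prod_one) (intro id)
    have mem: "E i (p i) \<in> ?P (e i) (f i)" if i: "i \<in> SO" "p i \<noteq> None" for i
    proof -
      obtain k where k: "p i = Some k" "k \<in> S" using pS[OF i(1)] i(2) by auto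
      have Bk: "B i (Some k) \<in> gen_coeff (Suc (dg i)) k" using B[OF i(1) pS[OF i(1)]] k by (simp add: WO_def)
      show ?thesis
      proof (cases "p i = i")
        case True
        then have ik: "i = Some k" using k by simp
        have "gen_coeff (Suc (d k)) k = J" using ipow_1[OF J] by (simp add: gen_coeff_def)
        then have "B i (Some k) \<in> I" using Bk JI ik by (auto simp: dg_def)
        then have "E i (p i) \<in> I" using ideal_minus[OF I DI[OF k(2)]] ik k by (simp add: E_def)
        moreover have "e i = 0" "f i = 1" using True ik by (simp_all add: e_def f_def)
        ultimately show ?thesis using P0[of 1] ipow_1[OF I] by simp
      next
        case False
        have "E i (p i) = \<ominus> B i (Some k)" using False k Bc[OF i(1) pS[OF i(1)]] by (simp add: E_def a_minus_def)
        also have "\<dots> \<in> gen_coeff (Suc (dg i)) k" by (rule ideal_neg[OF gen_coeff_ideal Bk])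
        also have "\<dots> = ?P (e i) (f i)"
          using False k le[OF i(1) False] P1[of "e i"] by (simp add: gen_coeff_def e_def f_def dg_def)
        finally show ?thesis .
      qed
    qed
    have mem0: "E i (p i) \<in> K \<cdot> ?P (e i) (f i)" if i: "i \<in> SO" "p i = None" for i
    proof -
      have KI: "K \<cdot> ?P 0 2 = (K \<cdot> I) \<cdot> I"
      proof -
        have "?p I 2 = I \<cdot> I"
          by (simp only: numeral_2_eq_2 ipow_Suc[OF I] ipow_0 ideal_prod_one[OF I])
        then show ?thesis unfolding P0 by (simp only: ideal_prod_assoc id)
      qed
      have B0: "B i None \<in> (K \<cdot> I) \<cdot> ?p J (dg i)" using B[OF i(1) fS(2)] by (simp add: WO_def kbase_def)
      show ?thesis
      proof (cases "p i = i")
        case True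
        then have iN: "i = None" using i by simp
        have "B i None \<in> (K \<cdot> I) \<cdot> J" using B0 iN ipow_1[OF J] by (simp add: dg_def)
        then have "B i None \<in> (K \<cdot> I) \<cdot> I" using ideal_prod_mono[OF subset_refl JI] by blast
        then have "E i (p i) \<in> (K \<cdot> I) \<cdot> I" using ideal_minus[OF KII q] iN i by (simp add: E_def D_def)
        moreover have "e i = 0" "f i = 2" using iN i by (simp_all add: e_def f_def)
        ultimately show ?thesis using KI by simp
      next
        case False
        have "E i (p i) = \<ominus> B i None" using False i Bc[OF i(1) fS(2)] by (simp add: E_def a_minus_def)
        also have "\<dots> \<in> (K \<cdot> I) \<cdot> ?p J (dg i)" by (rule ideal_neg[OF _ B0]) (intro id)
        also have "\<dots> = K \<cdot> (?p J (dg i) \<cdot> I)" by (simp only: ideal_prod_ac id)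
        also have "\<dots> = K \<cdot> ?P (e i) (f i)"
          using False i ipow_1[OF I] by (simp add: e_def f_def dg_def)
        finally show ?thesis .
      qed
    qed
    obtain i0 where i0: "i0 \<in> SO" "p i0 = None" using p(1) fS(2) by (metis permutes_def permutes_in_image)
    have uni: "p i \<noteq> None" if "i \<noteq> i0" for i using that i0(2) permutes_inj[OF p(1)] by (metis injD)
    have pc: "E i (p i) \<in> carrier R" if "i \<in> SO" for i using Ec that pS by blast
    have "perm_term SO E p = (\<Otimes>i\<in>insert i0 (SO - {i0}). E i (p i))"
      using i0 by (simp add: perm_term_def insert_absorb)
    also have "\<dots> = E i0 (p i0) \<otimes> (\<Otimes>i\<in>SO - {i0}. E i (p i))"
    proof (rule finprod_insert)
      show "(\<lambda>i. E i (p i)) \<in> SO - {i0} \<rightarrow> carrier R" using pc by blast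
    qed (use fS pc[OF i0(1)] in auto)
    also have "\<dots> \<in> (K \<cdot> ?P (e i0) (f i0)) \<cdot> ?P (sum e (SO - {i0})) (sum f (SO - {i0}))"
      using mem0[OF i0] mem uni fS by (intro ideal_prod_mem prod_mem_two_powers[OF I J]) auto
    also have "\<dots> = K \<cdot> ?P (e i0 + sum e (SO - {i0})) (f i0 + sum f (SO - {i0}))"
      unfolding ipow_add[OF I] ipow_add[OF J] by (simp only: ideal_prod_ac id)
    also have "e i0 + sum e (SO - {i0}) = sum e SO" using fS i0 by (metis sum.remove)
    also have "f i0 + sum f (SO - {i0}) = sum f SO" using fS i0 by (metis sum.remove)
    finally have mP: "perm_term SO E p \<in> K \<cdot> ?P (sum e SO) (sum f SO)" .
    have none1: "(\<Sum>i\<in>SO. if p i = None then 1 else 0 :: nat) = 1"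
    proof -
      have "(\<Sum>i\<in>SO. if p i = None then 1 else 0 :: nat) = (\<Sum>i\<in>SO. if i = None then 1 else 0)"
        using sum.permute[OF p(1), of "\<lambda>i. if i = None then 1 else 0 :: nat"] by (simp add: comp_def)
      also have "\<dots> = 1" using fS by (subst sum.delta) auto
      finally show ?thesis .
    qed
    have "e i + f i + dg (p i) = dg i + 1 + (if p i = None then 1 else 0)" if "i \<in> SO" for i
      using le[OF that] by (auto simp: e_def f_def dg_def)
    then have "(\<Sum>i\<in>SO. e i + f i + dg (p i)) = (\<Sum>i\<in>SO. dg i + 1 + (if p i = None then 1 else 0))"
      by (rule sum.cong[OF refl])
    then have "sum e SO + sum f SO + (\<Sum>i\<in>SO. dg (p i)) = sum dg SO + card SO + 1"
      unfolding sum.distrib none1 by simp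
    moreover have "(\<Sum>i\<in>SO. dg (p i)) = sum dg SO"
      using sum.permute[OF p(1), of dg] by (simp add: comp_def)
    \<comment> \<open>The degrees \<open>dg\<close> cancel because \<open>p\<close> permutes
      \<open>SO\<close>; there remain one for each of the \<open>?s + 1\<close> rows and one for
      column \<open>None\<close>.\<close>
    ultimately have tot: "sum e SO + sum f SO = ?s + 2" using cS by simp
    \<comment> \<open>Factors I come from fixed indices and from column \<open>None\<close>. As
      \<open>p\<close> moves some index, there are at most \<open>?s + 1\<close> of them, which is
      less than the total \<open>?s + 2\<close>; so J occurs.\<close>
    have "sum f SO = card {i \<in> SO. p i = i} + 1"
      unfolding f_def sum.distrib none1 using fS(1) by (simp add: sum.If_cases Int_def)
    moreover have "card {i \<in> SO. p i = i} < card SO"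
    proof -
      obtain i where i: "p i \<noteq> i" using p(2) by (auto simp: fun_eq_iff)
      then have iS: "i \<in> SO" using p(1) permutes_not_in by metis
      have "card {i \<in> SO. p i = i} \<le> card (SO - {i})" using i fS(1) by (intro card_mono) auto
      also have "\<dots> < card SO" by (rule card_Diff1_less[OF fS(1) iS])
      finally show ?thesis .
    qed
    ultimately have "sum e SO \<ge> 1" using tot cS by linarith
    then obtain e' where e': "sum e SO = Suc e'" by (cases "sum e SO") auto
    have "?P (sum e SO) (sum f SO) = J \<cdot> (?p J e' \<cdot> ?p I (sum f SO))"
      unfolding e' ipow_Suc[OF J] by (intro ideal_prod_assoc id)
    also have "\<dots> \<subseteq> J \<cdot> (?p I e' \<cdot> ?p I (sum f SO))"
      by (intro ideal_prod_mono subset_refl ipow_mono I J JI)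
    also have "?p I e' \<cdot> ?p I (sum f SO) = ?p I (?s + 1)"
      using ipow_add[OF I, of e' "sum f SO"] tot e' by simp
    finally have "K \<cdot> ?P (sum e SO) (sum f SO) \<subseteq> ?Q" by (rule ideal_prod_mono[OF subset_refl])
    then show ?thesis using mP by blast
  qed
  have diag: "(\<Otimes>i\<in>SO. E i i) \<in> ?Q"
    by (rule det_kernel_ideal[OF fS Ec yo_closed _ ker iQ offdiag]) (simp_all add: yo_def)
  \<comment> \<open>The diagonal entries are q - c and z_j - b_j with c in K I J and b_j in J.
    Expanding the diagonal product, all terms with c or some b_j fall into
    \<open>?Q\<close>.\<close>
  define b where "b j = B (Some j) (Some j)" for j
  have bJ: "b \<in> S \<rightarrow> J"
  proof
    fix j assume "j \<in> S"
    then have "b j \<in> gen_coeff (Suc (d j)) j" using B[of "Some j" "Some j"] by (simp add: b_def WO_def dg_def)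
    then show "b j \<in> J" using ipow_1[OF J] by (simp add: gen_coeff_def)
  qed
  let ?z = "\<Otimes>j\<in>S. z j" and ?zb = "\<Otimes>j\<in>S. z j \<ominus> b j" and ?c = "B None None"
  have cc: "?c \<in> (K \<cdot> I) \<cdot> J" using B[OF fS(2,2)] ipow_1[OF J] by (simp add: WO_def dg_def kbase_def)
  have zbI: "z j \<ominus> b j \<in> I" if "j \<in> S" for j using that z bJ JI ideal_minus[OF I] by blast
  have pz: "?zb \<in> ?p I ?s"
    using prod_mem_ipow[OF I S, of "\<lambda>j. z j \<ominus> b j" "\<lambda>_. 1"] zbI ipow_1[OF I] by simp
  have carr: "q \<in> carrier R" "?c \<in> carrier R" "?z \<in> carrier R" "?zb \<in> carrier R"
    using ideal_carr[OF KII q] Bc[OF fS(2,2)] ideal_carr[OF id(1) pz] z ideal_carr[OF I]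
    by (auto intro!: finprod_closed)
  have "(\<Otimes>i\<in>SO. E i i) = E None None \<otimes> (\<Otimes>i\<in>Some ` S. E i i)"
    using S Ec by (intro finprod_insert) auto
  also have "(\<Otimes>i\<in>Some ` S. E i i) = (\<Otimes>j\<in>S. E (Some j) (Some j))"
    using Ec by (intro finprod_reindex) auto
  also have "\<dots> = ?zb"
    using zbI ideal_carr[OF I] by (intro finprod_cong') (auto simp: E_def D_def b_def)
  also have "E None None = q \<ominus> ?c" by (simp add: E_def D_def)
  finally have dq: "(q \<ominus> ?c) \<otimes> ?zb \<in> ?Q" using diag by simp
  have "?c \<otimes> ?zb \<in> ((K \<cdot> I) \<cdot> J) \<cdot> ?p I ?s" using cc pz by (rule ideal_prod_mem)
  also have "\<dots> = ?Q" unfolding Suc_eq_plus1[symmetric] ipow_Suc[OF I] by (simp only: ideal_prod_ac id)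
  finally have cq: "?c \<otimes> ?zb \<in> ?Q" .
  have rq: "q \<otimes> (?z \<ominus> ?zb) \<in> ?Q"
  proof (cases "?s")
    case 0
    have "?z \<ominus> ?zb = \<zero>" using prod_minus_mem[OF I J JI S z bJ] 0 by (simp add: red_filt_def)
    then have "q \<otimes> (?z \<ominus> ?zb) = \<zero>" by (simp only: r_null carr)
    then show ?thesis using ideal_zero[OF iQ] by (simp only:)
  next
    case (Suc m)
    have "?z \<ominus> ?zb \<in> J \<cdot> ?p I m" using prod_minus_mem[OF I J JI S z bJ] Suc by (simp add: red_filt_def)
    then have "q \<otimes> (?z \<ominus> ?zb) \<in> ((K \<cdot> I) \<cdot> I) \<cdot> (J \<cdot> ?p I m)" by (rule ideal_prod_mem[OF q])
    also have "\<dots> = ?Q" unfolding Suc Suc_eq_plus1[symmetric] ipow_Suc[OF I] by (simp only: ideal_prod_ac id)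
    finally show ?thesis .
  qed
  have "q \<otimes> ?z = q \<otimes> (?z \<ominus> ?zb) \<oplus> ((q \<ominus> ?c) \<otimes> ?zb \<oplus> ?c \<otimes> ?zb)"
  proof -
    have "a \<otimes> x = a \<otimes> (x \<ominus> w) \<oplus> ((a \<ominus> c) \<otimes> w \<oplus> c \<otimes> w)"
      if "a \<in> carrier R" "c \<in> carrier R" "x \<in> carrier R" "w \<in> carrier R" for a c x w
      using that by algebra
    then show ?thesis using carr by blast
  qed
  then show ?thesis using ideal_add[OF iQ rq ideal_add[OF iQ dq cq]] by simp
qed

text \<open>The exponent \<open>card S + 2\<close> consists of one factor I for every generator and
  two for the index \<open>None\<close>, whose multiplier runs through K I I.\<close>

theorem determinant_trick: "K \<cdot> ipow I (card S + 2) = K \<cdot> J \<cdot> ipow I (card S + 1)"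
proof
  let ?p = "ipow I"
  note id = ipow_ideal[OF I] ideal_prod_is_ideal I J K
  have "((K \<cdot> I) \<cdot> I) \<cdot> ?p (card S) \<subseteq> K \<cdot> (J \<cdot> ?p (card S + 1))"
    by (intro ideal_prod_power_le[OF _ I S] determinant_trick_product) (intro id | assumption)+
  moreover have "((K \<cdot> I) \<cdot> I) \<cdot> ?p (card S) = K \<cdot> ?p (card S + 2)"
    using ipow_Suc[OF I, of "Suc (card S)"] ipow_Suc[OF I, of "card S"]
    by (simp only: add_2_eq_Suc' ideal_prod_ac id)
  ultimately show "K \<cdot> ?p (card S + 2) \<subseteq> K \<cdot> J \<cdot> ?p (card S + 1)"
    by (simp only: ideal_prod_assoc id)
  have "K \<cdot> J \<cdot> ?p (card S + 1) = K \<cdot> (J \<cdot> ?p (card S + 1))" by (intro ideal_prod_assoc id)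
  also have "\<dots> \<subseteq> K \<cdot> (I \<cdot> ?p (card S + 1))" by (intro ideal_prod_mono subset_refl JI)
  also have "\<dots> = K \<cdot> ?p (card S + 2)" using ipow_Suc[OF I, of "card S + 1"] by simp
  finally show "K \<cdot> J \<cdot> ?p (card S + 1) \<subseteq> K \<cdot> ?p (card S + 2)" .
qed

end

end

end

section \<open>Hilbert functions\<close>

lemma cubic_not_le_quadratic:
  fixes a b c :: int
  assumes "\<And>n. n \<ge> n0 \<Longrightarrow> int n ^ 3 \<le> a * int n ^ 2 + b * int n + c"
  shows False
proof -
  \<comment> \<open>Beyond \<open>n0\<close>, and larger than the sum of the absolute values of the
    coefficients, while all lower powers of \<open>?m\<close> are at most
    \<open>?m ^ 2\<close>.\<close>
  define m where "m = n0 + nat (\<bar>a\<bar> + \<bar>b\<bar> + \<bar>c\<bar>) + 1"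
  let ?m = "int m"
  have m: "?m \<ge> 1" "?m > \<bar>a\<bar> + \<bar>b\<bar> + \<bar>c\<bar>" by (simp_all add: m_def)
  have m2: "1 \<le> ?m ^ 2" "?m \<le> ?m ^ 2" using m(1) by (auto intro: one_le_power self_le_power)
  have "a * ?m ^ 2 \<le> \<bar>a\<bar> * ?m ^ 2" by (intro mult_right_mono) auto
  moreover have "b * ?m \<le> \<bar>b\<bar> * ?m ^ 2"
    using m2 m(1) by (meson abs_ge_self abs_ge_zero mult_mono order_trans zero_le_power2 of_nat_0_le_iff)
  moreover have "c \<le> \<bar>c\<bar> * ?m ^ 2"
    using m2 mult_left_mono[of 1 "?m ^ 2" "\<bar>c\<bar>"] by linarith
  ultimately have "a * ?m ^ 2 + b * ?m + c \<le> (\<bar>a\<bar> + \<bar>b\<bar> + \<bar>c\<bar>) * ?m ^ 2"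
    by (simp add: distrib_right)
  also have "\<dots> < ?m * ?m ^ 2" using m m2 by (intro mult_strict_right_mono) auto
  also have "\<dots> = ?m ^ 3" by (simp add: power3_eq_cube power2_eq_square)
  finally show False using assms[of m] by (simp add: m_def)
qed

lemma quadratic_le_linear:
  fixes a b c :: int
  assumes "\<And>n. n \<ge> n0 \<Longrightarrow> a * int n ^ 2 \<le> b * int n + c"
  shows "a \<le> 0"
proof (rule ccontr)
  assume "\<not> a \<le> 0"
  then have a: "a \<ge> 1" by simp
  show False
  \<comment> \<open>Multiplying the assumed inequality by \<open>int n\<close> reduces the claim to
    the cubic case.\<close>
  proof (rule cubic_not_le_quadratic)
    fix n assume "n \<ge> n0"
    have "int n ^ 3 \<le> a * int n ^ 3" using a mult_right_mono[of 1 a "int n ^ 3"] by simp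
    moreover have "a * int n ^ 3 = int n * (a * int n ^ 2)" by (simp add: power3_eq_cube power2_eq_square)
    moreover have "int n * (a * int n ^ 2) \<le> int n * (b * int n + c)"
      using assms[OF \<open>n \<ge> n0\<close>] by (intro mult_left_mono) auto
    moreover have "int n * (b * int n + c) = b * int n ^ 2 + c * int n + 0"
      by (simp add: power2_eq_square algebra_simps)
    ultimately show "int n ^ 3 \<le> b * int n ^ 2 + c * int n + 0" by linarith
  qed
qed

context cring begin

lemma ipow_mult: "ideal A R \<Longrightarrow> ipow (ipow A m) n = ipow A (m * n)"
proof -
  interpret S: comm_monoid "ideals_set R" by (rule ideals_set_is_comm_monoid)
  assume "ideal A R"
  then show ?thesis using S.nat_pow_pow[of A m n] by (simp add: ideals_set_def)
qed

lemma power_le_sum: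
  assumes A: "ideal A R" and J: "ideal J R" and Q: "ideal Q R" and le: "A \<subseteq> ladd \<one> J Q"
  shows "ipow A p \<subseteq> ladd \<one> (ipow J p) Q"
proof (induction p)
  case 0
  show ?case unfolding ipow_0 using ladd_meml[OF one_closed oneideal Q] by fastforce
next
  case (Suc p)
  let ?L = "ladd \<one> (ipow J (Suc p)) Q"
  have iL: "ideal ?L R" by (intro ladd_ideal one_closed ipow_ideal J Q)
  show ?case unfolding ipow_Suc[OF A]
  proof (rule ideal_prod_le[OF iL])
    fix a b assume a: "a \<in> A" and b: "b \<in> ipow A p"
    obtain j q where 1: "j \<in> J" "q \<in> Q" "a = \<one> \<otimes> j \<oplus> q" using subsetD[OF le a] by (auto elim: laddE)
    obtain i r where 2: "i \<in> ipow J p" "r \<in> Q" "b = \<one> \<otimes> i \<oplus> r" using subsetD[OF Suc b] by (auto elim: laddE)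
    have c: "j \<in> carrier R" "q \<in> carrier R" "i \<in> carrier R" "r \<in> carrier R"
      using 1 2 ideal_carr[OF J] ideal_carr[OF Q] ideal_carr[OF ipow_ideal[OF J]] by blast+
    have "a \<otimes> b = \<one> \<otimes> (j \<otimes> i) \<oplus> (j \<otimes> r \<oplus> q \<otimes> (i \<oplus> r))"
      unfolding 1 2 using c by algebra
    moreover have "j \<otimes> i \<in> ipow J (Suc p)"
      unfolding ipow_Suc[OF J] using 1 2 by (intro ideal_prod_mem)
    moreover have "j \<otimes> r \<oplus> q \<otimes> (i \<oplus> r) \<in> Q"
      using 1 2 c by (intro ideal_add[OF Q] ideal_l[OF Q] ideal_r[OF Q]) auto
    ultimately show "a \<otimes> b \<in> ?L" using laddI[of "j \<otimes> i" _ _ Q \<one>] by simp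
  qed
qed

text \<open>Adjoining s to J': the n-th power of the larger ideal lies in (s^n) + J', hence in J' +
  Q, and the p-th power of J' + Q lies in J'^p + Q, hence in Q.\<close>

lemma fg_radical_power_le:
  assumes "finite S" "S \<subseteq> carrier R" and Q: "ideal Q R"
    and "\<And>s. s \<in> S \<Longrightarrow> \<exists>n::nat. s [^] n \<in> Q"
  shows "\<exists>p. ipow (Idl S) p \<subseteq> Q" using assms(1,2,4)
proof (induction S rule: finite_induct)
  case empty
  have "Idl {} \<subseteq> Q" by (intro genideal_minimal Q) auto
  then show ?case using ipow_1[OF genideal_ideal, of "{}"] by (intro exI[of _ "Suc 0"]) simp
next
  case (insert s S)
  obtain p where p: "ipow (Idl S) p \<subseteq> Q" using insert by auto
  obtain n where n: "s [^] (n::nat) \<in> Q" using insert.prems by blast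
  let ?J = "Idl (insert s S)" and ?J' = "Idl S"
  have s: "s \<in> carrier R" and Sc: "S \<subseteq> carrier R" using insert.prems by auto
  have J: "ideal ?J R" "ideal ?J' R" using s Sc by (auto intro: genideal_ideal)
  have JJ: "?J' \<subseteq> ?J" using genideal_self[of "insert s S"] s Sc by (intro genideal_minimal J) auto
  have iL: "ideal (ladd s (carrier R) ?J') R" by (intro ladd_ideal s oneideal J)
  have "?J \<subseteq> ladd s (carrier R) ?J'"
  proof (rule genideal_minimal[OF iL])
    have "s \<in> ladd s (carrier R) ?J'" using ladd_meml[OF s oneideal J(2) one_closed] s by simp
    then show "insert s S \<subseteq> ladd s (carrier R) ?J'"
      using genideal_self[OF Sc] ladd_memr[OF s oneideal J(2)] by blast
  qed
  from power_le_red_filt[OF J(1,2) JJ s this, of n]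
  have le: "ipow ?J n \<subseteq> ladd (s [^] n) (carrier R) (red_filt ?J' ?J n)" .
  have iJQ: "ideal (ladd \<one> ?J' Q) R" by (intro ladd_ideal one_closed J Q)
  have QL: "Q \<subseteq> ladd \<one> ?J' Q" and JL: "?J' \<subseteq> ladd \<one> ?J' Q"
    using ladd_memr[OF one_closed J(2) Q] ladd_meml[OF one_closed J(2) Q] ideal_carr[OF J(2)] by fastforce+
  have "red_filt ?J' ?J n \<subseteq> ?J'"
    using ideal_prod_sub(1)[OF J(2) ipow_ideal[OF J(1)]] ideal_zero[OF J(2)] by (auto simp: red_filt_def)
  then have "ipow ?J n \<subseteq> ladd \<one> ?J' Q"
    using JL QL n by (intro order_trans[OF le] ladd_least[OF iJQ] ideal_r[OF iJQ]) auto
  from power_le_sum[OF ipow_ideal[OF J(1)] J(2) Q this, of p]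
  have "ipow ?J (n * p) \<subseteq> ladd \<one> (ipow ?J' p) Q" unfolding ipow_mult[OF J(1)] .
  also have "\<dots> \<subseteq> Q" using p ideal_carr[OF Q] by (intro ladd_least[OF Q]) auto
  finally show ?case by blast
qed

text \<open>J^(n+1) is generated by y^(n+1) over \<open>?C\<close>, the ideal x J^n + J^(n+2). The
  upper layer is cyclic and killed by J; the lower one is the image of J^n under multiplication by
  x, which sends J^(n+1) to zero.\<close>

lemma len_dbl_power_step:
  assumes xy: "x \<in> carrier R" "y \<in> carrier R" and J: "J = dbl x y (carrier R)"
    and fin: "\<And>n. ilen (carrier R) (ipow J n) \<noteq> \<infinity>"
  shows "len (ipow J (Suc n)) (ipow J (Suc (Suc n)))
    \<le> len (ipow J n) (ipow J (Suc n)) + len (carrier R) J"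
proof -
  let ?p = "ipow J"
  have iJ: "ideal J R" unfolding J by (intro dbl_ideal xy oneideal)
  note ip = ipow_ideal[OF iJ]
  have xJ: "x \<in> J" "y \<in> J" using dbl_carrier[OF xy] J by auto
  let ?J' = "ladd x (carrier R) {\<zero>}"
  have iJ': "ideal ?J' R" by (intro ladd_ideal xy oneideal zeroideal)
  have xJ': "x \<in> ?J'" using ladd_meml[OF xy(1) oneideal zeroideal one_closed] xy by simp
  have JJ: "?J' \<subseteq> J" using xJ ideal_zero[OF iJ] by (intro ladd_least[OF iJ] ideal_r[OF iJ]) auto
  have iL: "ideal (ladd y (carrier R) ?J') R" by (intro ladd_ideal xy oneideal iJ')
  have JL: "J \<subseteq> ladd y (carrier R) ?J'"
    unfolding J using ladd_meml[OF xy(2) oneideal iJ' one_closed] xy ladd_memr[OF xy(2) oneideal iJ' xJ']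
    by (intro dbl_least[OF iL]) auto
  let ?C = "ladd x (?p n) (?p (Suc (Suc n)))" and ?y = "y [^] Suc n"
  have yc: "?y \<in> carrier R" using xy by simp
  have iC: "ideal ?C R" by (intro ladd_ideal xy ip)
  have CC: "?p (Suc (Suc n)) \<subseteq> ?C" using ladd_memr[OF xy(1) ip ip] by blast
  have mC: "?C \<subseteq> ?p (Suc n)" using ipow_antimono[OF iJ, of "Suc n" "Suc (Suc n)"]
      ideal_prod_mem[OF xJ(1), of _ "?p n"] ipow_Suc[OF iJ, of n] by (intro ladd_least[OF ip]) auto
  have eq: "?p (Suc n) = ladd ?y (carrier R) ?C"
  proof
    have "?J' \<cdot> ?p n \<subseteq> ?C"
    proof (rule ideal_prod_le[OF iC])
      fix a b assume a: "a \<in> ?J'" and b: "b \<in> ?p n"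
      then obtain r where r: "r \<in> carrier R" "a = x \<otimes> r" using xy by (auto elim: laddE)
      have bc: "b \<in> carrier R" using b ideal_carr[OF ip] by blast
      have eq: "a \<otimes> b = x \<otimes> (r \<otimes> b)" using r bc xy by (simp add: m_assoc)
      show "a \<otimes> b \<in> ?C" unfolding eq by (rule ladd_meml[OF xy(1) ip ip ideal_l[OF ip b r(1)]])
    qed
    then have "red_filt ?J' J (Suc n) \<subseteq> ?C" by (simp add: red_filt_def)
    then show "?p (Suc n) \<subseteq> ladd ?y (carrier R) ?C"
      using power_le_red_filt[OF iJ iJ' JJ xy(2) JL, of "Suc n"] ladd_mono[OF subset_refl] by (meson subset_trans)
    show "ladd ?y (carrier R) ?C \<subseteq> ?p (Suc n)"
      by (intro ladd_least[OF ip mC] ideal_r[OF ip] pow_mem_ipow[OF iJ xJ(2)])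
  qed
  have "len (?p (Suc n)) (?p (Suc (Suc n))) = len (?p (Suc n)) ?C + len ?C (?p (Suc (Suc n)))"
    by (intro len_add ip iC CC mC fin)
  also have "len (?p (Suc n)) ?C = len (carrier R) (carrier R \<inter> colon ?C {?y})"
    unfolding eq by (rule len_ladd[OF yc oneideal iC])
  also have "\<dots> \<le> len (carrier R) J"
  proof (rule len_mono)
    show "J \<subseteq> carrier R \<inter> colon ?C {?y}"
      using ideal_prod_mem[OF _ pow_mem_ipow[OF iJ xJ(2)], of _ J "Suc n"] CC
        ipow_Suc[OF iJ, of "Suc n"] ideal_carr[OF iJ] by (auto simp: colon_def)
    show "ilen (carrier R) J \<noteq> \<infinity>" using fin[of 1] ipow_1[OF iJ] by simp
  qed auto
  also have "len ?C (?p (Suc (Suc n))) = len (?p n) (?p n \<inter> colon (?p (Suc (Suc n))) {x})"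
    by (rule len_ladd[OF xy(1) ip ip])
  also have "\<dots> \<le> len (?p n) (?p (Suc n))"
  proof (rule len_mono)
    show "?p (Suc n) \<subseteq> ?p n \<inter> colon (?p (Suc (Suc n))) {x}"
    proof
      fix v assume v: "v \<in> ?p (Suc n)"
      have vc: "v \<in> carrier R" using v ideal_carr[OF ip] by blast
      have "x \<otimes> v \<in> ?p (Suc (Suc n))" unfolding ipow_Suc[OF iJ, of "Suc n"] by (rule ideal_prod_mem[OF xJ(1) v])
      then show "v \<in> ?p n \<inter> colon (?p (Suc (Suc n))) {x}"
        using v vc xy ipow_antimono[OF iJ, of n "Suc n"] by (auto simp: colon_def m_comm)
    qed
    show "?p n \<subseteq> carrier R" by (rule ideal_sub[OF ip])
  qed (rule subset_refl fin)+
  finally show ?thesis by simp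
qed

text \<open>The increments of the layers add up to a triangular number. The resulting bound on R/J^n
  is what limits g_0 from above later.\<close>

lemma len_dbl_power:
  assumes xy: "x \<in> carrier R" "y \<in> carrier R" and J: "J = dbl x y (carrier R)"
    and fin: "\<And>n. ilen (carrier R) (ipow J n) \<noteq> \<infinity>"
  shows "2 * len (carrier R) (ipow J n) \<le> len (carrier R) J * (n * (n + 1))"
proof -
  let ?p = "ipow J"
  have iJ: "ideal J R" unfolding J by (intro dbl_ideal xy oneideal)
  note ip = ipow_ideal[OF iJ]
  have st: "len (?p n) (?p (Suc n)) \<le> len (carrier R) J * (n + 1)" for n
  proof (induction n)
    case 0
    then show ?case using ipow_1[OF iJ] by (simp add: ideals_set_one)
  next
    case (Suc n)
    then show ?case using len_dbl_power_step[OF xy J fin, of n] by (simp del: nat_pow_Suc add: algebra_simps)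
  qed
  show ?thesis
  proof (induction n)
    case 0
    then show ?case by (simp add: ideals_set_one len_self)
  next
    case (Suc n)
    have "len (carrier R) (?p (Suc n)) = len (carrier R) (?p n) + len (?p n) (?p (Suc n))"
      by (intro len_add oneideal ip ipow_antimono iJ ideal_sub[OF ip] fin) simp
    then show ?case using Suc st[of n] by (simp del: nat_pow_Suc add: algebra_simps)
  qed
qed

lemma reduction_power:
  assumes I: "ideal I R" and J: "ideal J R" and c: "J \<cdot> ipow I c = ipow I (c + 1)"
  shows "ipow I (c + n) = ipow J n \<cdot> ipow I c"
proof (induction n)
  case 0
  have "ipow J 0 \<cdot> ipow I c = ipow I c \<cdot> carrier R"
    unfolding ipow_0 by (intro ideal_prod_commute oneideal ipow_ideal I)
  then show ?case using ideal_prod_one[OF ipow_ideal[OF I]] by simp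
next
  case (Suc n)
  note id = ipow_ideal[OF I] ipow_ideal[OF J] I J ideal_prod_is_ideal
  have "ipow I (c + Suc n) = I \<cdot> (ipow J n \<cdot> ipow I c)"
    using Suc ipow_Suc[OF I, of "c + n"] by simp
  also have "\<dots> = ipow J n \<cdot> (I \<cdot> ipow I c)" by (intro ideal_prod_lcomm id)
  also have "I \<cdot> ipow I c = J \<cdot> ipow I c" using c ipow_Suc[OF I, of c] by simp
  also have "ipow J n \<cdot> (J \<cdot> ipow I c) = ipow J (Suc n) \<cdot> ipow I c"
    unfolding ipow_Suc[OF J] by (simp only: ideal_prod_ac id)
  finally show ?case .
qed

lemma reduction_trans:
  assumes I: "ideal I R" and "reduction R J' J" "reduction R J I"
  shows "reduction R J' I"
proof -
  obtain n c where J: "ideal J R" "J \<subseteq> I" "J \<cdot> ipow I c = ipow I (c + 1)"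
    and J': "ideal J' R" "J' \<subseteq> J" "J' \<cdot> ipow J n = ipow J (n + 1)"
    using assms by (auto simp: reduction_def)
  note id = ipow_ideal[OF I] ipow_ideal[OF J(1)] I J J' ideal_prod_is_ideal
  have "J' \<cdot> ipow I (c + n) = (J' \<cdot> ipow J n) \<cdot> ipow I c"
    unfolding reduction_power[OF I J(1,3)] by (intro ideal_prod_assoc[symmetric] id)
  also have "\<dots> = ipow I (c + n + 1)"
    unfolding J' using reduction_power[OF I J(1,3), of "n + 1"] by simp
  finally show ?thesis unfolding reduction_def using J J' by blast
qed

end

lemma two_choose_two: "2 * int ((m + 1) choose 2) = int m * (int m + 1)"
  by (induction m) (simp_all add: numeral_2_eq_2 algebra_simps)

context noetherian_local_ring begin

text \<open>\<mm> is finitely generated and each generator has a power in \<open>I\<close>; so a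
  power of \<mm> lies in \<open>Q\<close>, and R modulo a power of \<mm> has finite length.\<close>

lemma primary_power_finite:
  assumes I: "ideal I R" and rad: "ideal_radical R I = \<mm>" and Q: "ipow I n \<subseteq> Q" and A: "A \<subseteq> carrier R"
  shows "ilen A Q \<noteq> \<infinity>"
proof -
  obtain S where S: "S \<subseteq> carrier R" "finite S" "\<mm> = Idl S" using finetely_gen[OF max_ideal] by blast
  have "\<exists>k::nat. s [^] k \<in> I" if "s \<in> S" for s
    using that genideal_self[OF S(1)] S(3) rad by (auto simp: ideal_radical_def)
  then obtain p where "ipow \<mm> p \<subseteq> I" using fg_radical_power_le[OF S(2,1) I] S(3) by auto
  then have le: "ipow \<mm> (p * n) \<subseteq> ipow I n"
    unfolding ipow_mult[OF max_ideal, symmetric] by (intro ipow_mono ipow_ideal max_ideal I)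
  show ?thesis by (rule ilen_finite_mono[OF ilen_max_power A subset_trans[OF le Q]])
qed

text \<open>A least generating set cannot have three elements: \<open>smaller_reduction\<close>
  would give a reduction of J, hence of I, inside J with fewer generators, and minimality identifies
  it with J. The Hilbert polynomial enters through its degree.\<close>

lemma minimal_reduction_two_generated:
  assumes inf: "infinite (carrier (R Quot \<mm>))" and I: "ideal I R" and rad: "ideal_radical R I = \<mm>"
    and K: "ideal K R" "I \<subseteq> K" and J: "minimal_reduction R J I" and g: "fiber_hilbert_coeffs R K I g\<^sub>0 g\<^sub>1 g\<^sub>2"
  shows "\<exists>x\<in>carrier R. \<exists>y\<in>carrier R. J = dbl x y (carrier R)"
proof -
  let ?p = "ipow"
  obtain c where iJ: "ideal J R" and JI: "J \<subseteq> I" and c: "J \<cdot> ?p I c = ?p I (c + 1)"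
    using J by (auto simp: minimal_reduction_def reduction_def)
  note id = ipow_ideal[OF I] ipow_ideal[OF iJ] iJ I K(1) ideal_prod_is_ideal
  have Im: "I \<subseteq> \<mm>" 
  proof
    fix a assume a: "a \<in> I"
    then have "a \<in> carrier R" "a [^] (1::nat) \<in> I" using ideal_carr[OF I a] by simp_all
    then show "a \<in> \<mm>" unfolding rad[symmetric] ideal_radical_def by blast
  qed
  have powle: "?p I (c + n) \<subseteq> ?p J n" for n
    unfolding reduction_power[OF I iJ c] by (intro ideal_prod_sub id)
  have fin: "ilen A (?p J n) \<noteq> \<infinity>" if "A \<subseteq> carrier R" for A n
    using primary_power_finite[OF I rad powle that] .
  obtain n0 where n0: "\<And>n. n \<ge> n0 \<Longrightarrow> int (quot_length R (carrier R) (K \<cdot> ?p I n))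
      = g\<^sub>0 * int ((n + 1) choose 2) - g\<^sub>1 * int n + g\<^sub>2"
    using g unfolding fiber_hilbert_coeffs_def eventually_sequentially by blast
  \<comment> \<open>Otherwise the numbers of generators of the J^N, being at least quadratic in N,
    would add up to a cubic lower bound for R/J^n, while the inclusion of K I^(n+c) in J^n gives a
    quadratic upper bound.\<close>
  have growth: "\<exists>N\<ge>1. ilen (?p J N) (\<mm> \<cdot> ?p J N) < enat ((N div 2 + 1)^2)"
  proof (rule ccontr)
    assume no: "\<not> ?thesis"
    have st: "(N div 2 + 1)^2 \<le> len (?p J N) (?p J (Suc N))" if "N \<ge> 1" for N
    proof -
      have "enat ((N div 2 + 1)^2) \<le> ilen (?p J N) (\<mm> \<cdot> ?p J N)" using no that by (meson not_le)
      also have "\<dots> \<le> ilen (?p J N) (?p J (Suc N))"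
        unfolding ipow_Suc[OF iJ] using JI Im by (intro ilen_mono subset_refl ideal_prod_mono) auto
      finally have le: "enat ((N div 2 + 1)^2) \<le> ilen (?p J N) (?p J (Suc N))" .
      have "ilen (?p J N) (?p J (Suc N)) \<noteq> \<infinity>" by (rule fin[OF ideal_sub[OF id(2)]])
      then obtain m where m: "ilen (?p J N) (?p J (Suc N)) = enat m" by (cases rule: enat.exhaust) blast+
      show ?thesis using le unfolding len_def m by simp
    qed
    \<comment> \<open>The constant 12 is 3 times 4: the cube grows by at most 3 (n+1)^2, and (n+1)^2
      is at most four times the bound in \<open>st\<close>. The summand 1 covers the step from 0 to
      1, outside the range of \<open>st\<close>.\<close>
    have low: "int n ^ 3 \<le> 12 * int (len (carrier R) (?p J n)) + 1" for n
    proof (induction n)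
      case (Suc n)
      show ?case
      proof (cases "n = 0")
        case False
        have "len (carrier R) (?p J (Suc n)) = len (carrier R) (?p J n) + len (?p J n) (?p J (Suc n))"
          by (intro len_add oneideal id ipow_antimono ideal_sub[OF id(2)] fin) auto
        moreover have "(n + 1)^2 \<le> 4 * (n div 2 + 1)^2"
        proof -
          have "n + 1 \<le> 2 * (n div 2 + 1)" by presburger
          then have "(n + 1)^2 \<le> (2 * (n div 2 + 1))^2" by (rule power_mono) simp
          then show ?thesis unfolding power_mult_distrib by simp
        qed
        ultimately have "len (carrier R) (?p J n) * 4 + (n + 1)^2 \<le> 4 * len (carrier R) (?p J (Suc n))"
          using st[of n] False by linarith
        then have "int (len (carrier R) (?p J n) * 4 + (n + 1)^2) \<le> int (4 * len (carrier R) (?p J (Suc n)))"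
          by (rule zle_int[THEN iffD2])
        then have "4 * int (len (carrier R) (?p J n)) + (int n + 1)^2 \<le> 4 * int (len (carrier R) (?p J (Suc n)))"
          by (simp del: nat_pow_Suc add: algebra_simps)
        moreover have "int (Suc n) ^ 3 \<le> int n ^ 3 + 3 * (int n + 1)^2"
          by (simp add: power3_eq_cube power2_eq_square algebra_simps)
        ultimately show ?thesis using Suc by linarith
      qed (simp del: nat_pow_Suc)
    qed simp
    show False
    proof (rule cubic_not_le_quadratic)
      fix n assume n: "n \<ge> n0"
      have "K \<cdot> ?p I (n + c) \<subseteq> ?p J n"
        using subset_trans[OF ideal_prod_sub(2)[OF K(1) id(1)] powle[of n]] by (simp add: add.commute)
      moreover have KI: "ideal (K \<cdot> ?p I (n + c)) R" by (intro id)
      moreover have "ilen (carrier R) (K \<cdot> ?p I (n + c)) \<noteq> \<infinity>"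
        using ideal_prod_mono[OF K(2) subset_refl] ipow_Suc[OF I, of "n + c"]
        by (intro primary_power_finite[OF I rad, of "Suc (n + c)"]) auto
      ultimately have "len (carrier R) (?p J n) \<le> len (carrier R) (K \<cdot> ?p I (n + c))"
        by (intro len_mono) auto
      also have "len (carrier R) (K \<cdot> ?p I (n + c)) = quot_length R (carrier R) (K \<cdot> ?p I (n + c))"
        using quot_length_eq[OF oneideal KI ideal_sub[OF KI]] by (simp add: len_def)
      finally have le: "int (len (carrier R) (?p J n)) \<le> g\<^sub>0 * int ((n + c + 1) choose 2) - g\<^sub>1 * int (n + c) + g\<^sub>2"
        using n0[of "n + c"] n by simp
      have "2 * int ((n + c + 1) choose 2) = (int n + int c) * (int n + int c + 1)"
        using two_choose_two[of "n + c"] by simp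
      then have "12 * (g\<^sub>0 * int ((n + c + 1) choose 2) - g\<^sub>1 * int (n + c) + g\<^sub>2) + 1
        = 6 * g\<^sub>0 * ((int n + int c) * (int n + int c + 1)) - 12 * g\<^sub>1 * (int n + int c) + 12 * g\<^sub>2 + 1"
        by simp
      also have "\<dots> = 6 * g\<^sub>0 * int n ^ 2 + (6 * g\<^sub>0 * (2 * int c + 1) - 12 * g\<^sub>1) * int n
          + (6 * g\<^sub>0 * (int c * (int c + 1)) - 12 * g\<^sub>1 * int c + 12 * g\<^sub>2 + 1)"
        by (simp add: power2_eq_square algebra_simps)
      finally have eq: "12 * (g\<^sub>0 * int ((n + c + 1) choose 2) - g\<^sub>1 * int (n + c) + g\<^sub>2) + 1
        = 6 * g\<^sub>0 * int n ^ 2 + (6 * g\<^sub>0 * (2 * int c + 1) - 12 * g\<^sub>1) * int n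
          + (6 * g\<^sub>0 * (int c * (int c + 1)) - 12 * g\<^sub>1 * int c + 12 * g\<^sub>2 + 1)" .
      have mono: "u \<le> q" if "u \<le> 12 * v + 1" "v \<le> p" "12 * p + 1 = q" for u v p q :: int
        using that by linarith
      show "int n ^ 3 \<le> 6 * g\<^sub>0 * int n ^ 2 + (6 * g\<^sub>0 * (2 * int c + 1) - 12 * g\<^sub>1) * int n
          + (6 * g\<^sub>0 * (int c * (int c + 1)) - 12 * g\<^sub>1 * int c + 12 * g\<^sub>2 + 1)"
        by (rule mono[OF low le eq])
    qed
  qed
  then obtain N where N: "N \<ge> 1" "ilen (?p J N) (\<mm> \<cdot> ?p J N) < enat ((N div 2 + 1)^2)" by blast
  let ?G = "\<lambda>n. \<exists>G. finite G \<and> G \<subseteq> carrier R \<and> card G = n \<and> J = Idl G"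
  have ex: "\<exists>n. ?G n" using finetely_gen[OF iJ] by blast
  define n where "n = (LEAST n. ?G n)"
  obtain G where G: "finite G" "G \<subseteq> carrier R" "card G = n" "J = Idl G"
    using LeastI_ex[OF ex] unfolding n_def by blast
  have "n < 3"
  proof (rule ccontr)
    assume "\<not> n < 3"
    then have "card G \<ge> 3" using G by simp
    from smaller_reduction[OF inf G(1,2) this G(4) N] obtain G' where G': "finite G'" "G' \<subseteq> carrier R"
      "card G' < card G" "reduction R (Idl G') J" by blast
    have "reduction R (Idl G') I" "Idl G' \<subseteq> J"
      using reduction_trans[OF I G'(4)] J G'(4) by (auto simp: minimal_reduction_def reduction_def)
    then have "Idl G' = J" using J by (auto simp: minimal_reduction_def)
    then have "?G (card G')" using G' by blast
    then have "n \<le> card G'" unfolding n_def by (rule Least_le)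
    then show False using G' G by simp
  qed
  \<comment> \<open>Padding with \<open>\<zero>\<close> turns at most two generators into a
    pair.\<close>
  have "\<exists>x y. x \<in> carrier R \<and> y \<in> carrier R \<and> insert \<zero> G = insert \<zero> {x, y}"
  proof -
    consider "card G = 0" | "card G = 1" | "card G = 2" using \<open>n < 3\<close> G by linarith
    then show ?thesis
    proof cases
      case 1
      then show ?thesis using G by (intro exI[of _ \<zero>]) auto
    next
      case 2
      then obtain x where "G = {x}" by (auto simp: card_1_singleton_iff)
      then show ?thesis using G by (intro exI[of _ x]) auto
    next
      case 3
      then obtain x y where "G = {x, y}" by (auto simp: card_2_iff)
      then show ?thesis using G by blast
    qed
  qed
  then obtain x y where xy: "x \<in> carrier R" "y \<in> carrier R" "insert \<zero> G = insert \<zero> {x, y}" by blast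
  have iD: "ideal (dbl x y (carrier R)) R" by (intro dbl_ideal xy oneideal)
  have "insert \<zero> G \<subseteq> dbl x y (carrier R)" unfolding xy(3) using dbl_carrier[OF xy(1,2)] ideal_zero[OF iD] by simp
  then have "J \<subseteq> dbl x y (carrier R)" unfolding G(4) by (intro genideal_minimal[OF iD]) auto
  moreover have "insert \<zero> G \<subseteq> J" using genideal_self[OF G(2)] ideal_zero[OF iJ] G(4) by auto
  then have "dbl x y (carrier R) \<subseteq> J" unfolding xy(3) by (intro dbl_least[OF iJ]) auto
  ultimately show ?thesis using xy by blast
qed

end

section \<open>The closure of the filtration K I^n and the count of its generators\<close>

context cring begin

lemma colon_carrier: "ideal A R \<Longrightarrow> colon A (carrier R) = A"
proof
  assume A: "ideal A R"
  show "colon A (carrier R) \<subseteq> A"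
  proof
    fix u assume "u \<in> colon A (carrier R)"
    then have "u \<in> carrier R" "u \<otimes> \<one> \<in> A" unfolding colon_def by blast+
    then show "u \<in> A" by simp
  qed
  show "A \<subseteq> colon A (carrier R)" using ideal_carr[OF A] ideal_r[OF A] by (auto simp: colon_def)
qed

lemma le_colon_iff:
  assumes "ideal A R" "ideal B R" "ideal C R"
  shows "C \<subseteq> colon A B \<longleftrightarrow> C \<cdot> B \<subseteq> A"
proof
  assume "C \<subseteq> colon A B"
  then show "C \<cdot> B \<subseteq> A" by (intro ideal_prod_le[OF assms(1)]) (auto simp: colon_def)
next
  assume "C \<cdot> B \<subseteq> A"
  then show "C \<subseteq> colon A B"
    using ideal_carr[OF assms(3)] ideal_prod_mem by (fastforce simp: colon_def)
qed

lemma colon_colon: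
  assumes A: "ideal A R" and B: "ideal B R" and C: "ideal C R"
  shows "colon (colon A B) C = colon A (C \<cdot> B)"
proof -
  have c: "ideal (colon A B) R" "ideal (colon (colon A B) C) R" "ideal (colon A (C \<cdot> B)) R" "ideal (C \<cdot> B) R"
    using colon_ideal ideal_sub ideal_prod_is_ideal A B C by metis+
  have "D \<subseteq> colon (colon A B) C \<longleftrightarrow> D \<subseteq> colon A (C \<cdot> B)" if D: "ideal D R" for D
    using le_colon_iff[OF c(1) C D] le_colon_iff[OF A B ideal_prod_is_ideal[OF D C]]
      le_colon_iff[OF A c(4) D] ideal_prod_assoc[OF D C B] by simp
  from this[OF c(2)] this[OF c(3)] show ?thesis by blast
qed

lemma ladd_one_sub:
  assumes A: "ideal A R" and B: "ideal B R"
  shows "A \<subseteq> ladd \<one> A B" "B \<subseteq> ladd \<one> A B"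
  using ladd_meml[OF one_closed A B] ladd_memr[OF one_closed A B] ideal_carr[OF A] by fastforce+

text \<open>The witness \<open>r\<close> is the number of generators collected in all degrees; the
  equation bounds the reduction number by \<open>r + 1\<close>.\<close>

lemma fiber_bound:
  assumes s: "syz2 x y" and J: "J = dbl x y (carrier R)" and I: "ideal I R" and K: "ideal K R"
    and JI: "J \<subseteq> I" and IK: "I \<subseteq> K"
    and c: "J \<cdot> ipow I c = ipow I (c + 1)"
    and fin: "\<And>A n. A \<subseteq> carrier R \<Longrightarrow> ilen A (ipow J n) \<noteq> \<infinity>"
    and H: "\<And>n. n \<ge> n0 \<Longrightarrow> int (len (carrier R) (K \<cdot> ipow I n))
      = g\<^sub>0 * int ((n + 1) choose 2) - g\<^sub>1 * int n + g\<^sub>2"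
    and cap: "(K \<cdot> I) \<inter> J = K \<cdot> J"
  shows "\<exists>r. K \<cdot> ipow I (r + 2) = K \<cdot> J \<cdot> ipow I (r + 1)
    \<and> int r \<le> g\<^sub>1 + int (len (carrier R) K) - int (len (K \<cdot> I) (K \<cdot> J))"
proof -
  let ?R = "carrier R" and ?p = "ipow"
  have xy: "x \<in> ?R" "y \<in> ?R" using s by (auto simp: syz2_def)
  have iJ: "ideal J R" unfolding J by (intro dbl_ideal xy oneideal)
  note id = ipow_ideal[OF I] ipow_ideal[OF iJ] I iJ K ideal_prod_is_ideal
  define F where "F n = K \<cdot> ?p I n" for n
  have iF: "ideal (F n) R" for n unfolding F_def by (intro id)
  have IF: "I \<cdot> F n = F (Suc n)" for n
    unfolding F_def ipow_Suc[OF I] by (intro ideal_prod_lcomm id)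
  have JF: "J \<cdot> F n \<subseteq> F (Suc n)" for n unfolding IF[symmetric] by (intro ideal_prod_mono JI subset_refl)
  have JF_eq: "J \<cdot> F n = F (Suc n)" if nc: "n \<ge> c" for n
  proof -
    obtain k where n: "n = c + k" using le_Suc_ex[OF nc] by blast
    have "J \<cdot> ?p I n = ?p I (Suc n)"
    proof -
      have "J \<cdot> ?p I n = J \<cdot> (?p J k \<cdot> ?p I c)" unfolding n reduction_power[OF I iJ c] ..
      also have "\<dots> = ?p J (Suc k) \<cdot> ?p I c" unfolding ipow_Suc[OF iJ] by (intro ideal_prod_assoc[symmetric] id)
      also have "\<dots> = ?p I (Suc n)" unfolding n reduction_power[OF I iJ c, of "Suc k", symmetric] by simp
      finally show ?thesis .
    qed
    moreover have "J \<cdot> F n = K \<cdot> (J \<cdot> ?p I n)" unfolding F_def by (intro ideal_prod_lcomm id)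
    ultimately show ?thesis unfolding F_def by metis
  qed
  have JpF: "?p J (Suc n) \<subseteq> F n" for n
    unfolding ipow_Suc[OF iJ] F_def by (intro ideal_prod_mono subset_trans[OF JI IK] ipow_mono iJ I JI)
  have finF: "ilen A B \<noteq> \<infinity>" if "F n \<subseteq> B" "A \<subseteq> ?R" for A B n
    by (rule ilen_finite_mono[OF fin[OF subset_refl] that(2) subset_trans[OF JpF that(1)]])
  have finJF: "ilen A (J \<cdot> B) \<noteq> \<infinity>" if "F n \<subseteq> B" "A \<subseteq> ?R" for A B n
  proof -
    have "?p J (Suc (Suc n)) \<subseteq> J \<cdot> B" unfolding ipow_Suc[OF iJ, of "Suc n"]
      by (rule ideal_prod_mono[OF subset_refl subset_trans[OF JpF that(1)]])
    then show ?thesis by (rule ilen_finite_mono[OF fin[OF subset_refl] that(2)])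
  qed
  have dblJ: "J \<cdot> B = dbl x y B" if "ideal B R" for B unfolding J by (rule dbl_prod[OF xy that])
  have main: "len ?R (J \<cdot> B) + len ?R (colon B J) = len ?R J + 2 * len ?R B"
    if B: "ideal B R" "F n \<subseteq> B" for B n
    using len_dbl[OF s B(1)] finJF[OF B(2) subset_refl] unfolding dblJ[OF B(1)] J[symmetric] by simp
  let ?e = "int (len ?R J)"
  define N where "N = max n0 c"
  have choose: "int ((Suc (Suc n) + 1) choose 2) - 2 * int ((Suc n + 1) choose 2) + int ((n + 1) choose 2) = 1" for n
    by (simp add: numeral_2_eq_2)
  \<comment> \<open>Two expressions for one second difference: the Hilbert polynomial gives g_0, and
    \<open>len_dbl\<close> gives length(R/J) plus the excess of the colon ideal over
    \<open>F n\<close>. Thus equality of g_0 and length(R/J) forces this excess to vanish.\<close>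
  have w: "?e + int (len (colon (F (Suc n)) J) (F n)) = g\<^sub>0 \<and> F n \<subseteq> colon (F (Suc n)) J" if n: "n \<ge> N" for n
  proof -
    have ic: "ideal (colon (F (Suc n)) J) R" by (rule colon_ideal[OF iF ideal_sub[OF iJ]])
    have sub: "F n \<subseteq> colon (F (Suc n)) J"
      using le_colon_iff[OF iF iJ iF] JF[of n] ideal_prod_commute[OF iF iJ] by simp
    have "len ?R (F n) = len ?R (colon (F (Suc n)) J) + len (colon (F (Suc n)) J) (F n)"
      by (intro len_add oneideal ic iF sub ideal_sub[OF ic] finF[OF subset_refl] subset_refl)
    moreover have "len ?R (F (Suc (Suc n))) + len ?R (colon (F (Suc n)) J) = len ?R J + 2 * len ?R (F (Suc n))"
      using main[OF iF subset_refl, of "Suc n"] JF_eq[of "Suc n"] n by (simp add: N_def)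
    ultimately have "int (len ?R (F (Suc (Suc n)))) - 2 * int (len ?R (F (Suc n))) + int (len ?R (F n))
      = ?e + int (len (colon (F (Suc n)) J) (F n))" by linarith
    moreover have "int (len ?R (F (Suc (Suc n)))) - 2 * int (len ?R (F (Suc n))) + int (len ?R (F n))
      = g\<^sub>0 * (int ((Suc (Suc n) + 1) choose 2) - 2 * int ((Suc n + 1) choose 2) + int ((n + 1) choose 2))"
      using H[of n] H[of "Suc n"] H[of "Suc (Suc n)"] n unfolding F_def N_def
      by (simp del: binomial_Suc_Suc nat_pow_Suc add: algebra_simps)
    ultimately show ?thesis using sub choose[of n] by simp
  qed
  \<comment> \<open>J^(n+1) lies in \<open>F n\<close>, so \<open>len_dbl_power\<close> bounds the
    Hilbert polynomial by a polynomial with leading coefficient half of \<open>?e\<close>; comparing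
    the quadratic terms gives the inequality.\<close>
  have "g\<^sub>0 - ?e \<le> 0"
  proof (rule quadratic_le_linear)
    fix n assume n: "n \<ge> N"
    have "len ?R (F n) \<le> len ?R (?p J (Suc n))" by (intro len_mono subset_refl JpF fin)
    then have "2 * len ?R (F n) \<le> len ?R J * (Suc n * (Suc n + 1))"
      using len_dbl_power[OF xy J fin[OF subset_refl], of "Suc n"] by linarith
    then have "2 * int (len ?R (F n)) \<le> ?e * ((int n + 1) * (int n + 2))"
      by (metis (mono_tags, lifting) of_nat_le_iff of_nat_mult of_nat_numeral of_nat_add of_nat_1 Suc_eq_plus1 add.assoc one_add_one)
    moreover have "2 * int (len ?R (F n)) = g\<^sub>0 * (int n * (int n + 1)) - 2 * g\<^sub>1 * int n + 2 * g\<^sub>2"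
    proof -
      have "int (len ?R (F n)) = g\<^sub>0 * int ((n + 1) choose 2) - g\<^sub>1 * int n + g\<^sub>2"
        using H[of n] n unfolding F_def N_def by simp
      then have "2 * int (len ?R (F n)) = g\<^sub>0 * (2 * int ((n + 1) choose 2)) - 2 * g\<^sub>1 * int n + 2 * g\<^sub>2"
        by simp
      then show ?thesis unfolding two_choose_two .
    qed
    ultimately show "(g\<^sub>0 - ?e) * int n ^ 2 \<le> (3 * ?e - g\<^sub>0 + 2 * g\<^sub>1) * int n + (2 * ?e - 2 * g\<^sub>2)"
      by (simp add: algebra_simps power2_eq_square)
  qed
  then have g0: "g\<^sub>0 = ?e" using w[of N] by linarith
  have colF: "colon (F (Suc n)) J = F n" if "n \<ge> N" for n
  proof (rule len_strict[OF _ iF])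
    show "ideal (colon (F (Suc n)) J) R" by (rule colon_ideal[OF iF ideal_sub[OF iJ]])
    show "F n \<subseteq> colon (F (Suc n)) J" "len (colon (F (Suc n)) J) (F n) = 0" using w[OF that] g0 by auto
    show "ilen ?R (F n) \<noteq> \<infinity>" by (rule finF[OF subset_refl subset_refl])
  qed
  \<comment> \<open>The union of the \<open>F (n + k) : J\<^sup>k\<close> stabilises once \<open>n + k \<ge> N\<close>; for \<open>n > N\<close> truncated
    subtraction gives \<open>F n : R = F n\<close>.\<close>
  define M where "M n = colon (F (max n N)) (?p J (N - n))" for n
  have iM: "ideal (M n) R" for n unfolding M_def by (intro colon_ideal iF ideal_sub id)
  have M_large: "M n = F n" if "n \<ge> N" for n
    using that colon_carrier[OF iF] by (simp add: M_def max_absorb1 ideals_set_one)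
  have FpJ: "?p J k \<cdot> F n \<subseteq> F (n + k)" for k n
  proof (induction k)
    case 0
    then show ?case using ideal_prod_sub(2)[OF oneideal iF] by (simp add: ideals_set_one)
  next
    case (Suc k)
    have "?p J (Suc k) \<cdot> F n = J \<cdot> (?p J k \<cdot> F n)" unfolding ipow_Suc[OF iJ] by (intro ideal_prod_assoc id iF)
    also have "\<dots> \<subseteq> J \<cdot> F (n + k)" by (intro ideal_prod_mono subset_refl Suc)
    also have "\<dots> \<subseteq> F (n + Suc k)" using JF[of "n + k"] by simp
    finally show ?case .
  qed
  have FM: "F n \<subseteq> M n" for n
  proof (cases "n \<ge> N")
    case False
    then show ?thesis unfolding M_def using FpJ[of "N - n" n]
      by (simp add: le_colon_iff[OF iF id(2) iF] ideal_prod_commute[OF iF id(2)] max_absorb2)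
  qed (simp add: M_large)
  have colM: "colon (M (Suc n)) J = M n" for n
  proof (cases "n \<ge> N")
    case True
    then show ?thesis by (simp add: M_large colF)
  next
    case False
    then have "N - n = Suc (N - Suc n)" by simp
    then show ?thesis using False colon_colon[OF iF id(2) iJ, of N "N - Suc n"] ipow_Suc[OF iJ, of "N - Suc n"]
      by (simp add: M_def max_absorb2 del: nat_pow_Suc)
  qed
  have IM: "I \<cdot> M n \<subseteq> M (Suc n)" for n
  proof (cases "n \<ge> N")
    case True
    then show ?thesis by (simp add: M_large IF)
  next
    case False
    \<comment> \<open>One factor J is cancelled: M_n J^(k+1) lies in F_N, so (I M_n J^k) J lies in
      F_(N+1), and F_(N+1) : J is F_N.\<close>
    let ?k = "N - Suc n"
    have k: "N - n = Suc ?k" using False by simp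
    have "M n = colon (F N) (?p J (Suc ?k))" using False by (simp add: M_def max_absorb2 k del: nat_pow_Suc)
    then have "M n \<cdot> ?p J (Suc ?k) \<subseteq> F N"
      using le_colon_iff[OF iF[of N] ipow_ideal[OF iJ, of "Suc ?k"] iM[of n]] by blast
    then have "I \<cdot> (M n \<cdot> ?p J (Suc ?k)) \<subseteq> F (Suc N)" unfolding IF[symmetric] by (intro ideal_prod_mono subset_refl)
    moreover have "I \<cdot> (M n \<cdot> ?p J (Suc ?k)) = (I \<cdot> M n) \<cdot> ?p J ?k \<cdot> J"
      unfolding ipow_Suc[OF iJ] by (simp only: ideal_prod_ac id iM)
    ultimately have "(I \<cdot> M n) \<cdot> ?p J ?k \<subseteq> F N"
      using le_colon_iff[OF iF[of "Suc N"] iJ ideal_prod_is_ideal[OF ideal_prod_is_ideal[OF I iM[of n]] ipow_ideal[OF iJ, of ?k]]]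
        colF[of N] by simp
    then have "I \<cdot> M n \<subseteq> colon (F N) (?p J ?k)"
      using le_colon_iff[OF iF[of N] ipow_ideal[OF iJ, of ?k] ideal_prod_is_ideal[OF I iM[of n]]] by blast
    then show ?thesis using False by (simp add: M_def max_absorb2)
  qed
  have JM: "J \<cdot> M n \<subseteq> M (Suc n)" for n using ideal_prod_mono[OF JI subset_refl] IM by blast
  have iJM: "ideal (J \<cdot> M n) R" for n by (intro id iM)
  define h where "h n = int (len ?R (M n))" for n
  define l where "l n = int (len (M (Suc n)) (J \<cdot> M n))" for n
  have lh: "len ?R (J \<cdot> M n) = len ?R (M (Suc n)) + len (M (Suc n)) (J \<cdot> M n)" for n
    by (intro len_add oneideal iM iJM JM ideal_sub[OF iM] finJF[OF FM] subset_refl)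
  \<comment> \<open>The missing predecessor of \<open>M 0\<close> is the whole ring, because J lies
    in \<open>M 0\<close>; so this is the pattern of \<open>lS\<close> with 0 as the preceding value
    of \<open>h\<close>.\<close>
  have l0: "l 0 = ?e + 2 * h 0 - h 1"
  proof -
    have "J \<subseteq> M 0" using FM[of 0] JI IK ideal_prod_one[OF K] by (auto simp: F_def ideals_set_one)
    then have "colon (M 0) J = ?R" using ideal_l[OF iM] by (auto simp: colon_def)
    then show ?thesis using main[OF iM FM, of 0] lh[of 0] len_self[of ?R] unfolding h_def l_def by simp
  qed
  have lS: "l (Suc n) = ?e + 2 * h (Suc n) - h n - h (Suc (Suc n))" for n
    using main[OF iM FM, of "Suc n"] lh[of "Suc n"] colM[of n] unfolding h_def l_def by simp
  have tele: "(\<Sum>i\<le>n. l i) = ?e * int (Suc n) + h 0 + h n - h (Suc n)" for n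
    by (induction n) (simp_all add: l0 lS algebra_simps)
  \<comment> \<open>The telescoped sum involves \<open>h\<close> at its end only through a first
    difference, which from \<open>N\<close> on is that of the Hilbert polynomial and brings in
    g_1.\<close>
  have hN: "h (Suc N) - h N = g\<^sub>0 * int (Suc N) - g\<^sub>1"
  proof -
    have hF: "h n = g\<^sub>0 * int ((n + 1) choose 2) - g\<^sub>1 * int n + g\<^sub>2" if "n \<ge> N" for n
      using H[of n] that unfolding h_def M_large[OF that] F_def by (simp add: N_def)
    have "int ((Suc N + 1) choose 2) = int ((N + 1) choose 2) + int (Suc N)" by (simp add: numeral_2_eq_2)
    then have "h (Suc N) = g\<^sub>0 * (int ((N + 1) choose 2) + int (Suc N)) - g\<^sub>1 * int (Suc N) + g\<^sub>2"
      using hF[of "Suc N"] by simp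
    then show ?thesis using hF[of N] by (simp add: algebra_simps)
  qed
  have total: "(\<Sum>i\<le>N. l i) = g\<^sub>1 + h 0" using tele[of N] hN g0 by simp

  \<comment> \<open>What K, K I and the preceding degree supply in degree \<open>n\<close>; new
    generators are required only for the quotient of \<open>M n\<close> by it.\<close>
  define B where "B n = (if n = 0 then K else if n = 1 then ladd \<one> (K \<cdot> I) (J \<cdot> M 0) else J \<cdot> M (n - 1))" for n
  have KIM: "K \<cdot> I \<subseteq> M 1" using FM[of 1] ipow_1[OF I] by (simp add: F_def)
  have iKI: "ideal (K \<cdot> I) R" by (intro id)
  have iB: "ideal (B n) R" for n unfolding B_def using K iJM iKI ladd_ideal[OF one_closed iKI iJM] by simp
  have BM: "B n \<subseteq> M n" for n
  proof -
    consider "n = 0" | "n = 1" | m where "n = Suc (Suc m)" by (metis One_nat_def not0_implies_Suc)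
    then show ?thesis
    proof cases
      case 1
      then show ?thesis using FM[of 0] ideal_prod_one[OF K] by (simp add: B_def F_def ideals_set_one)
    next
      case 2
      have "ladd \<one> (K \<cdot> I) (J \<cdot> M 0) \<subseteq> M 1"
        using JM[of 0] KIM ideal_carr[OF iKI] by (intro ladd_least[OF iM]) auto
      then show ?thesis using 2 by (simp add: B_def)
    next
      case 3
      then show ?thesis using JM[of "Suc m"] by (simp add: B_def)
    qed
  qed
  have finB: "ilen A (B n) \<noteq> \<infinity>" if "A \<subseteq> ?R" for A n
  proof -
    consider "n = 0" | "n = 1" | m where "n = Suc (Suc m)" by (metis One_nat_def not0_implies_Suc)
    then show ?thesis
    proof cases
      case 1
      have "F 0 \<subseteq> K" using ideal_prod_one[OF K] by (simp add: F_def ideals_set_one)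
      then show ?thesis using 1 finF[OF _ that] by (simp add: B_def)
    next
      case 2
      have "F 1 \<subseteq> B 1" using ladd_one_sub(1)[OF iKI iJM] ipow_1[OF I] by (simp add: B_def F_def)
      then show ?thesis using 2 finF[OF _ that] by simp
    next
      case 3
      then show ?thesis using finJF[OF FM that] by (simp add: B_def)
    qed
  qed
  have "\<exists>Y. finite Y \<and> Y \<subseteq> M n \<and> enat (card Y) \<le> ilen (M n) (B n)
      \<and> (\<forall>C. ideal C R \<longrightarrow> B n \<subseteq> C \<longrightarrow> Y \<subseteq> C \<longrightarrow> M n \<subseteq> C)" for n
    by (intro ilen_gens iM iB BM finB ideal_sub[OF iM])
  then obtain Y where Y: "\<And>n. finite (Y n)" "\<And>n. Y n \<subseteq> M n" "\<And>n. enat (card (Y n)) \<le> ilen (M n) (B n)"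
    "\<And>n C. ideal C R \<Longrightarrow> B n \<subseteq> C \<Longrightarrow> Y n \<subseteq> C \<Longrightarrow> M n \<subseteq> C" by metis
  have cY: "int (card (Y n)) \<le> int (len (M n) (B n))" for n
  proof -
    obtain m where m: "ilen (M n) (B n) = enat m" using finB[OF ideal_sub[OF iM]] by (cases rule: enat.exhaust) blast+
    show ?thesis using Y(3)[of n] unfolding len_def m by simp
  qed
  \<comment> \<open>Pairs of a degree and an element, so that an element chosen in several degrees
    is counted in each. Beyond degree \<open>Suc N\<close> the ideal J times the preceding component
    is all of \<open>M n\<close>.\<close>
  define S where "S = Sigma {..Suc N} Y"
  have fS: "finite S" unfolding S_def using Y(1) by blast
  have cS: "card S = (\<Sum>n\<le>Suc N. card (Y n))" unfolding S_def using Y(1) by (simp add: card_SigmaI)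
  have c0: "int (len (M 0) (B 0)) = int (len ?R K) - h 0"
  proof -
    have "len ?R (B 0) = len ?R (M 0) + len (M 0) (B 0)"
      by (intro len_add oneideal iM iB BM ideal_sub[OF iM] finB subset_refl)
    then show ?thesis unfolding h_def by (simp add: B_def)
  qed
  \<comment> \<open>The gain in degree 1: B_1 modulo J M_0 is K I modulo K I \<inter> J M_0. This
    intersection lies in K I \<inter> J, which is K J by \<open>cap\<close>, and contains K J
    because K lies in M_0.\<close>
  have c1: "int (len (M 1) (B 1)) = l 0 - int (len (K \<cdot> I) (K \<cdot> J))"
  proof -
    have "len (M 1) (J \<cdot> M 0) = len (M 1) (B 1) + len (B 1) (J \<cdot> M 0)"
      using ladd_one_sub(2)[OF iKI iJM]
      by (intro len_add iM iB iJM BM finJF[OF FM] subset_refl) (simp add: B_def)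
    moreover have "len (B 1) (J \<cdot> M 0) = len (K \<cdot> I) (K \<cdot> I \<inter> colon (J \<cdot> M 0) {\<one>})"
      unfolding B_def using len_ladd[OF one_closed iKI iJM] by simp
    moreover have "K \<cdot> I \<inter> colon (J \<cdot> M 0) {\<one>} = K \<cdot> J"
    proof
      have "colon (J \<cdot> M 0) {\<one>} \<subseteq> J" using ideal_prod_sub(1)[OF iJ iM[of 0]] by (auto simp: colon_def)
      then show "K \<cdot> I \<inter> colon (J \<cdot> M 0) {\<one>} \<subseteq> K \<cdot> J" using cap by blast
      have "K \<cdot> J = J \<cdot> K" by (intro ideal_prod_commute id)
      also have "\<dots> \<subseteq> J \<cdot> M 0" using BM[of 0] by (intro ideal_prod_mono) (simp_all add: B_def)
      finally have "K \<cdot> J \<subseteq> colon (J \<cdot> M 0) {\<one>}"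
        using ideal_carr[OF ideal_prod_is_ideal[OF K iJ]] by (auto simp: colon_def)
      then show "K \<cdot> J \<subseteq> K \<cdot> I \<inter> colon (J \<cdot> M 0) {\<one>}" using cap by blast
    qed
    ultimately show ?thesis unfolding l_def by simp
  qed
  have c2: "int (len (M (Suc (Suc n))) (B (Suc (Suc n)))) = l (Suc n)" for n
    unfolding l_def B_def by simp
  have bound: "(\<Sum>n\<le>Suc m. int (len (M n) (B n))) = int (len ?R K) - h 0 + (\<Sum>i\<le>m. l i) - int (len (K \<cdot> I) (K \<cdot> J))" for m
  proof (induction m)
    case 0
    then show ?case using c0 c1 by simp
  next
    case (Suc m)
    then show ?case using c2[of m] by simp
  qed
  have "int (card S) \<le> (\<Sum>n\<le>Suc N. int (len (M n) (B n)))"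
    unfolding cS of_nat_sum by (rule sum_mono) (rule cY)
  \<comment> \<open>The term \<open>h 0\<close> from \<open>total\<close> cancels the one from
    \<open>c0\<close>: the generators of degree 0 replace length(R/M_0) by length(R/K).\<close>
  also have "\<dots> = g\<^sub>1 + int (len ?R K) - int (len (K \<cdot> I) (K \<cdot> J))" unfolding bound total by simp
  finally have cardS: "int (card S) \<le> g\<^sub>1 + int (len ?R K) - int (len (K \<cdot> I) (K \<cdot> J))" .
  have "K \<cdot> ?p I (card S + 2) = K \<cdot> J \<cdot> ?p I (card S + 1)"
  proof (rule determinant_trick[where y = snd and d = fst and M = M, OF I iJ K JI fS _ IM KIM])
    show yM: "snd k \<in> M (fst k)" if "k \<in> S" for k
      using that subsetD[OF Y(2)[of "fst k"]] by (auto simp: S_def)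
    show "snd k \<in> ?R" if "k \<in> S" for k using ideal_carr[OF iM yM[OF that]] .
    fix n C assume C: "ideal C R" "n = 0 \<Longrightarrow> K \<subseteq> C" "n = 1 \<Longrightarrow> K \<cdot> I \<subseteq> C" "n > 0 \<Longrightarrow> J \<cdot> M (n - 1) \<subseteq> C"
      "\<And>k. k \<in> S \<Longrightarrow> fst k = n \<Longrightarrow> snd k \<in> C"
    show "M n \<subseteq> C"
    proof (cases "n \<le> Suc N")
      case True
      have "Y n \<subseteq> C"
      proof
        fix v assume "v \<in> Y n"
        then show "v \<in> C" using C(5)[of "(n, v)"] True by (simp add: S_def)
      qed
      moreover have "B n \<subseteq> C"
      proof -
        have "ladd \<one> (K \<cdot> I) (J \<cdot> M 0) \<subseteq> C" if "n = 1"
          using C(3,4) that ideal_carr[OF iKI] by (intro ladd_least[OF C(1)]) auto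
        then show ?thesis unfolding B_def using C(2,4) by simp
      qed
      ultimately show ?thesis using Y(4)[OF C(1)] by blast
    next
      case False
      then have "N \<le> n" "N \<le> n - 1" "c \<le> n - 1" by (auto simp: N_def)
      then have "M n = J \<cdot> M (n - 1)"
        using M_large[of n] M_large[of "n - 1"] JF_eq[of "n - 1"] False by simp
      then show ?thesis using C(4) False by simp
    qed
  qed
  then show ?thesis using cardS by blast
qed

end

section \<open>The bound for the reduction number\<close>

theorem corollary3p5:
  fixes R :: "('a, 'b) ring_scheme" (structure)
    and \<mm> I J K :: "'a set"
    and g\<^sub>0 g\<^sub>1 g\<^sub>2 :: int
  assumes "cohen_macaulay_local_ring R \<mm>"
    and "krull_dim R = 2"
    and "infinite (carrier (R Quot \<mm>))"
    and "primary_to R \<mm> I"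
    and "ideal K R" and "I \<subseteq> K"
    and "minimal_reduction R J I"
    and "fiber_hilbert_coeffs R K I g\<^sub>0 g\<^sub>1 g\<^sub>2"
    and "(K \<cdot> I) \<inter> J = K \<cdot> J"
  shows "int (reduction_number R K J I)
           \<le> g\<^sub>1 - int (quot_length R (K \<cdot> I) (K \<cdot> J)) + 1 + int (quot_length R (carrier R) K)"
proof -
  interpret CM: cohen_macaulay_local_ring R \<mm> by fact
  have I: "ideal I R" and rad: "ideal_radical R I = \<mm>"
    using assms(4) by (auto simp: primary_to_def primaryideal_def)
  have iJ: "ideal J R" and JI: "J \<subseteq> I"
    using assms(7) by (auto simp: minimal_reduction_def reduction_def)
  obtain c where c: "J \<cdot> ideal_power R I c = ideal_power R I (c + 1)"
    using assms(7) by (auto simp: minimal_reduction_def reduction_def)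
  obtain x y where xy: "x \<in> carrier R" "y \<in> carrier R" and J: "J = CM.dbl x y (carrier R)"
    using CM.minimal_reduction_two_generated[OF assms(3) I rad assms(5,6,7,8)] by blast
  have cJ: "ideal_power R I (c + 1) \<subseteq> J"
    using c CM.ideal_prod_sub(1)[OF iJ CM.ipow_ideal[OF I]] by metis
  \<comment> \<open>J contains a power of I, and every element of \<mm> has a power in I; so every
    element of \<mm> has a power in (x, y).\<close>
  have "CM.syz2 x y"
  proof (rule CM.syz2_of_radical[OF assms(2) xy])
    fix a assume "a \<in> \<mm>"
    then obtain n :: nat where n: "a \<in> carrier R" "a [^] n \<in> I" using rad by (auto simp: ideal_radical_def)
    have "(a [^] n) [^] (c + 1) \<in> J" using CM.pow_mem_ipow[OF I n(2)] cJ by blast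
    then have "a [^] (n * (c + 1)) \<in> J" unfolding CM.nat_pow_pow[OF n(1)] .
    then show "\<exists>n::nat. a [^] n \<in> CM.dbl x y (carrier R)" unfolding J by blast
  qed
  moreover have "CM.ilen A (ideal_power R J n) \<noteq> \<infinity>" if "A \<subseteq> carrier R" for A n
  proof (rule CM.primary_power_finite[OF I rad _ that])
    show "ideal_power R I (c + n) \<subseteq> ideal_power R J n"
      unfolding CM.reduction_power[OF I iJ c]
      by (intro CM.ideal_prod_sub CM.ipow_ideal I iJ)
  qed
  moreover obtain n0 where "\<And>n. n \<ge> n0 \<Longrightarrow> int (quot_length R (carrier R) (K \<cdot> ideal_power R I n))
      = g\<^sub>0 * int ((n + 1) choose 2) - g\<^sub>1 * int n + g\<^sub>2"
    using assms(8) unfolding fiber_hilbert_coeffs_def eventually_sequentially by blast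
  moreover have ql: "quot_length R A B = CM.len A B" if "ideal A R" "ideal B R" "B \<subseteq> A" for A B
    using CM.quot_length_eq[OF that] by (simp add: CM.len_def)
  have "quot_length R (carrier R) (K \<cdot> ideal_power R I n) = CM.len (carrier R) (K \<cdot> ideal_power R I n)" for n
  proof -
    have "ideal (K \<cdot> ideal_power R I n) R"
      by (intro CM.ideal_prod_is_ideal assms(5) CM.ipow_ideal I)
    then show ?thesis using ql[OF CM.oneideal] CM.ideal_sub by blast
  qed
  ultimately obtain r where r: "K \<cdot> ideal_power R I (r + 2) = K \<cdot> J \<cdot> ideal_power R I (r + 1)"
    "int r \<le> g\<^sub>1 + int (CM.len (carrier R) K) - int (CM.len (K \<cdot> I) (K \<cdot> J))"
    using CM.fiber_bound[OF _ J I assms(5) JI assms(6) c, of n0 g\<^sub>0 g\<^sub>1 g\<^sub>2] assms(9) by metis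
  \<comment> \<open>In the definition of the reduction number n is the exponent of I next to J, here
    \<open>r + 1\<close>; this shift is the summand 1 of the bound.\<close>
  have "reduction_number R K J I \<le> r + 1"
    unfolding reduction_number_def by (rule Least_le) (use r(1) in \<open>simp only: add.assoc one_add_one\<close>)
  moreover have "quot_length R (carrier R) K = CM.len (carrier R) K"
    by (intro ql CM.oneideal assms(5) CM.ideal_sub)
  moreover have "quot_length R (K \<cdot> I) (K \<cdot> J) = CM.len (K \<cdot> I) (K \<cdot> J)"
    by (intro ql CM.ideal_prod_is_ideal assms(5) I iJ CM.ideal_prod_mono subset_refl JI)
  ultimately show ?thesis using r(2) by linarith
qed

end
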